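(* Let $X$ be a complex Banach space and $1\le p\le\infty$. Then $\mathcal{H}_p(X)\subset\mathcal{H}_p^{+}(X)$ and the inclusion is isometric, i.e. $\|D\|_{\mathcal{H}_p^+(X)}=\|D\|_{\mathcal{H}_p(X)}$ for every $D\in\mathcal{H}_p(X)$.
   Context: $\mathbb{N}_0=\mathbb{N}\cup\{0\}$; $\mathbb{Z}^{(\mathbb{N})}$ (resp. $\mathbb{N}_0^{(\mathbb{N})}$) is the set of eventually zero sequences of integers (resp. of elements of $\mathbb{N}_0$). $\mathfrak{p}=(\mathfrak{p}_1<\mathfrak{p}_2<\dots)$ is the sequence of primes and $\mathfrak{p}^\alpha=\prod_j\mathfrak{p}_j^{\alpha_j}$, so every $n\in\mathbb{N}$ equals $\mathfrak{p}^\alpha$ for a unique $\alpha\in\mathbb{N}_0^{(\mathbb{N})}$. $\mathbb{T}^{\mathbb{N}}$ is the infinite-dimensional torus with normalized Haar measure $d\omega$; $L_p(\mathbb{T}^{\mathbb{N}},X)$ is the Bochner space of $p$-integrable functions ($p<\infty$), resp. of essentially bounded (strongly) measurable functions ($p=\infty$). For $\alpha\in\mathbb{Z}^{(\mathbb{N})}$ put $\omega^\alpha=\prod_j\omega_j^{\alpha_j}$ and $\widehat f(\alpha)=\int_{\mathbb{T}^{\mathbb{N}}}f(\omega)\omega^{-\alpha}\,d\omega$. $H_p(\mathbb{T}^{\mathbb{N}},X)$ is the closed subspace of those $f\in L_p(\mathbb{T}^{\mathbb{N}},X)$ with $\widehat f(\alpha)=0$ for all $\alpha\in\mathbb{Z}^{(\mathbb{N})}\setminus\mathbb{N}_0^{(\mathbb{N})}$.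 A Dirichlet series in $X$ is a formal series $D=\sum_n a_n n^{-s}$ with $a_n\in X$, identified with its coefficient sequence. $\mathcal{H}_p(X)$ is the space of Dirichlet series $D=\sum_n a_nn^{-s}$ for which there is a (unique) $f\in H_p(\mathbb{T}^{\mathbb{N}},X)$ with $\widehat f(\alpha)=a_{\mathfrak{p}^\alpha}$ for all $\alpha\in\mathbb{N}_0^{(\mathbb{N})}$, with norm $\|D\|_{\mathcal{H}_p(X)}=\|f\|_{L_p(\mathbb{T}^{\mathbb{N}},X)}$. For $z\in\mathbb{C}$ the translate of $D$ is $D_z=\sum_n \frac{a_n}{n^z}n^{-s}$. $\mathcal{H}_p^+(X)$ is the space of Dirichlet series $D$ in $X$ such that $D_\varepsilon\in\mathcal{H}_p(X)$ for every $\varepsilon>0$ and $\|D\|_{\mathcal{H}_p^+(X)}:=\sup_{\varepsilon>0}\|D_\varepsilon\|_{\mathcal{H}_p(X)}<\infty$. *)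

theory Defs
  imports "HOL-Probability.Probability" "HOL-Library.Infinite_Set"
    "HOL-Computational_Algebra.Primes"
begin

section \<open>Complex Banach spaces\<close>

class complex_banach = banach +
  fixes scaleC :: "complex \<Rightarrow> 'a \<Rightarrow> 'a"
  assumes scaleC_add_right: "scaleC c (x + y) = scaleC c x + scaleC c y"
    and scaleC_add_left: "scaleC (c + d) x = scaleC c x + scaleC d x"
    and scaleC_scaleC: "scaleC c (scaleC d x) = scaleC (c * d) x"
    and scaleC_of_real: "scaleC (of_real r) x = r *\<^sub>R x"
    and norm_scaleC: "norm (scaleC c x) = cmod c * norm x"

instantiation complex :: complex_banach
begin

definition "scaleC c x = c * (x :: complex)"

instance
  by standard (auto simp: scaleC_complex_def algebra_simps norm_mult scaleR_conv_of_real)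

end

section \<open>The Bochner integral in an arbitrary Banach space\<close>

text \<open>
  The Bochner integral of HOL-Analysis is restricted to second countable value spaces, that is to
  separable Banach spaces. The following definitions drop this restriction: Borel measurability is
  replaced by strong measurability, and everything else is as in the library.
  The lemmas below show agreement with the library for separable value spaces.
\<close>

definition strongly_measurable :: "'a measure \<Rightarrow> ('a \<Rightarrow> 'b::real_normed_vector) \<Rightarrow> bool" where
  "strongly_measurable M f \<longleftrightarrow>
     (\<exists>s. (\<forall>n::nat. simple_function M (s n)) \<and> (\<forall>x\<in>space M. (\<lambda>n. s n x) \<longlonglongrightarrow> f x))"

definition has_strong_integral :: "'a measure \<Rightarrow> ('a \<Rightarrow> 'b::real_normed_vector) \<Rightarrow> 'b \<Rightarrow> bool" where
  "has_strong_integral M f I \<longleftrightarrow> strongly_measurable M f \<and>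
     (\<exists>s. (\<forall>n::nat. Bochner_Integration.simple_bochner_integrable M (s n)) \<and>
          (\<lambda>n. \<integral>\<^sup>+x. ennreal (norm (f x - s n x)) \<partial>M) \<longlonglongrightarrow> 0 \<and>
          (\<lambda>n. Bochner_Integration.simple_bochner_integral M (s n)) \<longlonglongrightarrow> I)"

definition strong_integral :: "'a measure \<Rightarrow> ('a \<Rightarrow> 'b::real_normed_vector) \<Rightarrow> 'b" where
  "strong_integral M f = (THE I. has_strong_integral M f I)"

lemma strongly_measurable_iff_borel_measurable:
  fixes f :: "'a \<Rightarrow> 'b::{real_normed_vector, second_countable_topology}"
  shows "strongly_measurable M f \<longleftrightarrow> f \<in> borel_measurable M"
proof
  assume "strongly_measurable M f"
  then obtain s where s: "\<And>n::nat. simple_function M (s n)"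
      "\<And>x. x \<in> space M \<Longrightarrow> (\<lambda>n. s n x) \<longlonglongrightarrow> f x"
    unfolding strongly_measurable_def by blast
  show "f \<in> borel_measurable M"
    by (rule borel_measurable_LIMSEQ_metric[of s])
      (auto intro: borel_measurable_simple_function s)
next
  assume "f \<in> borel_measurable M"
  then show "strongly_measurable M f"
    unfolding strongly_measurable_def
    using borel_measurable_implies_sequence_metric[of f M 0] by blast
qed

lemma has_strong_integral_iff_has_bochner_integral:
  fixes f :: "'a \<Rightarrow> 'b::{real_normed_vector, second_countable_topology}"
  shows "has_strong_integral M f I \<longleftrightarrow> has_bochner_integral M f I"
  unfolding has_strong_integral_def has_bochner_integral.simps
    strongly_measurable_iff_borel_measurable by auto

section \<open>Bochner-Lebesgue spaces\<close>

definition Lp_norm :: "ennreal \<Rightarrow> 'a measure \<Rightarrow> ('a \<Rightarrow> 'b::real_normed_vector) \<Rightarrow> ennreal" where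
  "Lp_norm p M f =
     (if p = \<infinity> then esssup M (\<lambda>x. ennreal (norm (f x)))
      else let I = \<integral>\<^sup>+x. ennreal (norm (f x) powr enn2real p) \<partial>M
           in if I = \<infinity> then \<infinity> else ennreal (enn2real I powr (1 / enn2real p)))"

text \<open>
  The elements are functions, not classes modulo equality almost everywhere. Each class has a
  representative that is strongly measurable in the above everywhere sense.
\<close>

definition Lp_space :: "ennreal \<Rightarrow> 'a measure \<Rightarrow> ('a \<Rightarrow> 'b::real_normed_vector) set" where
  "Lp_space p M = {f. strongly_measurable M f \<and> Lp_norm p M f < \<infinity>}"

section \<open>Hardy spaces on the infinite-dimensional torus\<close>

text \<open>Normalized arc length on the unit circle, and its countable power: the normalized Haar
  measures of the compact groups \<open>\<T>\<close> and \<open>\<T>\<^sup>\<nat>\<close>.\<close>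

definition circle_measure :: "complex measure" where
  "circle_measure =
     distr (uniform_measure lborel {0..<2 * pi}) (restrict_space borel (sphere 0 1)) cis"

definition torus :: "(nat \<Rightarrow> complex) measure" where
  "torus = PiM UNIV (\<lambda>_. circle_measure)"

definition fin_int_seqs :: "(nat \<Rightarrow> int) set" where
  "fin_int_seqs = {\<alpha>. finite {j. \<alpha> j \<noteq> 0}}"

definition fin_nat_seqs :: "(nat \<Rightarrow> int) set" where
  "fin_nat_seqs = {\<alpha> \<in> fin_int_seqs. \<forall>j. \<alpha> j \<ge> 0}"

definition monomial :: "(nat \<Rightarrow> int) \<Rightarrow> (nat \<Rightarrow> complex) \<Rightarrow> complex" where
  "monomial \<alpha> \<omega> = (\<Prod>j | \<alpha> j \<noteq> 0. \<omega> j powi \<alpha> j)"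

definition fourier_coeff ::
    "((nat \<Rightarrow> complex) \<Rightarrow> 'a::complex_banach) \<Rightarrow> (nat \<Rightarrow> int) \<Rightarrow> 'a" where
  "fourier_coeff f \<alpha> = strong_integral torus (\<lambda>\<omega>. scaleC (monomial (\<lambda>j. - \<alpha> j) \<omega>) (f \<omega>))"

definition hardy_torus :: "ennreal \<Rightarrow> ((nat \<Rightarrow> complex) \<Rightarrow> 'a::complex_banach) set" where
  "hardy_torus p =
     {f \<in> Lp_space p torus. \<forall>\<alpha>\<in>fin_int_seqs - fin_nat_seqs. fourier_coeff f \<alpha> = 0}"

section \<open>Hardy spaces of Dirichlet series\<close>

text \<open>A Dirichlet series is its sequence of coefficients \<open>a 1, a 2, \<dots>\<close>; the spurious entry
  \<open>a 0\<close> is fixed to be zero.\<close>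

definition dirichlet_series :: "(nat \<Rightarrow> 'a::complex_banach) set" where
  "dirichlet_series = {a. a 0 = 0}"

definition prime_power :: "(nat \<Rightarrow> int) \<Rightarrow> nat" where
  "prime_power \<alpha> = (\<Prod>j | \<alpha> j \<noteq> 0. enumerate {q::nat. prime q} j ^ nat (\<alpha> j))"

text \<open>\<open>f\<close> is the function on the torus associated with the Dirichlet series \<open>a\<close>; it is unique up to
  equality almost everywhere, so that the norm of \<open>a\<close> below does not depend on its choice.\<close>

definition bohr_lift ::
    "ennreal \<Rightarrow> (nat \<Rightarrow> 'a::complex_banach) \<Rightarrow> ((nat \<Rightarrow> complex) \<Rightarrow> 'a) \<Rightarrow> bool" where
  "bohr_lift p a f \<longleftrightarrow>
     f \<in> hardy_torus p \<and> (\<forall>\<alpha>\<in>fin_nat_seqs. fourier_coeff f \<alpha> = a (prime_power \<alpha>))"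

definition hardy_dirichlet :: "ennreal \<Rightarrow> (nat \<Rightarrow> 'a::complex_banach) set" where
  "hardy_dirichlet p = {a \<in> dirichlet_series. \<exists>f. bohr_lift p a f}"

definition hardy_dirichlet_norm :: "ennreal \<Rightarrow> (nat \<Rightarrow> 'a::complex_banach) \<Rightarrow> ennreal" where
  "hardy_dirichlet_norm p a = (THE r. \<exists>f. bohr_lift p a f \<and> r = Lp_norm p torus f)"

definition translate :: "complex \<Rightarrow> (nat \<Rightarrow> 'a::complex_banach) \<Rightarrow> nat \<Rightarrow> 'a" where
  "translate z a = (\<lambda>n. scaleC (1 / of_nat n powr z) (a n))"

definition hardy_dirichlet_plus_norm :: "ennreal \<Rightarrow> (nat \<Rightarrow> 'a::complex_banach) \<Rightarrow> ennreal" where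
  "hardy_dirichlet_plus_norm p a =
     (SUP \<epsilon>\<in>{0::real<..}. hardy_dirichlet_norm p (translate (of_real \<epsilon>) a))"

definition hardy_dirichlet_plus :: "ennreal \<Rightarrow> (nat \<Rightarrow> 'a::complex_banach) set" where
  "hardy_dirichlet_plus p =
     {a \<in> dirichlet_series.
        (\<forall>\<epsilon>>0. translate (complex_of_real \<epsilon>) a \<in> hardy_dirichlet p) \<and>
        hardy_dirichlet_plus_norm p a < \<infinity>}"

end

theory Submission
  imports Defs "HOL-Computational_Algebra.Polynomial"
begin

text \<open>
  Let \<open>f\<close> be the function on the torus that belongs to a Dirichlet series \<open>a\<close>. Multiplying \<open>a n\<close> by
  \<open>n\<close> to the power \<open>-\<epsilon>\<close> multiplies the Fourier coefficient of \<open>f\<close> at a nonnegative \<open>\<alpha>\<close> by the product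
  of the \<open>r j ^ \<alpha> j\<close>, where \<open>r j\<close> is the \<open>j\<close>-th prime to the power \<open>-\<epsilon>\<close>. This is what convolution with
  the product of the Poisson kernels of radii \<open>r j\<close> does, and convolution with a probability measure
  does not increase any \<open>L\<^sub>p\<close> norm. As \<open>\<epsilon>\<close> tends to 0, the convolutions tend to \<open>f\<close> in \<open>L\<^sub>1\<close>, hence a
  subsequence does so almost everywhere, and Fatou's lemma (or, for \<open>p = \<infinity>\<close>, the mere pointwise bound)
  shows that the norm of \<open>f\<close> is at most the supremum of the norms of the convolutions. The argument
  through \<open>L\<^sub>1\<close> treats all \<open>p\<close> alike, although there is no convergence in norm for \<open>p = \<infinity>\<close>.

  The Poisson measure of radius \<open>r\<close> is the image of arc length under the automorphism
  \<open>z \<mapsto> (z + r) / (1 + r z)\<close> of the disc: the mean over the circle of its \<open>k\<close>-th power is its value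
  \<open>r ^ k\<close> at the centre. So the convolution is \<open>g \<omega> = \<integral> f (\<omega> \<cdot> \<Phi> \<eta>) d\<eta>\<close>, where \<open>\<Phi>\<close> applies these maps
  coordinatewise. In this form only three facts about the map \<open>(\<omega>, \<eta>) \<mapsto> \<omega> \<cdot> \<Phi> \<eta>\<close> matter: it preserves
  the measure (\<open>distr_torus_shift\<close>), on average it multiplies monomials by constants
  (\<open>shift_monomial_integral\<close>), and it tends to the first projection as the radii tend to 1
  (\<open>shift_indicator_L1_tendsto\<close>). Only nonnegative exponents need to be evaluated, because
  the remaining coefficients of \<open>f\<close> vanish.

  Two tools carry everything from scalars to functions with values in a nonseparable Banach space.
  By \<open>strongly_integrable_induct\<close>, a property that passes to sums and to fast limits in \<open>L\<^sub>1\<close> holds for all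
  strongly integrable functions as soon as it holds for the functions \<open>indicator A \<omega> *\<^sub>R x\<close>. By
  \<open>torus_bounded_functional_class\<close>, which combines the Stone-Weierstrass theorem with Dynkin's theorem on
  \<open>\<pi>\<close>- and \<open>\<lambda>\<close>-systems, a property that passes to linear combinations and to bounded pointwise limits
  holds for all indicators as soon as it holds for the monomials. The second tool also yields the
  uniqueness of Fourier coefficients (\<open>fourier_coeff_zero_imp_AE_zero\<close>), without which the norm of a
  Dirichlet series would not be the norm of the function that it comes from.
\<close>

section \<open>Strongly measurable functions\<close>

lemma strongly_measurable_imp_borel[measurable_dest]:
  fixes f :: "'a \<Rightarrow> 'b::real_normed_vector"
  assumes "strongly_measurable M f"
  shows "f \<in> borel_measurable M"
proof -
  obtain s where s: "\<And>n::nat. simple_function M (s n)"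
      "\<And>x. x \<in> space M \<Longrightarrow> (\<lambda>n. s n x) \<longlonglongrightarrow> f x"
    using assms unfolding strongly_measurable_def by blast
  show ?thesis
    by (rule borel_measurable_LIMSEQ_metric[of s])
      (auto intro: borel_measurable_simple_function s)
qed

lemma strongly_measurable_simple: "simple_function M s \<Longrightarrow> strongly_measurable M s"
  unfolding strongly_measurable_def by (intro exI[of _ "\<lambda>_. s"]) auto

lemma strongly_measurable_compose2:
  assumes "strongly_measurable M f" "strongly_measurable M g"
    and p: "\<And>u v a b. u \<longlonglongrightarrow> a \<Longrightarrow> v \<longlonglongrightarrow> b \<Longrightarrow> (\<lambda>n::nat. p (u n) (v n)) \<longlonglongrightarrow> p a b"
  shows "strongly_measurable M (\<lambda>x. p (f x) (g x))"
proof -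
  obtain s where s: "\<And>n::nat. simple_function M (s n)" "\<And>x. x \<in> space M \<Longrightarrow> (\<lambda>n. s n x) \<longlonglongrightarrow> f x"
    using assms(1) unfolding strongly_measurable_def by blast
  obtain t where t: "\<And>n::nat. simple_function M (t n)" "\<And>x. x \<in> space M \<Longrightarrow> (\<lambda>n. t n x) \<longlonglongrightarrow> g x"
    using assms(2) unfolding strongly_measurable_def by blast
  show ?thesis unfolding strongly_measurable_def
    by (intro exI[of _ "\<lambda>n x. p (s n x) (t n x)"])
      (auto intro: p s t simple_function_compose2)
qed

lemma strongly_measurable_add:
  "strongly_measurable M f \<Longrightarrow> strongly_measurable M g \<Longrightarrow> strongly_measurable M (\<lambda>x. f x + g x)"
  by (rule strongly_measurable_compose2) (auto intro: tendsto_intros)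

lemma strongly_measurable_diff:
  "strongly_measurable M f \<Longrightarrow> strongly_measurable M g \<Longrightarrow> strongly_measurable M (\<lambda>x. f x - g x)"
  by (rule strongly_measurable_compose2) (auto intro: tendsto_intros)

lemma strongly_measurable_comp:
  assumes "strongly_measurable M f" "T \<in> measurable N M"
  shows "strongly_measurable N (\<lambda>x. f (T x))"
proof -
  obtain s where s: "\<And>n::nat. simple_function M (s n)" "\<And>x. x \<in> space M \<Longrightarrow> (\<lambda>n. s n x) \<longlonglongrightarrow> f x"
    using assms(1) unfolding strongly_measurable_def by blast
  have "simple_function N (\<lambda>x. s n (T x))" for n
    using simple_function_comp[OF assms(2) s(1)[of n]] .
  then show ?thesis unfolding strongly_measurable_def
    using measurable_space[OF assms(2)] s(2) by (intro exI[of _ "\<lambda>n x. s n (T x)"]) auto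
qed

text \<open>
  Replacing an approximating value by 0 wherever its norm exceeds twice that of the limit changes
  nothing eventually where the limit is nonzero, and gives 0 throughout where it is zero.
\<close>

lemma strongly_measurable_dominated_simple:
  fixes f :: "'a \<Rightarrow> 'b::real_normed_vector"
  assumes "strongly_measurable M f"
  obtains s where "\<And>n::nat. simple_function M (s n)" "\<And>x. x \<in> space M \<Longrightarrow> (\<lambda>n. s n x) \<longlonglongrightarrow> f x"
    "\<And>n x. x \<in> space M \<Longrightarrow> norm (s n x) \<le> 2 * norm (f x)"
proof -
  obtain t where t: "\<And>n::nat. simple_function M (t n)" "\<And>x. x \<in> space M \<Longrightarrow> (\<lambda>n. t n x) \<longlonglongrightarrow> f x"
    using assms(1) unfolding strongly_measurable_def by blast
  note [measurable] = borel_measurable_simple_function[OF t(1)] assms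
  define s where "s n x = (if norm (t n x) \<le> 2 * norm (f x) then t n x else 0)" for n x
  have "simple_function M (s n)" for n
    unfolding s_def by (rule simple_function_If) (auto intro: t)
  moreover have "(\<lambda>n. s n x) \<longlonglongrightarrow> f x" if x: "x \<in> space M" for x
  proof (cases "f x = 0")
    case True
    then have "s n x = 0" for n by (auto simp: s_def)
    then show ?thesis using True by simp
  next
    case False
    have "(\<lambda>n. norm (t n x)) \<longlonglongrightarrow> norm (f x)" by (intro tendsto_norm t x)
    then have "\<forall>\<^sub>F n in sequentially. norm (t n x) < 2 * norm (f x)"
      using False by (intro order_tendstoD(2)[of _ "norm (f x)"]) auto
    then have "\<forall>\<^sub>F n in sequentially. s n x = t n x"
      by eventually_elim (auto simp: s_def)
    then show ?thesis using t(2)[OF x] by (subst tendsto_cong)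
  qed
  moreover have "norm (s n x) \<le> 2 * norm (f x)" for n x by (auto simp: s_def)
  ultimately show ?thesis using that by blast
qed

section \<open>Strongly integrable functions\<close>

abbreviation L1_norm :: "'a measure \<Rightarrow> ('a \<Rightarrow> 'b::real_normed_vector) \<Rightarrow> ennreal" where
  "L1_norm M f \<equiv> \<integral>\<^sup>+x. ennreal (norm (f x)) \<partial>M"

definition strongly_integrable :: "'a measure \<Rightarrow> ('a \<Rightarrow> 'b::real_normed_vector) \<Rightarrow> bool" where
  "strongly_integrable M f \<longleftrightarrow> strongly_measurable M f \<and> L1_norm M f < \<infinity>"

lemma strongly_integrable_imp_measurable: "strongly_integrable M f \<Longrightarrow> strongly_measurable M f"
  by (simp add: strongly_integrable_def)

lemma nn_integral_norm_add_le:
  assumes "strongly_measurable M f" "strongly_measurable M g"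
  shows "L1_norm M (\<lambda>x. f x + g x) \<le>
    L1_norm M f + L1_norm M g"
proof -
  note [measurable] = assms
  have "L1_norm M (\<lambda>x. f x + g x) \<le> (\<integral>\<^sup>+x. ennreal (norm (f x)) + ennreal (norm (g x)) \<partial>M)"
    by (intro nn_integral_mono) (auto simp: norm_triangle_ineq simp flip: ennreal_plus)
  also have "\<dots> = L1_norm M f + L1_norm M g"
    by (rule nn_integral_add) auto
  finally show ?thesis .
qed

lemma nn_integral_norm_diff_le:
  assumes "strongly_measurable M f" "strongly_measurable M g"
  shows "L1_norm M (\<lambda>x. f x - g x) \<le>
    L1_norm M f + L1_norm M g"
proof -
  note [measurable] = assms
  have "L1_norm M (\<lambda>x. f x - g x) \<le> (\<integral>\<^sup>+x. ennreal (norm (f x)) + ennreal (norm (g x)) \<partial>M)"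
    by (intro nn_integral_mono) (auto simp: norm_triangle_ineq4 simp flip: ennreal_plus)
  also have "\<dots> = L1_norm M f + L1_norm M g"
    by (rule nn_integral_add) auto
  finally show ?thesis .
qed

lemma strongly_integrable_add:
  "strongly_integrable M f \<Longrightarrow> strongly_integrable M g \<Longrightarrow> strongly_integrable M (\<lambda>x. f x + g x)"
  unfolding strongly_integrable_def
  by (auto intro: strongly_measurable_add order.strict_trans1[OF nn_integral_norm_add_le])

lemma strongly_integrable_diff:
  "strongly_integrable M f \<Longrightarrow> strongly_integrable M g \<Longrightarrow> strongly_integrable M (\<lambda>x. f x - g x)"
  unfolding strongly_integrable_def
  by (auto intro: strongly_measurable_diff order.strict_trans1[OF nn_integral_norm_diff_le])

lemma (in finite_measure) strongly_integrable_bounded: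
  assumes "strongly_measurable M f" "\<And>x. x \<in> space M \<Longrightarrow> norm (f x) \<le> B"
  shows "strongly_integrable M f"
proof -
  have "L1_norm M f \<le> (\<integral>\<^sup>+x. ennreal B \<partial>M)"
    using assms(2) by (intro nn_integral_mono ennreal_leI) auto
  also have "\<dots> < \<infinity>"
    by (simp add: emeasure_eq_measure ennreal_mult_less_top)
  finally show ?thesis using assms(1) by (simp add: strongly_integrable_def)
qed

lemma (in finite_measure) strongly_integrable_simple:
  assumes "simple_function M s"
  shows "strongly_integrable M s"
proof -
  have "norm (s x) \<le> Max (norm ` s ` space M)" if "x \<in> space M" for x
    using simple_functionD(1)[OF assms] that by (intro Max_ge) auto
  then show ?thesis
    by (intro strongly_integrable_bounded[where B="Max (norm ` s ` space M)"] strongly_measurable_simple assms)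
qed

lemma strongly_integrable_simple_limit:
  fixes f :: "'a \<Rightarrow> 'b::real_normed_vector"
  assumes "strongly_integrable M f"
  obtains s where "\<And>n::nat. simple_function M (s n)"
    "(\<lambda>n. L1_norm M (\<lambda>x. f x - s n x)) \<longlonglongrightarrow> 0"
proof -
  from assms have f: "strongly_measurable M f" "L1_norm M f < \<infinity>"
    by (auto simp: strongly_integrable_def)
  obtain s where s: "\<And>n::nat. simple_function M (s n)" "\<And>x. x \<in> space M \<Longrightarrow> (\<lambda>n. s n x) \<longlonglongrightarrow> f x"
    "\<And>n x. x \<in> space M \<Longrightarrow> norm (s n x) \<le> 2 * norm (f x)"
    by (rule strongly_measurable_dominated_simple[OF f(1)]) (rule that; assumption)
  note [measurable] = f(1) strongly_measurable_diff[OF f(1) strongly_measurable_simple[OF s(1)]]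
  have "(\<lambda>n. L1_norm M (\<lambda>x. f x - s n x)) \<longlonglongrightarrow> (\<integral>\<^sup>+x. 0 \<partial>M)"
  proof (rule nn_integral_dominated_convergence[where w="\<lambda>x. ennreal 3 * ennreal (norm (f x))"])
    show "(\<integral>\<^sup>+x. ennreal 3 * ennreal (norm (f x)) \<partial>M) < \<infinity>"
      using f(2) by (subst nn_integral_cmult) (auto simp: ennreal_mult_less_top)
    show "AE x in M. ennreal (norm (f x - s n x)) \<le> ennreal 3 * ennreal (norm (f x))" for n
    proof (rule AE_I2)
      fix x assume "x \<in> space M"
      then have "norm (f x - s n x) \<le> 3 * norm (f x)"
        using s(3)[of x n] norm_triangle_ineq4[of "f x" "s n x"] by linarith
      then show "ennreal (norm (f x - s n x)) \<le> ennreal 3 * ennreal (norm (f x))"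
        by (subst ennreal_mult[symmetric]) (auto intro: ennreal_leI)
    qed
    show "AE x in M. (\<lambda>n. ennreal (norm (f x - s n x))) \<longlonglongrightarrow> 0"
    proof (rule AE_I2)
      fix x assume "x \<in> space M"
      then have "(\<lambda>n. norm (f x - s n x)) \<longlonglongrightarrow> norm (f x - f x)"
        by (intro tendsto_intros s)
      from tendsto_ennrealI[OF this] show "(\<lambda>n. ennreal (norm (f x - s n x))) \<longlonglongrightarrow> 0" by simp
    qed
  qed auto
  then show ?thesis using that[of s] s(1) by simp
qed

lemma strongly_integrable_fast_simple_limit:
  fixes f :: "'a \<Rightarrow> 'b::real_normed_vector"
  assumes "strongly_integrable M f"
  obtains s where "\<And>n::nat. simple_function M (s n)"
    "\<And>n. L1_norm M (\<lambda>x. f x - s n x) \<le> ennreal ((1/2)^n)"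
proof -
  obtain s where s: "\<And>n::nat. simple_function M (s n)"
    "(\<lambda>n. L1_norm M (\<lambda>x. f x - s n x)) \<longlonglongrightarrow> 0"
    using strongly_integrable_simple_limit[OF assms] by blast
  have "\<exists>m. L1_norm M (\<lambda>x. f x - s m x) \<le> ennreal ((1/2)^n)" for n
  proof -
    have "\<forall>\<^sub>F m in sequentially. L1_norm M (\<lambda>x. f x - s m x) < ennreal ((1/2)^n)"
      by (rule order_tendstoD(2)[OF s(2)]) simp
    then show ?thesis using eventually_happens'[OF sequentially_bot] less_imp_le by blast
  qed
  then obtain m where "\<And>n. L1_norm M (\<lambda>x. f x - s (m n) x) \<le> ennreal ((1/2)^n)"
    by metis
  then show ?thesis using that[of "\<lambda>n. s (m n)"] s(1) by simp
qed

text \<open>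
  The sum of the functions has finite integral, so it is finite almost everywhere and its terms tend
  to 0 there. The rate \<open>(1/2)^n\<close> is the one used for fast limits throughout.
\<close>

lemma fast_L1_null_imp_AE_null:
  fixes u :: "nat \<Rightarrow> 'a \<Rightarrow> ennreal"
  assumes [measurable]: "\<And>n. u n \<in> borel_measurable M"
    and le: "\<And>n. (\<integral>\<^sup>+x. u n x \<partial>M) \<le> ennreal ((1/2)^n)"
  shows "AE x in M. (\<lambda>n. u n x) \<longlonglongrightarrow> 0"
proof -
  have "(\<integral>\<^sup>+x. (\<Sum>n. u n x) \<partial>M) = (\<Sum>n. \<integral>\<^sup>+x. u n x \<partial>M)"
    by (rule nn_integral_suminf) auto
  also have "\<dots> \<le> (\<Sum>n. ennreal ((1/2)^n))" by (intro suminf_le le) auto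
  also have "\<dots> = ennreal (\<Sum>n. (1/2)^n)"
    by (rule suminf_ennreal2) (auto intro: summable_geometric)
  finally have "(\<integral>\<^sup>+x. (\<Sum>n. u n x) \<partial>M) \<noteq> \<infinity>" by (auto simp: top_unique)
  then have "AE x in M. (\<Sum>n. u n x) \<noteq> \<infinity>"
    by (intro nn_integral_PInf_AE) auto
  then show ?thesis
  proof eventually_elim
    case (elim x)
    have fin: "u n x < top" for n
      using elim ennreal_suminf_lessD[of "\<lambda>n. u n x" top n] by (auto simp: less_top)
    define v where "v n = enn2real (u n x)" for n
    have v: "u n x = ennreal (v n)" "v n \<ge> 0" for n using fin[of n] by (auto simp: v_def)
    have "summable v"
      using elim v by (intro summable_suminf_not_top) auto
    then have "v \<longlonglongrightarrow> 0" by (rule summable_LIMSEQ_zero)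
    from tendsto_ennrealI[OF this] show ?case by (simp add: v)
  qed
qed

lemma tendsto_zero_of_ennreal_norm:
  fixes v :: "nat \<Rightarrow> 'a::real_normed_vector"
  assumes "(\<lambda>n. ennreal (norm (v n))) \<longlonglongrightarrow> 0"
  shows "v \<longlonglongrightarrow> 0"
proof -
  have "(\<lambda>n. norm (v n)) \<longlonglongrightarrow> 0"
    using assms by (subst (asm) ennreal_0[symmetric], subst (asm) tendsto_ennreal_iff) auto
  then show ?thesis by (rule tendsto_norm_zero_cancel)
qed

text \<open>
  A limit of strongly measurable functions is again one, here for integrable ones and up to a null set: simple functions
  that follow the \<open>g n\<close> at a summable \<open>L\<^sub>1\<close> distance have the same limit almost everywhere. The exceptional
  set is removed by passing to 0, because strong measurability demands convergence at every point.
\<close>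

lemma strongly_measurable_AE_limit:
  fixes G :: "'a \<Rightarrow> 'b::real_normed_vector"
  assumes g: "\<And>n::nat. strongly_integrable M (g n)" and lim: "AE x in M. (\<lambda>n. g n x) \<longlonglongrightarrow> G x"
  obtains h where "strongly_measurable M h" "AE x in M. h x = G x"
proof -
  have "\<exists>u. simple_function M u \<and> (L1_norm M (\<lambda>x. g n x - u x)) \<le> ennreal ((1/2)^n)" for n
    using strongly_integrable_fast_simple_limit[OF g[of n]] by metis
  then obtain u where u: "\<And>n. simple_function M (u n)"
    "\<And>n. L1_norm M (\<lambda>x. g n x - u n x) \<le> ennreal ((1/2)^n)" by metis
  note [measurable] = strongly_measurable_diff[OF strongly_integrable_imp_measurable[OF g] strongly_measurable_simple[OF u(1)]]
  have "AE x in M. (\<lambda>n. ennreal (norm (g n x - u n x))) \<longlonglongrightarrow> 0"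
    by (rule fast_L1_null_imp_AE_null[OF _ u(2)]) auto
  with lim have ae: "AE x in M. (\<lambda>n. u n x) \<longlonglongrightarrow> G x"
  proof eventually_elim
    case (elim x)
    from tendsto_diff[OF elim(1) tendsto_zero_of_ennreal_norm[OF elim(2)]] show ?case by simp
  qed
  then obtain Z where Z: "Z \<in> null_sets M" "{x\<in>space M. \<not> (\<lambda>n. u n x) \<longlonglongrightarrow> G x} \<subseteq> Z"
    by (auto simp: eventually_ae_filter)
  define h where "h x = (if x \<in> Z then 0 else G x)" for x
  have "strongly_measurable M h"
    unfolding strongly_measurable_def
  proof (intro exI conjI allI ballI)
    show "simple_function M (\<lambda>x. if x \<in> Z then 0 else u n x)" for n
    proof (rule simple_function_If[OF simple_function_const u(1)])
      have "{x \<in> space M. x \<in> Z} = Z \<inter> space M" by auto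
      then show "{x \<in> space M. x \<in> Z} \<in> sets M" using Z(1) by auto
    qed
    show "(\<lambda>n. if x \<in> Z then 0 else u n x) \<longlonglongrightarrow> h x" if "x \<in> space M" for x
      using Z(2) that by (auto simp: h_def)
  qed
  moreover have "AE x in M. h x = G x"
    using AE_not_in[OF Z(1)] by eventually_elim (auto simp: h_def)
  ultimately show ?thesis using that by blast
qed

section \<open>The strong integral\<close>

abbreviation simple_bochner_integrable :: "'a measure \<Rightarrow> ('a \<Rightarrow> 'b::real_vector) \<Rightarrow> bool" where
  "simple_bochner_integrable \<equiv> Bochner_Integration.simple_bochner_integrable"

abbreviation simple_bochner_integral :: "'a measure \<Rightarrow> ('a \<Rightarrow> 'b::real_vector) \<Rightarrow> 'b" where
  "simple_bochner_integral \<equiv> Bochner_Integration.simple_bochner_integral"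

lemma norm_simple_bochner_integral_le:
  assumes "simple_bochner_integrable M s"
  shows "ennreal (norm (simple_bochner_integral M s)) \<le> L1_norm M s"
proof -
  have "simple_bochner_integrable M (\<lambda>x. norm (s x))"
    using simple_bochner_integrable_compose2[of "\<lambda>a _. norm a", OF _ assms assms] by simp
  from simple_bochner_integral_eq_nn_integral[OF this]
    simple_bochner_integral_norm_bound[OF assms]
  show ?thesis by (simp flip: simple_bochner_integral_eq_nn_integral[OF \<open>simple_bochner_integrable M (\<lambda>x. norm (s x))\<close>] add: ennreal_leI)
qed

lemma simple_bochner_integrable_imp_strongly_measurable:
  "simple_bochner_integrable M s \<Longrightarrow> strongly_measurable M s"
  by (auto elim!: simple_bochner_integrable.cases intro: strongly_measurable_simple)

lemma simple_bochner_integral_diff_le: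
  assumes f: "strongly_measurable M f" and s: "simple_bochner_integrable M s"
    and t: "simple_bochner_integrable M t"
  shows "ennreal (norm (simple_bochner_integral M s - simple_bochner_integral M t))
    \<le> L1_norm M (\<lambda>x. f x - s x) + L1_norm M (\<lambda>x. f x - t x)"
proof -
  have "ennreal (norm (simple_bochner_integral M s - simple_bochner_integral M t))
    \<le> L1_norm M (\<lambda>x. s x - t x)"
    using norm_simple_bochner_integral_le[of M "\<lambda>x. s x - t x"]
      simple_bochner_integrable_compose2[of "(-)", OF _ s t]
    by (simp add: simple_bochner_integral_diff[OF s t])
  also have "\<dots> = L1_norm M (\<lambda>x. (f x - t x) - (f x - s x))"
    by simp
  also have "\<dots> \<le> L1_norm M (\<lambda>x. f x - t x) + L1_norm M (\<lambda>x. f x - s x)"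
    by (intro nn_integral_norm_diff_le strongly_measurable_diff f
      simple_bochner_integrable_imp_strongly_measurable s t)
  finally show ?thesis by (simp add: add.commute)
qed

lemma has_strong_integral_unique:
  assumes "has_strong_integral M f I" "has_strong_integral M f J"
  shows "I = J"
proof -
  from assms(1) obtain s where f: "strongly_measurable M f"
    and s: "\<And>n::nat. simple_bochner_integrable M (s n)"
      "(\<lambda>n. L1_norm M (\<lambda>x. f x - s n x)) \<longlonglongrightarrow> 0"
      "(\<lambda>n. simple_bochner_integral M (s n)) \<longlonglongrightarrow> I"
    unfolding has_strong_integral_def by blast
  from assms(2) obtain t where
    t: "\<And>n::nat. simple_bochner_integrable M (t n)"
      "(\<lambda>n. L1_norm M (\<lambda>x. f x - t n x)) \<longlonglongrightarrow> 0"
      "(\<lambda>n. simple_bochner_integral M (t n)) \<longlonglongrightarrow> J"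
    unfolding has_strong_integral_def by blast
  let ?d = "\<lambda>n. simple_bochner_integral M (s n) - simple_bochner_integral M (t n)"
  have "(\<lambda>n. ennreal (norm (?d n))) \<longlonglongrightarrow> 0"
  proof (rule tendsto_sandwich[OF _ _ tendsto_const])
    show "\<forall>\<^sub>F n in sequentially. ennreal (norm (?d n)) \<le> L1_norm M (\<lambda>x. f x - s n x) + L1_norm M (\<lambda>x. f x - t n x)"
      by (intro always_eventually allI simple_bochner_integral_diff_le f s t)
    show "(\<lambda>n. L1_norm M (\<lambda>x. f x - s n x) + L1_norm M (\<lambda>x. f x - t n x)) \<longlonglongrightarrow> 0"
      using tendsto_add[OF s(2) t(2)] by simp
  qed auto
  moreover have "(\<lambda>n. ennreal (norm (?d n))) \<longlonglongrightarrow> ennreal (norm (I - J))"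
    by (intro tendsto_intros s t)
  ultimately have "ennreal (norm (I - J)) = 0" by (rule LIMSEQ_unique[rotated])
  then show ?thesis by simp
qed

lemma strong_integral_eqI: "has_strong_integral M f I \<Longrightarrow> strong_integral M f = I"
  unfolding strong_integral_def by (rule the_equality) (auto dest: has_strong_integral_unique)

lemma has_strong_integral_norm_le:
  assumes "has_strong_integral M f I"
  shows "ennreal (norm I) \<le> L1_norm M f"
proof -
  from assms(1) obtain s where f: "strongly_measurable M f"
    and s: "\<And>n::nat. simple_bochner_integrable M (s n)"
      "(\<lambda>n. L1_norm M (\<lambda>x. f x - s n x)) \<longlonglongrightarrow> 0"
      "(\<lambda>n. simple_bochner_integral M (s n)) \<longlonglongrightarrow> I"
    unfolding has_strong_integral_def by blast
  have "ennreal (norm (simple_bochner_integral M (s n))) \<le>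
     L1_norm M f + L1_norm M (\<lambda>x. f x - s n x)" for n
  proof -
    have "L1_norm M (\<lambda>x. s n x) = L1_norm M (\<lambda>x. f x - (f x - s n x))"
      by simp
    also have "\<dots> \<le> L1_norm M f + L1_norm M (\<lambda>x. f x - s n x)"
      by (intro nn_integral_norm_diff_le strongly_measurable_diff f
        simple_bochner_integrable_imp_strongly_measurable s)
    finally show ?thesis using norm_simple_bochner_integral_le[OF s(1)[of n]] by (rule order_trans[rotated])
  qed
  moreover have "(\<lambda>n. ennreal (norm (simple_bochner_integral M (s n)))) \<longlonglongrightarrow> ennreal (norm I)"
    by (intro tendsto_intros s)
  moreover have "(\<lambda>n. L1_norm M f + L1_norm M (\<lambda>x. f x - s n x)) \<longlonglongrightarrow> L1_norm M f + 0"
    by (intro tendsto_intros s)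
  ultimately show ?thesis using LIMSEQ_le by fastforce
qed

lemma has_strong_integral_bounded_linear:
  assumes T: "bounded_linear T" and "has_strong_integral M f I"
  shows "has_strong_integral M (\<lambda>x. T (f x)) (T I)"
proof -
  interpret bounded_linear T by fact
  from assms(2) obtain s where f: "strongly_measurable M f"
    and s: "\<And>n::nat. simple_bochner_integrable M (s n)"
      "(\<lambda>n. L1_norm M (\<lambda>x. f x - s n x)) \<longlonglongrightarrow> 0"
      "(\<lambda>n. simple_bochner_integral M (s n)) \<longlonglongrightarrow> I"
    unfolding has_strong_integral_def by blast
  obtain K where K: "\<And>x. norm (T x) \<le> norm x * K" "K \<ge> 0" using nonneg_bounded by blast
  have "(\<lambda>n. L1_norm M (\<lambda>x. T (f x) - T (s n x))) \<longlonglongrightarrow> 0"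
  proof (rule tendsto_sandwich[OF _ _ tendsto_const])
    show "\<forall>\<^sub>F n in sequentially. L1_norm M (\<lambda>x. T (f x) - T (s n x)) \<le> ennreal K * L1_norm M (\<lambda>x. f x - s n x)"
    proof (intro always_eventually allI)
      fix n
      note [measurable] = strongly_measurable_diff[OF f simple_bochner_integrable_imp_strongly_measurable[OF s(1)[of n]]]
      show "L1_norm M (\<lambda>x. T (f x) - T (s n x)) \<le> ennreal K * L1_norm M (\<lambda>x. f x - s n x)"
        using K by (subst nn_integral_cmult[symmetric])
          (auto intro!: nn_integral_mono ennreal_leI simp: ennreal_mult[symmetric] diff[symmetric] mult.commute)
    qed
    show "(\<lambda>n. ennreal K * L1_norm M (\<lambda>x. f x - s n x)) \<longlonglongrightarrow> 0"
      using ennreal_tendsto_cmult[OF _ s(2), of "ennreal K"] by simp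
  qed auto
  moreover have "(\<lambda>n. simple_bochner_integral M (\<lambda>x. T (s n x))) \<longlonglongrightarrow> T I"
    using tendsto[OF s(3)] by (simp add: simple_bochner_integral_linear[OF linear_axioms s(1)])
  moreover have "simple_bochner_integrable M (\<lambda>x. T (s n x))" for n
    using simple_bochner_integrable_compose2[of "\<lambda>x _. T x", OF _ s(1) s(1)] by (simp add: zero)
  moreover have "strongly_measurable M (\<lambda>x. T (f x))"
    by (rule strongly_measurable_compose2[OF f f]) (rule tendsto)
  ultimately show ?thesis unfolding has_strong_integral_def
    by (intro conjI exI[of _ "\<lambda>n x. T (s n x)"] allI) assumption+
qed

lemma has_strong_integral_add:
  assumes "has_strong_integral M f I" "has_strong_integral M g J"
  shows "has_strong_integral M (\<lambda>x. f x + g x) (I + J)"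
proof -
  from assms(1) obtain s where f: "strongly_measurable M f"
    and s: "\<And>n::nat. simple_bochner_integrable M (s n)"
      "(\<lambda>n. L1_norm M (\<lambda>x. f x - s n x)) \<longlonglongrightarrow> 0"
      "(\<lambda>n. simple_bochner_integral M (s n)) \<longlonglongrightarrow> I"
    unfolding has_strong_integral_def by blast
  from assms(2) obtain t where g: "strongly_measurable M g" and
    t: "\<And>n::nat. simple_bochner_integrable M (t n)"
      "(\<lambda>n. L1_norm M (\<lambda>x. g x - t n x)) \<longlonglongrightarrow> 0"
      "(\<lambda>n. simple_bochner_integral M (t n)) \<longlonglongrightarrow> J"
    unfolding has_strong_integral_def by blast
  have "(\<lambda>n. L1_norm M (\<lambda>x. (f x + g x) - (s n x + t n x))) \<longlonglongrightarrow> 0"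
  proof (rule tendsto_sandwich[OF _ _ tendsto_const])
    have "L1_norm M (\<lambda>x. (f x + g x) - (s n x + t n x)) \<le>
      L1_norm M (\<lambda>x. f x - s n x) + L1_norm M (\<lambda>x. g x - t n x)" for n
      using nn_integral_norm_add_le[OF strongly_measurable_diff[OF f] strongly_measurable_diff[OF g],
        OF simple_bochner_integrable_imp_strongly_measurable[OF s(1)[of n]]
        simple_bochner_integrable_imp_strongly_measurable[OF t(1)[of n]]]
      by (simp add: algebra_simps)
    then show "\<forall>\<^sub>F n in sequentially. L1_norm M (\<lambda>x. (f x + g x) - (s n x + t n x)) \<le>
      L1_norm M (\<lambda>x. f x - s n x) + L1_norm M (\<lambda>x. g x - t n x)"
      by (intro always_eventually allI)
    show "(\<lambda>n. L1_norm M (\<lambda>x. f x - s n x) + L1_norm M (\<lambda>x. g x - t n x)) \<longlonglongrightarrow> 0"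
      using tendsto_add[OF s(2) t(2)] by simp
  qed auto
  moreover have "(\<lambda>n. simple_bochner_integral M (\<lambda>x. s n x + t n x)) \<longlonglongrightarrow> I + J"
    using tendsto_add[OF s(3) t(3)] by (simp add: simple_bochner_integral_add[OF s(1) t(1)])
  moreover have "simple_bochner_integrable M (\<lambda>x. s n x + t n x)" for n
    using simple_bochner_integrable_compose2[of "(+)", OF _ s(1) t(1)] by simp
  ultimately show ?thesis unfolding has_strong_integral_def
    using strongly_measurable_add[OF f g]
    by (intro conjI exI[of _ "\<lambda>n x. s n x + t n x"] allI) assumption+
qed

lemma has_strong_integral_diff:
  assumes "has_strong_integral M f I" "has_strong_integral M g J"
  shows "has_strong_integral M (\<lambda>x. f x - g x) (I - J)"
  using has_strong_integral_add[OF assms(1) has_strong_integral_bounded_linear[OF bounded_linear_minus[OF bounded_linear_ident] assms(2)]]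
  by simp

lemma has_strong_integral_dist_le:
  assumes "has_strong_integral M f I" "has_strong_integral M g J"
  shows "ennreal (norm (I - J)) \<le> L1_norm M (\<lambda>x. f x - g x)"
  by (intro has_strong_integral_norm_le has_strong_integral_diff assms)

lemma (in finite_measure) has_strong_integral_exists:
  fixes f :: "'a \<Rightarrow> 'b::banach"
  assumes "strongly_integrable M f"
  shows "\<exists>I. has_strong_integral M f I"
proof -
  note f = strongly_integrable_imp_measurable[OF assms]
  obtain s where s: "\<And>n::nat. simple_function M (s n)"
    "\<And>n. L1_norm M (\<lambda>x. f x - s n x) \<le> ennreal ((1/2)^n)"
    using strongly_integrable_fast_simple_limit[OF assms] by blast
  have sb: "simple_bochner_integrable M (s n)" for n
    by (intro simple_bochner_integrable.intros s) auto
  let ?I = "\<lambda>n. simple_bochner_integral M (s n)"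
  have d: "norm (?I m - ?I n) \<le> (1/2)^m + (1/2)^n" for m n
  proof -
    have "ennreal (norm (?I m - ?I n)) \<le> ennreal ((1/2)^m) + ennreal ((1/2)^n)"
      by (rule order_trans[OF simple_bochner_integral_diff_le[OF f sb sb] add_mono[OF s(2) s(2)]])
    then show ?thesis by (simp flip: ennreal_plus)
  qed
  have p0: "(\<lambda>n. (1/2::real)^n) \<longlonglongrightarrow> 0" by (rule LIMSEQ_realpow_zero) auto
  have "Cauchy ?I"
  proof (rule CauchyI)
    fix e :: real assume "e > 0"
    then obtain N where N: "\<And>n. n \<ge> N \<Longrightarrow> (1/2::real)^n < e/2"
      using order_tendstoD(2)[OF p0, of "e/2"] by (auto simp: eventually_sequentially)
    show "\<exists>M. \<forall>m\<ge>M. \<forall>n\<ge>M. norm (?I m - ?I n) < e"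
    proof (intro exI allI impI)
      fix m n assume "m \<ge> N" "n \<ge> N"
      with N[of m] N[of n] d[of m n] show "norm (?I m - ?I n) < e" by linarith
    qed
  qed
  then obtain I where "?I \<longlonglongrightarrow> I" by (auto simp: Cauchy_convergent_iff convergent_def)
  moreover have "(\<lambda>n. L1_norm M (\<lambda>x. f x - s n x)) \<longlonglongrightarrow> 0"
    by (rule tendsto_sandwich[OF _ _ tendsto_const, of _ _ _ "\<lambda>n. ennreal ((1/2)^n)"])
      (use s(2) tendsto_ennrealI[OF p0] in auto)
  ultimately show ?thesis unfolding has_strong_integral_def using f sb by blast
qed

text \<open>
  The functions \<open>s n\<close> in the last premise converge fast, so that a closedness proof may use
  convergence almost everywhere and not only in \<open>L\<^sub>1\<close>.
\<close>

lemma (in finite_measure) strongly_integrable_induct[consumes 1, case_names indicator add lim]: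
  fixes P :: "('a \<Rightarrow> 'b::real_normed_vector) \<Rightarrow> bool"
  assumes f: "strongly_integrable M f"
    and ind: "\<And>A x. A \<in> sets M \<Longrightarrow> P (\<lambda>\<omega>. indicator A \<omega> *\<^sub>R x)"
    and add: "\<And>g h. strongly_integrable M g \<Longrightarrow> strongly_integrable M h \<Longrightarrow> P g \<Longrightarrow> P h \<Longrightarrow> P (\<lambda>\<omega>. g \<omega> + h \<omega>)"
    and lim: "\<And>g s. strongly_integrable M g \<Longrightarrow> (\<And>n::nat. strongly_integrable M (s n)) \<Longrightarrow> (\<And>n. P (s n)) \<Longrightarrow>
      (\<And>n. L1_norm M (\<lambda>x. g x - s n x) \<le> ennreal ((1/2)^n)) \<Longrightarrow> P g"
  shows "P f"
proof -
  have SI_ind: "strongly_integrable M (\<lambda>\<omega>. indicator A \<omega> *\<^sub>R x)" if "A \<in> sets M" for A and x :: 'b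
    using that by (intro strongly_integrable_simple simple_function_compose1[where f="indicator A" and g="\<lambda>c. c *\<^sub>R x"] simple_function_indicator)
  have simple: "P (\<lambda>\<omega>. \<Sum>y\<in>Y. indicator (s -` {y} \<inter> space M) \<omega> *\<^sub>R y)
      \<and> strongly_integrable M (\<lambda>\<omega>. \<Sum>y\<in>Y. indicator (s -` {y} \<inter> space M) \<omega> *\<^sub>R y)"
    if "simple_function M s" "finite Y" for s Y
    using that(2)
  proof induction
    case empty
    show ?case using ind[of "{}" 0] SI_ind[of "{}" 0] by simp
  next
    case (insert y Y)
    have "s -` {y} \<inter> space M \<in> sets M" using that(1) by (rule simple_functionD)
    then show ?case
      unfolding sum.insert[OF insert(1,2)]
      by (intro conjI add strongly_integrable_add ind SI_ind conjunct1[OF insert(3)] conjunct2[OF insert(3)])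
  qed
  obtain s where s: "\<And>n::nat. simple_function M (s n)"
    "\<And>n. L1_norm M (\<lambda>x. f x - s n x) \<le> ennreal ((1/2)^n)"
    using strongly_integrable_fast_simple_limit[OF f] by blast
  define t where "t n = (\<lambda>\<omega>. \<Sum>y\<in>s n ` space M. indicator (s n -` {y} \<inter> space M) \<omega> *\<^sub>R y)" for n
  have fin: "finite (s n ` space M)" for n using s(1) by (rule simple_functionD)
  have t: "P (t n)" "strongly_integrable M (t n)" for n
    unfolding t_def using simple[OF s(1) fin] by auto
  \<comment> \<open>outside the space of \<open>M\<close> the two functions may differ\<close>
  have "t n x = s n x" if "x \<in> space M" for n x
  proof -
    have "t n x = (\<Sum>y\<in>s n ` space M. if y = s n x then y else 0)"
      unfolding t_def using that by (intro sum.cong) (auto simp: indicator_def)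
    then show ?thesis using fin that by (simp add: sum.delta)
  qed
  then have "L1_norm M (\<lambda>x. f x - t n x) = L1_norm M (\<lambda>x. f x - s n x)" for n
    by (intro nn_integral_cong) auto
  then show ?thesis using s(2) by (intro lim[where g=f and s=t] f t) simp
qed

section \<open>The circle\<close>

lemma sets_circle: "sets circle_measure = sets (restrict_space borel (sphere 0 1))"
  by (simp add: circle_measure_def)

lemma space_circle: "space circle_measure = sphere 0 1"
  by (simp add: circle_measure_def space_restrict_space)

lemma measurable_cis: "cis \<in> measurable (uniform_measure lborel {0..<2 * pi}) (restrict_space borel (sphere 0 1))"
proof (rule measurable_restrict_space2)
  have "cis \<in> borel_measurable borel" by (intro borel_measurable_continuous_onI continuous_intros)
  then show "cis \<in> borel_measurable (uniform_measure lborel {0..<2 * pi})"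
    by (simp add: measurable_def)
qed auto

lemma prob_space_circle: "prob_space circle_measure"
  unfolding circle_measure_def
  by (intro prob_space.prob_space_distr prob_space_uniform_measure measurable_cis) auto

lemma borel_measurable_circle_continuous:
  "continuous_on (sphere 0 1) f \<Longrightarrow> f \<in> borel_measurable circle_measure"
  unfolding measurable_cong_sets[OF sets_circle refl] by (rule borel_measurable_continuous_on_restrict)

text \<open>
  The point \<open>-1\<close> is fixed by all the maps \<open>(z + r) / (1 + r z)\<close>, while on the rest of the circle they tend to
  the constant 1 as \<open>r\<close> tends to 1.
\<close>

lemma AE_circle_neq_minus_one: "AE z in circle_measure. z \<noteq> -1"
proof -
  have pi_eq: "x = pi" if x: "x \<in> {0..<2*pi}" and c: "cis x = -1" for x
  proof -
    have "cos x = -1" using c by (simp add: complex_eq_iff)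
    then obtain n :: int where n: "x = (2 * real_of_int n + 1) * pi" using cos_eq_minus1 by auto
    with x have "0 \<le> (2 * real_of_int n + 1) * pi" "(2 * real_of_int n + 1) * pi < 2 * pi" by auto
    then have "0 \<le> 2 * real_of_int n + 1" "2 * real_of_int n + 1 < 2"
      using pi_gt_zero by (simp_all add: zero_le_mult_iff)
    then have "n = 0" by linarith
    with n show ?thesis by simp
  qed
  have "AE x in lborel. x \<in> {0..<2 * pi} \<longrightarrow> cis x \<noteq> -1"
    using AE_lborel_singleton[of pi] by eventually_elim (use pi_eq in blast)
  then have "AE x in uniform_measure lborel {0..<2 * pi}. cis x \<noteq> -1"
    by (intro AE_uniform_measureI) auto
  moreover have "{z \<in> space (restrict_space borel (sphere 0 1)). z \<noteq> -1} \<in> sets (restrict_space borel (sphere (0::complex) 1))"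
    unfolding sets_restrict_space by (rule image_eqI[of _ _ "- {-1}"]) (auto simp: space_restrict_space)
  ultimately show ?thesis
    unfolding circle_measure_def by (subst AE_distr_iff[OF measurable_cis]) (auto simp: space_restrict_space)
qed

lemma circle_integral_continuous:
  fixes f :: "complex \<Rightarrow> complex"
  assumes "continuous_on (sphere 0 1) f"
  shows "(\<integral>z. f z \<partial>circle_measure) = (\<integral>x. indicator {0..2 * pi} x *\<^sub>R (f (cis x) / (2 * pi)) \<partial>lborel)"
proof -
  have m: "(\<lambda>x. f (cis x)) \<in> borel_measurable lborel"
    using continuous_on_compose2[OF assms, of UNIV cis]
    by (simp add: borel_measurable_continuous_onI continuous_intros image_subset_iff)
  have "(\<integral>z. f z \<partial>circle_measure) = (\<integral>x. f (cis x) \<partial>uniform_measure lborel {0..<2 * pi})"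
    unfolding circle_measure_def
    by (intro integral_distr measurable_cis borel_measurable_continuous_on_restrict assms)
  also have "uniform_measure lborel {0..<2 * pi} = density lborel (\<lambda>x. ennreal (indicator {0..<2 * pi} x / (2 * pi)))"
    unfolding uniform_measure_def
    by (intro density_cong) (auto simp: indicator_def divide_ennreal[symmetric])
  also have "(\<integral>x. f (cis x) \<partial>\<dots>) = (\<integral>x. (indicator {0..<2 * pi} x / (2 * pi)) *\<^sub>R f (cis x) \<partial>lborel)"
    using m by (intro integral_density) auto
  also have "\<dots> = (\<integral>x. indicator {0..2 * pi} x *\<^sub>R (f (cis x) / (2 * pi)) \<partial>lborel)"
    using m AE_lborel_singleton[of "2 * pi"]
    by (intro integral_cong_AE) (auto elim!: eventually_mono simp: indicator_def scaleR_conv_of_real)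
  finally show ?thesis .
qed

lemma continuous_on_circle_powi: "continuous_on (sphere 0 1) (\<lambda>z::complex. z powi k)"
  by (intro continuous_intros) auto

lemma circle_integral_powi: "(\<integral>z. z powi k \<partial>circle_measure) = (if k = 0 then 1 else 0)"
proof -
  have eq: "(\<integral>z. z powi k \<partial>circle_measure) = (\<integral>x. indicator {0..2 * pi} x *\<^sub>R (cis (real_of_int k * x) / (2 * pi)) \<partial>lborel)"
    by (simp add: circle_integral_continuous[OF continuous_on_circle_powi] cis_power_int)
  show ?thesis
  proof (cases "k = 0")
    case True
    interpret prob_space circle_measure by (rule prob_space_circle)
    show ?thesis using True by (simp add: prob_space)
  next
    case False
    define F where "F x = cis (real_of_int k * x) / (\<i> * of_int k * (2 * pi))" for x :: real
    have "(\<integral>x. indicator {0..2 * pi} x *\<^sub>R (cis (real_of_int k * x) / (2 * pi)) \<partial>lborel) = F (2 * pi) - F 0"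
    proof (rule integral_FTC_atLeastAtMost)
      show "(F has_vector_derivative cis (real_of_int k * x) / complex_of_real (2 * pi)) (at x within {0..2 * pi})" for x
      proof -
        have "((\<lambda>z. exp (\<i> * (of_int k * z)) / (\<i> * of_int k * (2 * pi))) has_field_derivative
            exp (\<i> * (of_int k * of_real x)) / (2 * pi)) (at (of_real x))"
          using False by (auto intro!: derivative_eq_intros simp: field_simps)
        from has_vector_derivative_real_field[OF this] show ?thesis
          by (simp add: F_def[abs_def] cis_conv_exp)
      qed
    qed (auto intro!: continuous_intros)
    also have "F (2 * pi) = F 0"
    proof -
      have "cis (real_of_int k * (2 * pi)) = 1"
        using cis_multiple_2pi[of "real_of_int k"] by (simp add: ac_simps)
      then show ?thesis unfolding F_def by simp
    qed
    finally show ?thesis using eq False by simp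
  qed
qed

lemma circle_integrable_continuous:
  fixes f :: "complex \<Rightarrow> complex"
  assumes "continuous_on (sphere 0 1) f"
  shows "integrable circle_measure f"
proof -
  interpret prob_space circle_measure by (rule prob_space_circle)
  have "bounded (f ` sphere 0 1)"
    by (intro compact_imp_bounded compact_continuous_image assms compact_sphere)
  then obtain B where "\<forall>z\<in>sphere 0 1. norm (f z) \<le> B" unfolding bounded_iff by auto
  then show ?thesis
    by (intro integrable_const_bound[where B=B] borel_measurable_circle_continuous assms)
      (auto simp: space_circle)
qed

lemma circle_integral_poly: "(\<integral>z. poly q z \<partial>circle_measure) = poly q 0"
proof -
  have "(\<integral>z. poly q z \<partial>circle_measure) = (\<integral>z. (\<Sum>i\<le>degree q. coeff q i * z powi int i) \<partial>circle_measure)"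
    by (simp add: poly_altdef)
  also have "\<dots> = (\<Sum>i\<le>degree q. coeff q i * (\<integral>z. z powi int i \<partial>circle_measure))"
  proof -
    have "integrable circle_measure (\<lambda>z. coeff q i * z powi int i)" for i
      by (intro integrable_mult_right circle_integrable_continuous continuous_on_circle_powi)
    then show ?thesis
      by (subst Bochner_Integration.integral_sum) (simp_all only: integral_mult_right_zero)
  qed
  also have "\<dots> = poly q 0"
    by (simp only: circle_integral_powi) (simp add: if_distrib sum.delta poly_0_coeff_0 cong: if_cong)
  finally show ?thesis .
qed

text \<open>
  An automorphism of the disc that moves 0 to \<open>r\<close>. The image of arc length under it is harmonic measure seen
  from \<open>r\<close>, whose density is the Poisson kernel.
\<close>

definition moebius :: "real \<Rightarrow> complex \<Rightarrow> complex" where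
  "moebius r z = (z + of_real r) / (1 + of_real r * z)"

lemma moebius_denom_nz:
  assumes "0 \<le> r" "r < 1" "norm z = 1"
  shows "1 + of_real r * z \<noteq> (0::complex)"
proof
  assume "1 + of_real r * z = 0"
  then have "of_real r * z = - 1" by (simp add: add_eq_0_iff)
  then have "norm (of_real r * z) = 1" by simp
  then show False using assms by (simp add: norm_mult)
qed

lemma norm_moebius:
  assumes "0 \<le> r" "r < 1" "norm z = 1"
  shows "norm (moebius r z) = 1"
proof -
  have z: "z * cnj z = 1" using assms(3) by (simp add: complex_norm_square[symmetric])
  have "norm (z + of_real r) = norm (cnj (z + of_real r) * z)"
    by (simp only: norm_mult complex_mod_cnj assms(3) mult_1_right)
  also have "cnj (z + of_real r) * z = 1 + of_real r * z" using z by (simp add: algebra_simps)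
  finally show ?thesis
    using moebius_denom_nz[OF assms] by (simp add: moebius_def norm_divide)
qed

lemma continuous_on_moebius:
  assumes "0 \<le> r" "r < 1"
  shows "continuous_on (sphere 0 1) (moebius r)"
  unfolding moebius_def using assms by (intro continuous_intros) (auto dest: moebius_denom_nz)

text \<open>
  Expanding \<open>1 / (1 + r z)\<close> as a geometric series writes \<open>moebius r\<close> on the circle as a bounded limit of polynomials
  with value \<open>r\<close> at 0, and for polynomials the mean over the circle is the value at 0.
\<close>

lemma circle_integral_moebius_power:
  assumes r: "0 \<le> r" "r < 1"
  shows "(\<integral>z. moebius r z ^ k \<partial>circle_measure) = of_real r ^ k"
proof (cases "k = 0")
  case True
  interpret prob_space circle_measure by (rule prob_space_circle)
  show ?thesis using True by (simp add: prob_space)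
next
  case False
  interpret prob_space circle_measure by (rule prob_space_circle)
  define q where "q n = [:complex_of_real r, 1:] * (\<Sum>i<n. [:0, - complex_of_real r:] ^ i)" for n
  have q: "poly (q n) z = (of_real r + z) * (\<Sum>i<n. (- of_real r * z) ^ i)" for n z
    by (simp add: q_def poly_sum algebra_simps)
  have conv: "poly (q n) z = moebius r z * (1 - (- of_real r * z) ^ n)" if "norm z = 1" for n z
  proof -
    have "- of_real r * z \<noteq> 1"
    proof
      assume "- of_real r * z = 1"
      then have "1 + of_real r * z = 0" by algebra
      with moebius_denom_nz[OF r that] show False by simp
    qed
    then have "(\<Sum>i<n. (- of_real r * z) ^ i) = (1 - (- of_real r * z) ^ n) / (1 + of_real r * z)"
      by (subst sum_gp_strict) auto
    then show ?thesis by (simp add: q moebius_def)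
  qed
  have small: "norm ((- complex_of_real r * z) ^ n) \<le> 1" if "norm z = 1" for z n
    using r that by (simp add: norm_power norm_mult power_le_one)
  \<comment> \<open>the error factor in \<open>conv\<close> has modulus at most 2, whence the dominating constant\<close>
  have "(\<lambda>n. \<integral>z. poly (q n) z ^ k \<partial>circle_measure) \<longlonglongrightarrow> (\<integral>z. moebius r z ^ k \<partial>circle_measure)"
  proof (rule integral_dominated_convergence[where w="\<lambda>_. 2 ^ k"])
    show "(\<lambda>z. moebius r z ^ k) \<in> borel_measurable circle_measure"
      using r by (intro borel_measurable_circle_continuous continuous_intros continuous_on_moebius)
    show "(\<lambda>z. poly (q n) z ^ k) \<in> borel_measurable circle_measure" for n
      by (intro borel_measurable_circle_continuous continuous_intros)
    show "AE z in circle_measure. (\<lambda>n. poly (q n) z ^ k) \<longlonglongrightarrow> moebius r z ^ k"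
    proof (rule AE_I2)
      fix z assume "z \<in> space circle_measure"
      then have z: "norm z = 1" by (simp add: space_circle)
      have "norm (- complex_of_real r * z) < 1" using r z by (simp add: norm_mult)
      then have "(\<lambda>n. (- complex_of_real r * z) ^ n) \<longlonglongrightarrow> 0" by (rule LIMSEQ_power_zero)
      then have "(\<lambda>n. (moebius r z * (1 - (- of_real r * z) ^ n)) ^ k) \<longlonglongrightarrow> (moebius r z * (1 - 0)) ^ k"
        by (intro tendsto_power tendsto_mult tendsto_diff tendsto_const)
      then show "(\<lambda>n. poly (q n) z ^ k) \<longlonglongrightarrow> moebius r z ^ k" by (simp add: conv[OF z])
    qed
    show "AE z in circle_measure. norm (poly (q n) z ^ k) \<le> 2 ^ k" for n
    proof (rule AE_I2)
      fix z assume "z \<in> space circle_measure"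
      then have z: "norm z = 1" by (simp add: space_circle)
      have "norm (poly (q n) z) \<le> 1 * (1 + 1)"
        unfolding conv[OF z] norm_mult
        using small[OF z, of n] norm_triangle_ineq4[of 1 "(- complex_of_real r * z) ^ n"]
        by (intro mult_mono) (auto simp: norm_moebius[OF r z])
      then show "norm (poly (q n) z ^ k) \<le> 2 ^ k" by (simp add: norm_power power_mono)
    qed
  qed auto
  moreover have "(\<integral>z. poly (q n) z ^ k \<partial>circle_measure) = of_real r ^ k" if "n \<ge> 1" for n
  proof -
    have "(\<integral>z. poly (q n) z ^ k \<partial>circle_measure) = poly (q n ^ k) 0"
      using circle_integral_poly[of "q n ^ k"] by (simp only: poly_power)
    also have "poly (q n) 0 = of_real r"
      using that by (simp add: q power_0_left)
    then have "poly (q n ^ k) 0 = of_real r ^ k" by simp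
    finally show ?thesis .
  qed
  then have "(\<lambda>n. \<integral>z. poly (q n) z ^ k \<partial>circle_measure) \<longlonglongrightarrow> of_real r ^ k"
    by (intro tendsto_eventually) (auto simp: eventually_sequentially)
  ultimately show ?thesis by (rule LIMSEQ_unique)
qed

section \<open>The torus\<close>

lemma space_torus: "space torus = {\<omega>. \<forall>j. norm (\<omega> j) = 1}"
  by (auto simp: torus_def space_PiM space_circle PiE_def Pi_iff)

interpretation circle_product: product_prob_space "\<lambda>_::nat. circle_measure" UNIV
  by (intro product_prob_spaceI prob_space_circle)

interpretation torus: prob_space torus
  unfolding torus_def by (rule circle_product.prob_space_axioms)

lemma measurable_torus_coordinate[measurable]: "(\<lambda>\<omega>. \<omega> j) \<in> measurable torus circle_measure"
  unfolding torus_def by (rule measurable_component_singleton) simp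

lemma borel_measurable_torus_coordinate_continuous:
  "continuous_on (sphere 0 1) f \<Longrightarrow> (\<lambda>\<omega>. f (\<omega> j)) \<in> borel_measurable torus"
  by (rule measurable_compose[OF measurable_torus_coordinate borel_measurable_circle_continuous])

lemma torus_integral_prod:
  fixes u :: "nat \<Rightarrow> complex \<Rightarrow> complex"
  assumes "finite J" "\<And>j. j \<in> J \<Longrightarrow> continuous_on (sphere 0 1) (u j)"
  shows "(\<integral>\<omega>. (\<Prod>j\<in>J. u j (\<omega> j)) \<partial>torus) = (\<Prod>j\<in>J. \<integral>z. u j z \<partial>circle_measure)"
proof -
  have m: "(\<lambda>\<omega>. \<Prod>j\<in>J. u j (\<omega> j)) \<in> borel_measurable (PiM J (\<lambda>_. circle_measure))"
  proof (rule borel_measurable_prod)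
    fix j assume "j \<in> J"
    then show "(\<lambda>\<omega>. u j (\<omega> j)) \<in> borel_measurable (PiM J (\<lambda>_. circle_measure))"
      using measurable_compose[OF measurable_component_singleton[of j J "\<lambda>_. circle_measure"]
        borel_measurable_circle_continuous[OF assms(2)[of j]]] by simp
  qed
  have "(\<integral>\<omega>. (\<Prod>j\<in>J. u j (\<omega> j)) \<partial>torus) = (\<integral>\<omega>. (\<Prod>j\<in>J. u j (restrict \<omega> J j)) \<partial>torus)"
    by (intro Bochner_Integration.integral_cong prod.cong) auto
  also have "\<dots> = (\<integral>\<omega>. (\<Prod>j\<in>J. u j (\<omega> j)) \<partial>distr torus (PiM J (\<lambda>_. circle_measure)) (\<lambda>\<omega>. restrict \<omega> J))"
    unfolding torus_def by (subst integral_distr[OF _ m]) (auto intro: measurable_restrict_subset)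
  also have "\<dots> = (\<integral>\<omega>. (\<Prod>j\<in>J. u j (\<omega> j)) \<partial>PiM J (\<lambda>_. circle_measure))"
    unfolding torus_def by (subst circle_product.distr_PiM_restrict_finite[OF assms(1)]) auto
  also have "\<dots> = (\<Prod>j\<in>J. \<integral>z. u j z \<partial>circle_measure)"
    using assms by (intro circle_product.product_integral_prod circle_integrable_continuous)
  finally show ?thesis .
qed

lemma monomial_superset:
  assumes "finite J" "{j. \<alpha> j \<noteq> 0} \<subseteq> J"
  shows "monomial \<alpha> \<omega> = (\<Prod>j\<in>J. \<omega> j powi \<alpha> j)"
  unfolding monomial_def using assms by (intro prod.mono_neutral_left) auto

lemma norm_monomial: "\<omega> \<in> space torus \<Longrightarrow> norm (monomial \<alpha> \<omega>) = 1"
  by (simp add: monomial_def space_torus norm_power_int flip: prod_norm)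

lemma monomial_mult: "monomial \<alpha> (\<lambda>j. \<omega> j * \<eta> j) = monomial \<alpha> \<omega> * monomial \<alpha> \<eta>"
  by (simp add: monomial_def power_int_mult_distrib prod.distrib)

lemma monomial_add:
  assumes "\<alpha> \<in> fin_int_seqs" "\<beta> \<in> fin_int_seqs" "\<omega> \<in> space torus"
  shows "monomial (\<lambda>j. \<alpha> j + \<beta> j) \<omega> = monomial \<alpha> \<omega> * monomial \<beta> \<omega>"
proof -
  let ?J = "{j. \<alpha> j \<noteq> 0} \<union> {j. \<beta> j \<noteq> 0}"
  have fin: "finite ?J" using assms by (auto simp: fin_int_seqs_def)
  have nz: "\<omega> j \<noteq> 0" for j using assms(3) by (metis (mono_tags) mem_Collect_eq norm_zero space_torus zero_neq_one)
  have "monomial (\<lambda>j. \<alpha> j + \<beta> j) \<omega> = (\<Prod>j\<in>?J. \<omega> j powi (\<alpha> j + \<beta> j))"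
    by (rule monomial_superset[OF fin]) auto
  also have "\<dots> = (\<Prod>j\<in>?J. \<omega> j powi \<alpha> j) * (\<Prod>j\<in>?J. \<omega> j powi \<beta> j)"
    by (simp add: power_int_add nz prod.distrib)
  also have "\<dots> = monomial \<alpha> \<omega> * monomial \<beta> \<omega>"
    by (subst (1 2) monomial_superset[OF fin]) auto
  finally show ?thesis .
qed

lemma fin_int_seqs_add: "\<alpha> \<in> fin_int_seqs \<Longrightarrow> \<beta> \<in> fin_int_seqs \<Longrightarrow> (\<lambda>j. \<alpha> j + \<beta> j) \<in> fin_int_seqs"
  unfolding fin_int_seqs_def by (auto intro: finite_subset[where B="{j. \<alpha> j \<noteq> 0} \<union> {j. \<beta> j \<noteq> 0}"])

lemma fin_int_seqs_uminus: "\<alpha> \<in> fin_int_seqs \<Longrightarrow> (\<lambda>j. - \<alpha> j) \<in> fin_int_seqs"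
  unfolding fin_int_seqs_def by auto

lemma measurable_monomial[measurable]: "monomial \<alpha> \<in> borel_measurable torus"
  unfolding monomial_def
  by (intro borel_measurable_prod borel_measurable_torus_coordinate_continuous[where f="\<lambda>z. z powi k" for k] continuous_on_circle_powi)

lemma torus_integral_monomial:
  assumes "\<alpha> \<in> fin_int_seqs"
  shows "(\<integral>\<omega>. monomial \<alpha> \<omega> \<partial>torus) = (if \<alpha> = (\<lambda>_. 0) then 1 else 0)"
proof -
  have fin: "finite {j. \<alpha> j \<noteq> 0}" using assms by (simp add: fin_int_seqs_def)
  have "(\<integral>\<omega>. monomial \<alpha> \<omega> \<partial>torus) = (\<Prod>j | \<alpha> j \<noteq> 0. \<integral>z. z powi \<alpha> j \<partial>circle_measure)"
    unfolding monomial_def by (rule torus_integral_prod[OF fin]) (rule continuous_on_circle_powi)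
  also have "\<dots> = (\<Prod>j | \<alpha> j \<noteq> 0. 0)"
    by (intro prod.cong) (auto simp: circle_integral_powi)
  also have "\<dots> = (if \<alpha> = (\<lambda>_. 0) then 1 else 0)"
    using fin by (auto simp: fun_eq_iff power_0_left card_eq_0_iff)
  finally show ?thesis .
qed

definition torus_moebius :: "(nat \<Rightarrow> real) \<Rightarrow> (nat \<Rightarrow> complex) \<Rightarrow> nat \<Rightarrow> complex" where
  "torus_moebius r \<omega> = (\<lambda>j. moebius (r j) (\<omega> j))"

lemma measurable_into_torus:
  assumes "\<And>j. (\<lambda>x. f x j) \<in> measurable M circle_measure"
  shows "f \<in> measurable M torus"
  unfolding torus_def using assms measurable_space[OF assms]
  by (intro measurable_PiM_single') auto

lemma measurable_into_circle:
  assumes "f \<in> borel_measurable M" "\<And>x. x \<in> space M \<Longrightarrow> norm (f x) = 1"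
  shows "f \<in> measurable M circle_measure"
  unfolding measurable_cong_sets[OF refl sets_circle]
  using assms by (intro measurable_restrict_space2) auto

lemma measurable_torus_moebius:
  assumes "\<And>j. 0 \<le> r j" "\<And>j. r j < 1"
  shows "torus_moebius r \<in> measurable torus torus"
  using assms unfolding torus_moebius_def
  by (intro measurable_into_torus measurable_into_circle borel_measurable_torus_coordinate_continuous continuous_on_moebius norm_moebius)
    (auto simp: space_torus)

lemma torus_integral_moebius_monomial:
  assumes r: "\<And>j. 0 \<le> r j" "\<And>j. r j < 1" and \<alpha>: "\<alpha> \<in> fin_nat_seqs"
  shows "(\<integral>\<eta>. monomial \<alpha> (torus_moebius r \<eta>) \<partial>torus) = (\<Prod>j | \<alpha> j \<noteq> 0. of_real (r j) ^ nat (\<alpha> j))"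
proof -
  have fin: "finite {j. \<alpha> j \<noteq> 0}" using \<alpha> by (simp add: fin_nat_seqs_def fin_int_seqs_def)
  have pow: "moebius (r j) z powi \<alpha> j = moebius (r j) z ^ nat (\<alpha> j)" for j z
    using \<alpha> by (simp add: fin_nat_seqs_def power_int_def)
  have "(\<integral>\<eta>. monomial \<alpha> (torus_moebius r \<eta>) \<partial>torus) = (\<Prod>j | \<alpha> j \<noteq> 0. \<integral>z. moebius (r j) z ^ nat (\<alpha> j) \<partial>circle_measure)"
    unfolding monomial_def torus_moebius_def pow
    using r by (intro torus_integral_prod[OF fin] continuous_intros continuous_on_moebius)
  then show ?thesis by (simp add: circle_integral_moebius_power r)
qed

section \<open>From monomials to measurable sets\<close>

inductive_set trig_polys :: "((nat \<Rightarrow> complex) \<Rightarrow> complex) set" where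
  monomial: "\<alpha> \<in> fin_int_seqs \<Longrightarrow> monomial \<alpha> \<in> trig_polys"
| add: "p \<in> trig_polys \<Longrightarrow> q \<in> trig_polys \<Longrightarrow> (\<lambda>\<omega>. p \<omega> + q \<omega>) \<in> trig_polys"
| scale: "p \<in> trig_polys \<Longrightarrow> (\<lambda>\<omega>. c * p \<omega>) \<in> trig_polys"

lemma trig_polys_mult_monomial:
  assumes "p \<in> trig_polys" "\<alpha> \<in> fin_int_seqs"
  shows "\<exists>s\<in>trig_polys. \<forall>\<omega>\<in>space torus. s \<omega> = monomial \<alpha> \<omega> * p \<omega>"
  using assms(1)
proof induction
  case (monomial \<beta>)
  then show ?case using trig_polys.monomial[OF fin_int_seqs_add[OF assms(2) monomial]] monomial_add[OF assms(2) monomial] by blast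
next
  case (add p q)
  then obtain s t where "s \<in> trig_polys" "t \<in> trig_polys"
    "\<forall>\<omega>\<in>space torus. s \<omega> = monomial \<alpha> \<omega> * p \<omega>" "\<forall>\<omega>\<in>space torus. t \<omega> = monomial \<alpha> \<omega> * q \<omega>" by blast
  then show ?case by (intro bexI[of _ "\<lambda>\<omega>. s \<omega> + t \<omega>"] trig_polys.add) (auto simp: algebra_simps)
next
  case (scale p c)
  then obtain s where "s \<in> trig_polys" "\<forall>\<omega>\<in>space torus. s \<omega> = monomial \<alpha> \<omega> * p \<omega>" by blast
  then show ?case by (intro bexI[of _ "\<lambda>\<omega>. c * s \<omega>"] trig_polys.scale) (auto simp: algebra_simps)
qed

lemma trig_polys_mult:
  assumes "p \<in> trig_polys" "q \<in> trig_polys"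
  shows "\<exists>s\<in>trig_polys. \<forall>\<omega>\<in>space torus. s \<omega> = q \<omega> * p \<omega>"
  using assms(2)
proof induction
  case (monomial \<beta>)
  then show ?case using trig_polys_mult_monomial[OF assms(1)] by blast
next
  case (add q r)
  then obtain s t where "s \<in> trig_polys" "t \<in> trig_polys"
    "\<forall>\<omega>\<in>space torus. s \<omega> = q \<omega> * p \<omega>" "\<forall>\<omega>\<in>space torus. t \<omega> = r \<omega> * p \<omega>" by blast
  then show ?case by (intro bexI[of _ "\<lambda>\<omega>. s \<omega> + t \<omega>"] trig_polys.add) (auto simp: algebra_simps)
next
  case (scale q c)
  then obtain s where "s \<in> trig_polys" "\<forall>\<omega>\<in>space torus. s \<omega> = q \<omega> * p \<omega>" by blast
  then show ?case by (intro bexI[of _ "\<lambda>\<omega>. c * s \<omega>"] trig_polys.scale) (auto simp: algebra_simps)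
qed

lemma monomial_zero: "monomial (\<lambda>_. 0) = (\<lambda>_. 1)"
  by (simp add: monomial_def fun_eq_iff)

lemma zero_in_fin_int_seqs: "(\<lambda>_. 0) \<in> fin_int_seqs"
  by (simp add: fin_int_seqs_def)

lemma const_in_trig_polys: "(\<lambda>_. c) \<in> trig_polys"
  using trig_polys.scale[OF trig_polys.monomial[OF zero_in_fin_int_seqs], of c] by (simp add: monomial_zero)

lemma continuous_on_monomial: "continuous_on (space torus) (monomial \<alpha>)"
  unfolding monomial_def
proof (intro continuous_on_prod)
  fix j
  have "continuous_on (space torus) (\<lambda>\<omega>::nat \<Rightarrow> complex. \<omega> j)"
    by (rule continuous_on_subset[OF continuous_on_product_coordinates]) auto
  then show "continuous_on (space torus) (\<lambda>\<omega>::nat \<Rightarrow> complex. \<omega> j powi \<alpha> j)"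
    by (rule continuous_on_compose2[OF continuous_on_circle_powi]) (auto simp: space_torus)
qed

lemma continuous_on_trig_poly: "p \<in> trig_polys \<Longrightarrow> continuous_on (space torus) p"
  by (induction rule: trig_polys.induct)
    (auto intro: continuous_on_monomial continuous_on_add continuous_on_mult_left)

lemma coordinate_in_trig_polys: "(\<lambda>\<omega>. \<omega> j) \<in> trig_polys" "(\<lambda>\<omega>. inverse (\<omega> j)) \<in> trig_polys"
proof -
  let ?e = "\<lambda>k i. if i = j then k else 0 :: int"
  have supp: "{i. ?e k i \<noteq> 0} = (if k = 0 then {} else {j})" for k by auto
  have m: "monomial (?e k) \<in> trig_polys" for k
    by (rule trig_polys.monomial) (simp add: fin_int_seqs_def supp)
  have "monomial (?e k) = (\<lambda>\<omega>. \<omega> j powi k)" if "k \<noteq> 0" for k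
    unfolding monomial_def supp using that by simp
  from m[of 1] m[of "-1"] this[of 1] this[of "-1"]
  show "(\<lambda>\<omega>. \<omega> j) \<in> trig_polys" "(\<lambda>\<omega>. inverse (\<omega> j)) \<in> trig_polys"
    by (simp_all add: power_int_minus)
qed

lemma compact_space_torus: "compact (space torus)"
proof -
  have "space torus = PiE UNIV (\<lambda>_. sphere (0::complex) 1)"
    by (auto simp: space_torus PiE_def Pi_iff)
  moreover have "compactin (product_topology (\<lambda>_::nat. euclidean) UNIV) (PiE UNIV (\<lambda>_. sphere (0::complex) 1))"
    unfolding compactin_PiE by simp
  ultimately show ?thesis by (simp add: euclidean_product_topology)
qed

text \<open>
  The Stone-Weierstrass theorem is about real functions, so it is applied to the real functions that agree on the
  torus with some trigonometric polynomial. Among them are the real and imaginary parts of the coordinates,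
  because inversion is conjugation on the circle; these separate points.
\<close>

lemma trig_polys_dense:
  fixes f :: "(nat \<Rightarrow> complex) \<Rightarrow> real"
  assumes f: "continuous_on (space torus) f" and e: "0 < e"
  shows "\<exists>p\<in>trig_polys. \<forall>\<omega>\<in>space torus. norm (of_real (f \<omega>) - p \<omega>) < e"
proof -
  define P where "P g \<longleftrightarrow> (\<exists>p\<in>trig_polys. \<forall>\<omega>\<in>space torus. p \<omega> = of_real (g \<omega>))" for g :: "(nat \<Rightarrow> complex) \<Rightarrow> real"
  have "\<exists>g. P g \<and> (\<forall>\<omega>\<in>space torus. \<bar>f \<omega> - g \<omega>\<bar> < e)"
  proof (rule Stone_Weierstrass_HOL[where P=P and S="space torus" and f=f and e=e, OF compact_space_torus])
    show "P (\<lambda>_. c)" for c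
      unfolding P_def by (rule bexI[OF _ const_in_trig_polys[of "of_real c"]]) simp
    show "continuous_on (space torus) g" if Pg: "P g" for g
    proof -
      obtain p where p: "p \<in> trig_polys" "\<forall>\<omega>\<in>space torus. p \<omega> = of_real (g \<omega>)" using Pg by (auto simp: P_def)
      have "continuous_on (space torus) (\<lambda>\<omega>. Re (p \<omega>))"
        by (intro continuous_intros continuous_on_trig_poly p)
      then show ?thesis by (rule continuous_on_eq) (simp add: p)
    qed
    show "P (\<lambda>\<omega>. g \<omega> + h \<omega>)" if gh: "P g \<and> P h" for g h
    proof -
      obtain p q where pq: "p \<in> trig_polys" "q \<in> trig_polys" "\<forall>\<omega>\<in>space torus. p \<omega> = of_real (g \<omega>)"
        "\<forall>\<omega>\<in>space torus. q \<omega> = of_real (h \<omega>)" using gh by (auto simp: P_def)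
      then show ?thesis unfolding P_def by (intro bexI[OF _ trig_polys.add[OF pq(1,2)]]) auto
    qed
    show "P (\<lambda>\<omega>. g \<omega> * h \<omega>)" if gh: "P g \<and> P h" for g h
    proof -
      obtain p q where pq: "p \<in> trig_polys" "q \<in> trig_polys" "\<forall>\<omega>\<in>space torus. p \<omega> = of_real (g \<omega>)"
        "\<forall>\<omega>\<in>space torus. q \<omega> = of_real (h \<omega>)" using gh by (auto simp: P_def)
      obtain s where "s \<in> trig_polys" "\<forall>\<omega>\<in>space torus. s \<omega> = p \<omega> * q \<omega>"
        using trig_polys_mult[OF pq(2,1)] by blast
      with pq show ?thesis unfolding P_def by (intro bexI[of _ s]) auto
    qed
    show "\<exists>g. P g \<and> g x \<noteq> g y" if xy: "x \<in> space torus \<and> y \<in> space torus \<and> x \<noteq> y" for x y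
    proof -
      obtain j where j: "x j \<noteq> y j" using xy by (auto simp: fun_eq_iff)
      have inv: "inverse (\<omega> j) = cnj (\<omega> j)" if "\<omega> \<in> space torus" for \<omega>
      proof -
        have "norm (\<omega> j) = 1" using that by (simp add: space_torus)
        then have "\<omega> j * cnj (\<omega> j) = 1" by (simp add: complex_norm_square[symmetric])
        then show ?thesis by (rule inverse_unique)
      qed
      have t1: "(\<lambda>\<omega>. (1/2) * (\<omega> j + inverse (\<omega> j))) \<in> trig_polys"
        by (intro trig_polys.scale trig_polys.add coordinate_in_trig_polys)
      have e1: "(1/2) * (\<omega> j + inverse (\<omega> j)) = of_real (Re (\<omega> j))" if "\<omega> \<in> space torus" for \<omega>
        using inv[OF that] by (simp add: complex_eq_iff)
      have 1: "P (\<lambda>\<omega>. Re (\<omega> j))" unfolding P_def by (rule bexI[OF _ t1], rule ballI, rule e1)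
      have t2: "(\<lambda>\<omega>. (- \<i>/2) * (\<omega> j + (-1) * inverse (\<omega> j))) \<in> trig_polys"
        by (intro trig_polys.scale trig_polys.add coordinate_in_trig_polys)
      have e2: "(- \<i>/2) * (\<omega> j + (-1) * inverse (\<omega> j)) = of_real (Im (\<omega> j))" if "\<omega> \<in> space torus" for \<omega>
        using inv[OF that] by (simp add: complex_eq_iff)
      have 2: "P (\<lambda>\<omega>. Im (\<omega> j))" unfolding P_def by (rule bexI[OF _ t2], rule ballI, rule e2)
      show ?thesis
      proof (cases "Re (x j) = Re (y j)")
        case True
        then have "Im (x j) \<noteq> Im (y j)" using j by (simp add: complex_eq_iff)
        with 2 show ?thesis by blast
      next
        case False
        with 1 show ?thesis by blast
      qed
    qed
  qed (use f e in auto)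
  then obtain g p where g: "p \<in> trig_polys" "\<forall>\<omega>\<in>space torus. p \<omega> = of_real (g \<omega>)"
    "\<forall>\<omega>\<in>space torus. \<bar>f \<omega> - g \<omega>\<bar> < e" by (auto simp: P_def)
  show ?thesis
    by (rule bexI[OF _ g(1)]) (use g(2,3) in \<open>auto simp flip: of_real_diff\<close>)
qed

lemma id_borel_measurable_torus: "(\<lambda>\<omega>. \<omega>) \<in> borel_measurable torus"
  by (rule measurable_coordinatewise_then_product)
    (rule borel_measurable_torus_coordinate_continuous[of "\<lambda>z. z", simplified])

lemma closed_in_sets_torus:
  assumes "closed A" "A \<subseteq> space torus"
  shows "A \<in> sets torus"
proof -
  have "(\<lambda>\<omega>. \<omega>) -` A \<inter> space torus \<in> sets torus"
    by (rule measurable_sets[OF id_borel_measurable_torus]) (use assms in auto)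
  also have "(\<lambda>\<omega>. \<omega>) -` A \<inter> space torus = A" using assms by auto
  finally show ?thesis .
qed

lemma sets_torus_closed: "sets torus = sigma_sets (space torus) {A. closed A \<and> A \<subseteq> space torus}"
proof
  show "sigma_sets (space torus) {A. closed A \<and> A \<subseteq> space torus} \<subseteq> sets torus"
    by (intro sets.sigma_sets_subset) (auto intro: closed_in_sets_torus)
next
  let ?S = "sigma (space torus) {A. closed A \<and> A \<subseteq> space torus}"
  have sp: "space ?S = space torus" by (rule space_measure_of) auto
  have closed: "closed (space torus)" using compact_space_torus by (rule compact_imp_closed)
  have "(\<lambda>\<omega>. \<omega>) \<in> measurable ?S torus"
  proof (intro measurable_into_torus measurable_into_circle)
    fix j
    show "(\<lambda>\<omega>::nat \<Rightarrow> complex. \<omega> j) \<in> borel_measurable ?S"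
    proof (rule borel_measurableI)
      fix U :: "complex set" assume "open U"
      have "closed ((\<lambda>\<omega>::nat \<Rightarrow> complex. \<omega> j) -` (- U) \<inter> space torus)"
        using \<open>open U\<close> by (intro closed_Int closed closed_vimage) (auto intro: continuous_on_product_coordinates)
      then have "(\<lambda>\<omega>. \<omega> j) -` (- U) \<inter> space torus \<in> sets ?S"
        by (subst sets_measure_of) auto
      from sets.compl_sets[OF this] have "space torus - ((\<lambda>\<omega>. \<omega> j) -` (- U) \<inter> space torus) \<in> sets ?S" by (simp add: sp)
      also have "space torus - ((\<lambda>\<omega>. \<omega> j) -` (- U) \<inter> space torus) = (\<lambda>\<omega>. \<omega> j) -` U \<inter> space ?S" by (auto simp: sp)
      finally show "(\<lambda>\<omega>. \<omega> j) -` U \<inter> space ?S \<in> sets ?S" .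
    qed
    show "norm (\<omega> j) = 1" if "\<omega> \<in> space ?S" for \<omega>
      using that unfolding sp by (simp add: space_torus)
  qed
  show "sets torus \<subseteq> sigma_sets (space torus) {A. closed A \<and> A \<subseteq> space torus}"
  proof
    fix A assume A: "A \<in> sets torus"
    have "(\<lambda>\<omega>. \<omega>) -` A \<inter> space ?S \<in> sets ?S"
      using \<open>(\<lambda>\<omega>. \<omega>) \<in> measurable ?S torus\<close> A by (rule measurable_sets)
    also have "(\<lambda>\<omega>. \<omega>) -` A \<inter> space ?S = A" using sets.sets_into_space[OF A] by (auto simp: sp)
    finally show "A \<in> sigma_sets (space torus) {A. closed A \<and> A \<subseteq> space torus}"
      by (subst (asm) sets_measure_of) auto
  qed
qed

text \<open>
  The class contains the real continuous functions, being uniform limits of trigonometric polynomials. For a closed set \<open>A\<close>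
  the functions \<open>max 0 (1 - n * infdist \<omega> A)\<close> are continuous and decrease to the indicator of \<open>A\<close>. The
  closed sets are stable under intersection and generate the measurable sets, and the
  sets with indicator in the class are stable under complements and countable disjoint unions.
\<close>

lemma torus_functional_class:
  assumes A: "A \<in> sets torus"
    and mono: "\<And>\<alpha>. \<alpha> \<in> fin_int_seqs \<Longrightarrow> C (monomial \<alpha>)"
    and add: "\<And>f g. C f \<Longrightarrow> C g \<Longrightarrow> C (\<lambda>\<omega>. f \<omega> + g \<omega>)"
    and scale: "\<And>f c. C f \<Longrightarrow> C (\<lambda>\<omega>. c * f \<omega>)"
    and lim: "\<And>f g B. (\<And>n::nat. C (f n)) \<Longrightarrow> (\<And>n \<omega>. \<omega> \<in> space torus \<Longrightarrow> norm (f n \<omega>) \<le> B) \<Longrightarrow>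
      (\<And>\<omega>. \<omega> \<in> space torus \<Longrightarrow> (\<lambda>n. f n \<omega>) \<longlonglongrightarrow> g \<omega>) \<Longrightarrow> C g"
  shows "C (indicator A :: (nat \<Rightarrow> complex) \<Rightarrow> complex)"
proof -
  have C_poly: "C p" if "p \<in> trig_polys" for p
    using that by induction (auto intro: mono add scale)
  have C_const: "C (\<lambda>_. c)" for c by (intro C_poly const_in_trig_polys)
  have C_cont: "C (\<lambda>\<omega>. of_real (f \<omega>))" if f: "continuous_on (space torus) f" for f :: "(nat \<Rightarrow> complex) \<Rightarrow> real"
  proof -
    have "\<exists>p\<in>trig_polys. \<forall>\<omega>\<in>space torus. norm (of_real (f \<omega>) - p \<omega>) < 1 / real (Suc n)" for n
      by (rule trig_polys_dense[OF f]) auto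
    then obtain p where p: "\<And>n. p n \<in> trig_polys"
      "\<And>n \<omega>. \<omega> \<in> space torus \<Longrightarrow> norm (of_real (f \<omega>) - p n \<omega>) < 1 / real (Suc n)" by metis
    have "bounded (f ` space torus)"
      by (intro compact_imp_bounded compact_continuous_image f compact_space_torus)
    then obtain B where B: "\<forall>\<omega>\<in>space torus. norm (f \<omega>) \<le> B" unfolding bounded_iff by auto
    show ?thesis
    proof (rule lim[where f=p and B="B + 1"])
      show "C (p n)" for n by (intro C_poly p)
    next
      fix n \<omega> assume w: "\<omega> \<in> space torus"
      have "norm (p n \<omega>) \<le> norm (complex_of_real (f \<omega>)) + norm (of_real (f \<omega>) - p n \<omega>)"
        using norm_triangle_ineq4[of "complex_of_real (f \<omega>)" "of_real (f \<omega>) - p n \<omega>"] by simp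
      moreover have "1 / real (Suc n) \<le> 1" by simp
      then have "norm (of_real (f \<omega>) - p n \<omega>) < 1" using p(2)[OF w, of n] by (rule less_le_trans[rotated])
      ultimately show "norm (p n \<omega>) \<le> B + 1" using bspec[OF B w] by simp
    next
      fix \<omega> assume w: "\<omega> \<in> space torus"
      show "(\<lambda>n. p n \<omega>) \<longlonglongrightarrow> of_real (f \<omega>)"
      proof (rule LIMSEQ_I)
        fix e :: real assume "0 < e"
        then obtain N where N: "1 / real (Suc N) < e" using nat_approx_posE by blast
        have "norm (p n \<omega> - of_real (f \<omega>)) < e" if "n \<ge> N" for n
        proof -
          have "1 / real (Suc n) \<le> 1 / real (Suc N)" using that by (intro divide_left_mono) auto
          then show ?thesis using p(2)[OF w, of n] N by (simp add: norm_minus_commute)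
        qed
        then show "\<exists>N. \<forall>n\<ge>N. norm (p n \<omega> - of_real (f \<omega>)) < e" by blast
      qed
    qed
  qed
  have C_closed: "C (indicator A :: (nat \<Rightarrow> complex) \<Rightarrow> complex)" if A: "closed A" "A \<subseteq> space torus" for A
  proof (cases "A = {}")
    case True
    then show ?thesis using C_const[of 0] by (simp add: indicator_def[abs_def])
  next
    case False
    show ?thesis
    proof (rule lim[where f="\<lambda>n \<omega>. of_real (max 0 (1 - real n * infdist \<omega> A))" and B=1])
      show "C (\<lambda>\<omega>. of_real (max 0 (1 - real n * infdist \<omega> A)))" for n
        by (intro C_cont continuous_intros)
      show "norm (complex_of_real (max 0 (1 - real n * infdist \<omega> A))) \<le> 1" for n \<omega>
        by (auto simp: infdist_nonneg)
      show "(\<lambda>n. complex_of_real (max 0 (1 - real n * infdist \<omega> A))) \<longlonglongrightarrow> indicator A \<omega>" for \<omega>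
      proof (cases "\<omega> \<in> A")
        case True
        then show ?thesis by (simp add: infdist_zero)
      next
        case notA: False
        then have d: "infdist \<omega> A > 0" using infdist_pos_not_in_closed[OF A(1) False] by simp
        then obtain N where N: "real N * infdist \<omega> A > 1" using ex_less_of_nat_mult by blast
        have "complex_of_real (max 0 (1 - real n * infdist \<omega> A)) = 0" if "n \<ge> N" for n
        proof -
          have "real N * infdist \<omega> A \<le> real n * infdist \<omega> A" using that d by (intro mult_right_mono) auto
          with N show ?thesis by simp
        qed
        then show ?thesis using notA
          by (intro tendsto_eventually) (auto simp: eventually_sequentially)
      qed
    qed
  qed
  let ?G = "{A. closed A \<and> A \<subseteq> space torus}"
  show ?thesis
  proof (rule sigma_sets_induct_disjoint[of ?G "space torus" A])
    show "Int_stable ?G" by (auto simp: Int_stable_def)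
    show "?G \<subseteq> Pow (space torus)" by auto
    show "A \<in> sigma_sets (space torus) ?G" using A by (simp add: sets_torus_closed)
    show "C (indicator A)" if "A \<in> ?G" for A using that C_closed by auto
    show "C (indicator {})" using C_const[of 0] by (simp add: indicator_def[abs_def])
    show "C (indicator (space torus - A))" if "A \<in> sigma_sets (space torus) ?G" "C (indicator A)" for A
    proof (rule lim[where f="\<lambda>_ \<omega>. 1 + (-1) * indicator A \<omega>" and B=1])
      show "C (\<lambda>\<omega>. 1 + (-1) * indicator A \<omega>)"
        by (rule add[OF C_const scale[OF that(2)]])
    qed (auto simp: indicator_def)
    show "C (indicator (\<Union>i. A i))"
      if "disjoint_family A" "range A \<subseteq> sigma_sets (space torus) ?G" "\<And>i. C (indicator (A i))" for A :: "nat \<Rightarrow> _"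
    proof (rule lim[where f="\<lambda>n \<omega>. \<Sum>i<n. indicator (A i) \<omega>" and B=1])
      show "C (\<lambda>\<omega>. \<Sum>i<n. indicator (A i) \<omega>)" for n
        by (induction n) (auto intro: add C_const that(3))
      have eq: "(\<Sum>i<n. indicator (A i) \<omega> :: complex) = indicator (\<Union>i<n. A i) \<omega>" for n \<omega>
        by (rule indicator_UN_disjoint[symmetric])
          (use that(1) in \<open>auto simp: disjoint_family_on_def\<close>)
      show "norm (\<Sum>i<n. indicator (A i) \<omega> :: complex) \<le> 1" for n \<omega>
        unfolding eq by (simp add: indicator_def)
      show "(\<lambda>n. \<Sum>i<n. indicator (A i) \<omega> :: complex) \<longlonglongrightarrow> indicator (\<Union>i. A i) \<omega>" for \<omega>
        unfolding eq by (rule LIMSEQ_indicator_UN)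
    qed
  qed
qed

definition bounded_measurable :: "'a measure \<Rightarrow> ('a \<Rightarrow> complex) \<Rightarrow> bool" where
  "bounded_measurable M \<psi> \<longleftrightarrow> \<psi> \<in> borel_measurable M \<and> (\<exists>B. \<forall>x\<in>space M. norm (\<psi> x) \<le> B)"

lemma bounded_measurableI:
  "\<psi> \<in> borel_measurable M \<Longrightarrow> (\<And>x. x \<in> space M \<Longrightarrow> norm (\<psi> x) \<le> B) \<Longrightarrow> bounded_measurable M \<psi>"
  unfolding bounded_measurable_def by blast

lemma bounded_measurable_add:
  assumes "bounded_measurable M f" "bounded_measurable M g"
  shows "bounded_measurable M (\<lambda>x. f x + g x)"
proof -
  obtain B B' where "\<forall>x\<in>space M. norm (f x) \<le> B" "\<forall>x\<in>space M. norm (g x) \<le> B'"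
    using assms unfolding bounded_measurable_def by blast
  then show ?thesis
    using assms by (intro bounded_measurableI[where B="B + B'"])
      (auto simp: bounded_measurable_def intro: norm_triangle_mono)
qed

lemma bounded_measurable_scale:
  assumes "bounded_measurable M f"
  shows "bounded_measurable M (\<lambda>x. c * f x)"
proof -
  obtain B where "\<forall>x\<in>space M. norm (f x) \<le> B"
    using assms unfolding bounded_measurable_def by blast
  then show ?thesis
    using assms by (intro bounded_measurableI[where B="norm c * B"])
      (auto simp: bounded_measurable_def norm_mult intro: mult_left_mono)
qed

lemma bounded_measurable_integrable:
  assumes "finite_measure M" "bounded_measurable M f"
  shows "integrable M f"
proof -
  interpret finite_measure M by fact
  obtain B where "\<forall>x\<in>space M. norm (f x) \<le> B"
    using assms(2) unfolding bounded_measurable_def by blast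
  then show ?thesis
    using assms(2) by (intro integrable_const_bound[where B=B]) (auto simp: bounded_measurable_def)
qed

lemma bounded_measurable_monomial: "bounded_measurable torus (monomial \<alpha>)"
  by (rule bounded_measurableI[where B=1]) (auto simp: norm_monomial)

text \<open>
  The same principle with boundedness and measurability carried along, so that the closure properties need to be
  checked for integrable functions only, and with dominated convergence at hand.
\<close>

lemma torus_bounded_functional_class:
  assumes A: "A \<in> sets torus"
    and mono: "\<And>\<alpha>. \<alpha> \<in> fin_int_seqs \<Longrightarrow> Q (monomial \<alpha>)"
    and add: "\<And>f g. bounded_measurable torus f \<Longrightarrow> bounded_measurable torus g \<Longrightarrow> Q f \<Longrightarrow> Q g \<Longrightarrow>
      Q (\<lambda>\<omega>. f \<omega> + g \<omega>)"
    and scale: "\<And>f c. bounded_measurable torus f \<Longrightarrow> Q f \<Longrightarrow> Q (\<lambda>\<omega>. c * f \<omega>)"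
    and lim: "\<And>f g B. (\<And>n::nat. f n \<in> borel_measurable torus) \<Longrightarrow> g \<in> borel_measurable torus \<Longrightarrow>
      (\<And>n \<omega>. \<omega> \<in> space torus \<Longrightarrow> norm (f n \<omega>) \<le> B) \<Longrightarrow> (\<And>\<omega>. \<omega> \<in> space torus \<Longrightarrow> norm (g \<omega>) \<le> B) \<Longrightarrow>
      (\<And>\<omega>. \<omega> \<in> space torus \<Longrightarrow> (\<lambda>n. f n \<omega>) \<longlonglongrightarrow> g \<omega>) \<Longrightarrow> (\<And>n. Q (f n)) \<Longrightarrow> Q g"
  shows "Q (indicator A :: (nat \<Rightarrow> complex) \<Rightarrow> complex)"
proof -
  have "bounded_measurable torus (indicator A :: _ \<Rightarrow> complex) \<and> Q (indicator A)"
    using A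
  proof (rule torus_functional_class)
    fix f g B
    assume f: "\<And>n::nat. bounded_measurable torus (f n) \<and> Q (f n)"
      and B: "\<And>n \<omega>. \<omega> \<in> space torus \<Longrightarrow> norm (f n \<omega>) \<le> B"
      and conv: "\<And>\<omega>. \<omega> \<in> space torus \<Longrightarrow> (\<lambda>n. f n \<omega>) \<longlonglongrightarrow> g \<omega>"
    have fm: "f n \<in> borel_measurable torus" for n
      using f[of n] by (simp add: bounded_measurable_def)
    have gm: "g \<in> borel_measurable torus"
      by (rule borel_measurable_LIMSEQ_metric[where f=f]) (use fm conv in auto)
    have Bg: "norm (g \<omega>) \<le> B" if "\<omega> \<in> space torus" for \<omega>
      using tendsto_norm[OF conv[OF that]] B[OF that] by (intro LIMSEQ_le_const2) auto
    show "bounded_measurable torus g \<and> Q g"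
      using bounded_measurableI[OF gm Bg] lim[OF fm gm B Bg conv] f by simp
  qed (simp_all add: bounded_measurable_monomial bounded_measurable_add bounded_measurable_scale mono add scale)
  then show ?thesis ..
qed

section \<open>Complex multipliers\<close>

lemma bounded_bilinear_scaleC: "bounded_bilinear (scaleC :: complex \<Rightarrow> 'a::complex_banach \<Rightarrow> 'a)"
proof
  fix a a' :: complex and b b' :: 'a and r :: real
  show "scaleC (a + a') b = scaleC a b + scaleC a' b" by (rule scaleC_add_left)
  show "scaleC a (b + b') = scaleC a b + scaleC a b'" by (rule scaleC_add_right)
  show "scaleC (r *\<^sub>R a) b = r *\<^sub>R scaleC a b"
    by (simp add: scaleR_conv_of_real scaleC_scaleC[symmetric] scaleC_of_real)
  show "scaleC a (r *\<^sub>R b) = r *\<^sub>R scaleC a b"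
    by (simp add: scaleC_of_real[symmetric] scaleC_scaleC mult.commute)
  show "\<exists>K. \<forall>a b. norm (scaleC a (b::'a)) \<le> norm a * norm b * K"
    by (intro exI[of _ 1]) (simp add: norm_scaleC)
qed

interpretation scaleC: bounded_bilinear "scaleC :: complex \<Rightarrow> 'a::complex_banach \<Rightarrow> 'a"
  by (rule bounded_bilinear_scaleC)

lemma strongly_measurable_scaleC:
  assumes "\<psi> \<in> borel_measurable M" "strongly_measurable M f"
  shows "strongly_measurable M (\<lambda>x. scaleC (\<psi> x) (f x))"
  using assms by (intro strongly_measurable_compose2[where p=scaleC])
    (auto simp: strongly_measurable_iff_borel_measurable intro: scaleC.tendsto)

lemma nn_integral_norm_scaleC_le:
  assumes "strongly_measurable M f" "\<And>x. x \<in> space M \<Longrightarrow> norm (\<psi> x) \<le> B" "0 \<le> B"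
  shows "L1_norm M (\<lambda>x. scaleC (\<psi> x) (f x)) \<le> ennreal B * L1_norm M f"
proof -
  note [measurable] = assms(1)
  have "L1_norm M (\<lambda>x. scaleC (\<psi> x) (f x)) \<le> (\<integral>\<^sup>+x. ennreal B * ennreal (norm (f x)) \<partial>M)"
    using assms(2,3) by (intro nn_integral_mono)
      (auto simp: norm_scaleC ennreal_mult[symmetric] intro!: ennreal_leI mult_right_mono)
  also have "\<dots> = ennreal B * L1_norm M f" by (rule nn_integral_cmult) auto
  finally show ?thesis .
qed

lemma strongly_integrable_scaleC:
  assumes "\<psi> \<in> borel_measurable M" "strongly_integrable M f" "\<And>x. x \<in> space M \<Longrightarrow> norm (\<psi> x) \<le> B"
  shows "strongly_integrable M (\<lambda>x. scaleC (\<psi> x) (f x))"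
proof -
  have "norm (\<psi> x) \<le> max 0 B" if "x \<in> space M" for x using assms(3)[OF that] by simp
  then have "L1_norm M (\<lambda>x. scaleC (\<psi> x) (f x)) \<le> ennreal (max 0 B) * L1_norm M f"
    using assms(2) by (intro nn_integral_norm_scaleC_le) (auto simp: strongly_integrable_def)
  also have "\<dots> < \<infinity>" using assms(2) by (auto simp: strongly_integrable_def ennreal_mult_less_top)
  finally show ?thesis
    using assms(1,2) by (auto simp: strongly_integrable_def intro: strongly_measurable_scaleC)
qed

section \<open>Fourier coefficients\<close>

lemma has_strong_integral_fourier_coeff:
  assumes "strongly_integrable torus f"
  shows "has_strong_integral torus (\<lambda>\<omega>. scaleC (monomial (\<lambda>j. - \<alpha> j) \<omega>) (f \<omega>)) (fourier_coeff f \<alpha>)"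
proof -
  have "strongly_integrable torus (\<lambda>\<omega>. scaleC (monomial (\<lambda>j. - \<alpha> j) \<omega>) (f \<omega>))"
    by (rule strongly_integrable_scaleC[OF measurable_monomial assms, where B=1]) (simp add: norm_monomial)
  then obtain I where I: "has_strong_integral torus (\<lambda>\<omega>. scaleC (monomial (\<lambda>j. - \<alpha> j) \<omega>) (f \<omega>)) I"
    using torus.has_strong_integral_exists by blast
  with strong_integral_eqI[OF I] show ?thesis by (simp add: fourier_coeff_def)
qed

lemma fourier_coeff_eqI:
  "has_strong_integral torus (\<lambda>\<omega>. scaleC (monomial (\<lambda>j. - \<alpha> j) \<omega>) (f \<omega>)) I \<Longrightarrow> fourier_coeff f \<alpha> = I"
  unfolding fourier_coeff_def by (rule strong_integral_eqI)

lemma fourier_coeff_dist_le: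
  assumes "strongly_integrable torus f" "strongly_integrable torus g"
  shows "ennreal (norm (fourier_coeff f \<alpha> - fourier_coeff g \<alpha>)) \<le> L1_norm torus (\<lambda>\<omega>. f \<omega> - g \<omega>)"
proof -
  have "ennreal (norm (fourier_coeff f \<alpha> - fourier_coeff g \<alpha>)) \<le>
    L1_norm torus (\<lambda>\<omega>. scaleC (monomial (\<lambda>j. - \<alpha> j) \<omega>) (f \<omega>) - scaleC (monomial (\<lambda>j. - \<alpha> j) \<omega>) (g \<omega>))"
    by (intro has_strong_integral_dist_le has_strong_integral_fourier_coeff assms)
  also have "\<dots> = L1_norm torus (\<lambda>\<omega>. f \<omega> - g \<omega>)"
    by (intro nn_integral_cong) (simp add: scaleC.diff_right[symmetric] norm_scaleC norm_monomial)
  finally show ?thesis .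
qed

lemma fourier_coeff_add:
  assumes "strongly_integrable torus f" "strongly_integrable torus g"
  shows "fourier_coeff (\<lambda>\<omega>. f \<omega> + g \<omega>) \<alpha> = fourier_coeff f \<alpha> + fourier_coeff g \<alpha>"
  using has_strong_integral_add[OF assms[THEN has_strong_integral_fourier_coeff]]
  by (intro fourier_coeff_eqI) (simp add: scaleC_add_right)

lemma fourier_coeff_diff:
  assumes "strongly_integrable torus f" "strongly_integrable torus g"
  shows "fourier_coeff (\<lambda>\<omega>. f \<omega> - g \<omega>) \<alpha> = fourier_coeff f \<alpha> - fourier_coeff g \<alpha>"
  using has_strong_integral_diff[OF assms[THEN has_strong_integral_fourier_coeff]]
  by (intro fourier_coeff_eqI) (simp add: scaleC.diff_right)

lemma has_strong_integral_scaleC_left: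
  assumes "integrable M (u :: _ \<Rightarrow> complex)"
  shows "has_strong_integral M (\<lambda>x. scaleC (u x) y) (scaleC (\<integral>x. u x \<partial>M) y)"
  by (rule has_strong_integral_bounded_linear[OF scaleC.bounded_linear_left])
    (simp add: has_strong_integral_iff_has_bochner_integral has_bochner_integral_integrable assms)

text \<open>
  By the functional class principle, \<open>h\<close> has integral 0 over every measurable set. Let \<open>d \<noteq> 0\<close> and let \<open>A\<close> be
  the set where \<open>h\<close> is closer to \<open>d\<close> than half the norm of \<open>d\<close>. The integral of \<open>d - h\<close> over \<open>A\<close> is the measure
  of \<open>A\<close> times \<open>d\<close>, but by the choice of \<open>A\<close> it has at most half that norm; so \<open>A\<close> is null. The
  values of a sequence of simple functions that tends to \<open>h\<close> are countably many \<open>d\<close>, whose sets \<open>A\<close> cover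
  the set where \<open>h\<close> is nonzero.
\<close>

lemma fourier_coeff_zero_imp_AE_zero:
  fixes h :: "(nat \<Rightarrow> complex) \<Rightarrow> 'a::complex_banach"
  assumes h: "strongly_integrable torus h" and z: "\<And>\<alpha>. \<alpha> \<in> fin_int_seqs \<Longrightarrow> fourier_coeff h \<alpha> = 0"
  shows "AE \<omega> in torus. h \<omega> = 0"
proof -
  note hm[measurable] = strongly_integrable_imp_measurable[OF h]
  have weighted: "has_strong_integral torus (\<lambda>\<omega>. scaleC (indicator A \<omega>) (h \<omega>)) 0" if "A \<in> sets torus" for A
    using that
  proof (rule torus_bounded_functional_class[where Q="\<lambda>\<psi>. has_strong_integral torus (\<lambda>\<omega>. scaleC (\<psi> \<omega>) (h \<omega>)) 0"])
    fix \<alpha> assume "\<alpha> \<in> fin_int_seqs"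
    then have "fourier_coeff h (\<lambda>j. - \<alpha> j) = 0" by (intro z fin_int_seqs_uminus)
    with has_strong_integral_fourier_coeff[OF h, of "\<lambda>j. - \<alpha> j"]
    show "has_strong_integral torus (\<lambda>\<omega>. scaleC (monomial \<alpha> \<omega>) (h \<omega>)) 0" by simp
  next
    fix f g
    assume "has_strong_integral torus (\<lambda>\<omega>. scaleC (f \<omega>) (h \<omega>)) 0"
      "has_strong_integral torus (\<lambda>\<omega>. scaleC (g \<omega>) (h \<omega>)) 0"
    from has_strong_integral_add[OF this]
    show "has_strong_integral torus (\<lambda>\<omega>. scaleC (f \<omega> + g \<omega>) (h \<omega>)) 0" by (simp add: scaleC_add_left)
  next
    fix f c assume "has_strong_integral torus (\<lambda>\<omega>. scaleC (f \<omega>) (h \<omega>)) 0"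
    from has_strong_integral_bounded_linear[OF scaleC.bounded_linear_right[of c] this]
    show "has_strong_integral torus (\<lambda>\<omega>. scaleC (c * f \<omega>) (h \<omega>)) 0"
      by (simp add: scaleC_scaleC scaleC.zero_right)
  next
    fix f g B
    assume fm[measurable]: "\<And>n::nat. f n \<in> borel_measurable torus" and g[measurable]: "g \<in> borel_measurable torus"
      and B: "\<And>n \<omega>. \<omega> \<in> space torus \<Longrightarrow> norm (f n \<omega>) \<le> B"
      and Bg: "\<And>\<omega>. \<omega> \<in> space torus \<Longrightarrow> norm (g \<omega>) \<le> B"
      and lim: "\<And>\<omega>. \<omega> \<in> space torus \<Longrightarrow> (\<lambda>n. f n \<omega>) \<longlonglongrightarrow> g \<omega>"
      and f: "\<And>n. has_strong_integral torus (\<lambda>\<omega>. scaleC (f n \<omega>) (h \<omega>)) 0"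
    have "strongly_integrable torus (\<lambda>\<omega>. scaleC (g \<omega>) (h \<omega>))"
      by (rule strongly_integrable_scaleC[OF g h Bg])
    then obtain I where I: "has_strong_integral torus (\<lambda>\<omega>. scaleC (g \<omega>) (h \<omega>)) I"
      using torus.has_strong_integral_exists by blast
    have sm: "strongly_measurable torus (\<lambda>\<omega>. scaleC (g \<omega>) (h \<omega>) - scaleC (f n \<omega>) (h \<omega>))" for n
      by (intro strongly_measurable_diff strongly_measurable_scaleC hm) auto
    note [measurable] = sm
    let ?D = "\<lambda>n \<omega>. scaleC (g \<omega>) (h \<omega>) - scaleC (f n \<omega>) (h \<omega>)"
    have "(\<lambda>n. L1_norm torus (\<lambda>\<omega>. ?D n \<omega>)) \<longlonglongrightarrow> (\<integral>\<^sup>+\<omega>. 0 \<partial>torus)"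
    proof (rule nn_integral_dominated_convergence[where w="\<lambda>\<omega>. ennreal (2 * B) * ennreal (norm (h \<omega>))"])
      show "(\<integral>\<^sup>+\<omega>. ennreal (2 * B) * ennreal (norm (h \<omega>)) \<partial>torus) < \<infinity>"
        using h by (subst nn_integral_cmult) (auto simp: strongly_integrable_def ennreal_mult_less_top)
      show "AE \<omega> in torus. ennreal (norm (?D n \<omega>)) \<le> ennreal (2 * B) * ennreal (norm (h \<omega>))" for n
      proof (rule AE_I2)
        fix \<omega> assume w: "\<omega> \<in> space torus"
        have "norm (g \<omega> - f n \<omega>) \<le> 2 * B"
          using norm_triangle_ineq4[of "g \<omega>" "f n \<omega>"] B[OF w, of n] Bg[OF w] by linarith
        then have "norm (g \<omega> - f n \<omega>) * norm (h \<omega>) \<le> 2 * B * norm (h \<omega>)" by (rule mult_right_mono) simp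
        moreover have "0 \<le> B" using Bg[OF w] norm_ge_zero order_trans by blast
        ultimately show "ennreal (norm (?D n \<omega>)) \<le> ennreal (2 * B) * ennreal (norm (h \<omega>))"
          by (subst ennreal_mult[symmetric]) (auto simp: scaleC.diff_left[symmetric] norm_scaleC intro!: ennreal_leI)
      qed
      show "AE \<omega> in torus. (\<lambda>n. ennreal (norm (?D n \<omega>))) \<longlonglongrightarrow> 0"
      proof (rule AE_I2)
        fix \<omega> assume w: "\<omega> \<in> space torus"
        have "(\<lambda>n. norm (?D n \<omega>)) \<longlonglongrightarrow> norm (scaleC (g \<omega>) (h \<omega>) - scaleC (g \<omega>) (h \<omega>))"
          by (intro tendsto_norm tendsto_diff tendsto_const scaleC.tendsto lim w)
        from tendsto_ennrealI[OF this]
        show "(\<lambda>n. ennreal (norm (?D n \<omega>))) \<longlonglongrightarrow> 0" by simp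
      qed
    qed auto
    moreover have "ennreal (norm (I - 0)) \<le> L1_norm torus (\<lambda>\<omega>. ?D n \<omega>)" for n
      by (intro has_strong_integral_dist_le I f)
    ultimately have "ennreal (norm (I - 0)) \<le> 0" by (intro LIMSEQ_le_const[of _ 0]) auto
    then have "I = 0" by simp
    with I show "has_strong_integral torus (\<lambda>\<omega>. scaleC (g \<omega>) (h \<omega>)) 0" by simp
  qed
  obtain s where s: "\<And>n::nat. simple_function torus (s n)" "\<And>\<omega>. \<omega> \<in> space torus \<Longrightarrow> (\<lambda>n. s n \<omega>) \<longlonglongrightarrow> h \<omega>"
    using hm unfolding strongly_measurable_def by blast
  define D where "D = (\<Union>n. s n ` space torus) - {0}"
  have "countable (s n ` space torus)" for n by (intro countable_finite simple_functionD(1) s)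
  then have "countable D" unfolding D_def by (intro countable_Diff) auto
  have null: "AE \<omega> in torus. \<not> 2 * norm (h \<omega> - d) \<le> norm d" if "d \<in> D" for d
  proof -
    have d0: "d \<noteq> 0" using that by (auto simp: D_def)
    have "strongly_measurable torus (\<lambda>\<omega>. h \<omega> - d)"
      by (intro strongly_measurable_diff hm strongly_measurable_simple simple_function_const)
    note [measurable] = strongly_measurable_imp_borel[OF this]
    define A where "A = {\<omega>\<in>space torus. 2 * norm (h \<omega> - d) \<le> norm d}"
    have A[measurable]: "A \<in> sets torus" unfolding A_def by measurable
    note weighted[OF A]
    moreover have "has_strong_integral torus (\<lambda>\<omega>. scaleC (indicator A \<omega>) d) (scaleC (\<integral>\<omega>. indicator A \<omega> \<partial>torus) d)"
      using A by (intro has_strong_integral_scaleC_left torus.integrable_const_bound[where B=1] borel_measurable_indicator AE_I2)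
        (auto simp: indicator_def)
    ultimately have "ennreal (norm (scaleC (\<integral>\<omega>. indicator A \<omega> \<partial>torus) d - 0)) \<le>
        L1_norm torus (\<lambda>\<omega>. scaleC (indicator A \<omega>) d - scaleC (indicator A \<omega>) (h \<omega>))"
      by (intro has_strong_integral_dist_le)
    also have "\<dots> \<le> (\<integral>\<^sup>+\<omega>. ennreal (norm d / 2) * indicator A \<omega> \<partial>torus)"
      by (intro nn_integral_mono) (auto simp: scaleC.diff_right[symmetric] norm_scaleC A_def indicator_def norm_minus_commute intro!: ennreal_leI)
    also have "\<dots> = ennreal (norm d / 2) * emeasure torus A" using A by (rule nn_integral_cmult_indicator)
    also have "\<dots> = ennreal (norm d / 2 * measure torus A)"
      unfolding torus.emeasure_eq_measure by (rule ennreal_mult[symmetric]) auto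
    finally have le: "norm (scaleC (\<integral>\<omega>. indicator A \<omega> \<partial>torus) d) \<le> norm d / 2 * measure torus A" by simp
    have "(\<integral>\<omega>. indicator A \<omega> \<partial>torus) = (\<integral>\<omega>. complex_of_real (indicator A \<omega>) \<partial>torus)"
      by (intro Bochner_Integration.integral_cong) (auto simp: indicator_def)
    also have "\<dots> = of_real (measure torus A)"
      using A sets.sets_into_space[OF A] by (simp add: integral_complex_of_real Int_absorb2)
    finally have "measure torus A * norm d \<le> norm d / 2 * measure torus A" using le by (simp add: norm_scaleC)
    then have "measure torus A * norm d \<le> 0" by (simp add: field_simps)
    then have "measure torus A = 0"
      using d0 measure_nonneg[of torus A] by (simp add: mult_le_0_iff)
    then have "emeasure torus A = 0" by (simp add: torus.emeasure_eq_measure)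
    then have "AE \<omega> in torus. \<omega> \<notin> A" using A by (intro AE_not_in) (auto simp: null_sets_def)
    then show ?thesis by (rule AE_mp) (auto simp: A_def)
  qed
  then have "AE \<omega> in torus. \<forall>d\<in>D. \<not> 2 * norm (h \<omega> - d) \<le> norm d"
    using \<open>countable D\<close> by (subst AE_ball_countable) auto
  then show ?thesis
  proof (rule AE_mp, intro AE_I2 impI)
    fix \<omega> assume w: "\<omega> \<in> space torus" and d: "\<forall>d\<in>D. \<not> 2 * norm (h \<omega> - d) \<le> norm d"
    show "h \<omega> = 0"
    proof (rule ccontr)
      assume "h \<omega> \<noteq> 0"
      then have "norm (h \<omega>) / 3 > 0" by simp
      from LIMSEQ_D[OF s(2)[OF w] this] obtain n where n: "norm (s n \<omega> - h \<omega>) < norm (h \<omega>) / 3" by blast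
      then have "norm (h \<omega>) - norm (s n \<omega>) < norm (h \<omega>) / 3"
        using norm_triangle_ineq2[of "h \<omega>" "s n \<omega>"] by (simp add: norm_minus_commute)
      with n have "2 * norm (h \<omega> - s n \<omega>) \<le> norm (s n \<omega>)" "s n \<omega> \<noteq> 0" by (auto simp: norm_minus_commute)
      with d w show False by (auto simp: D_def)
    qed
  qed
qed

section \<open>The random shift of the torus\<close>

abbreviation torus_pair :: "((nat \<Rightarrow> complex) \<times> (nat \<Rightarrow> complex)) measure" where
  "torus_pair \<equiv> torus \<Otimes>\<^sub>M torus"

text \<open>
  For \<open>\<eta>\<close> distributed according to Haar measure, the second factor is distributed according to the product of the
  Poisson measures of radii \<open>r j\<close>; averaging over \<open>\<eta>\<close> is convolution with that product.
\<close>

definition torus_shift :: "(nat \<Rightarrow> real) \<Rightarrow> (nat \<Rightarrow> complex) \<times> (nat \<Rightarrow> complex) \<Rightarrow> nat \<Rightarrow> complex" where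
  "torus_shift r = (\<lambda>(\<omega>, \<eta>) j. \<omega> j * torus_moebius r \<eta> j)"

definition shift_radii :: "(nat \<Rightarrow> real) \<Rightarrow> bool" where
  "shift_radii r \<longleftrightarrow> (\<forall>j. 0 \<le> r j \<and> r j < 1)"

interpretation torus2: pair_prob_space torus torus ..

lemma measurable_torus_moebius_shift_radii: "shift_radii r \<Longrightarrow> torus_moebius r \<in> measurable torus torus"
  by (rule measurable_torus_moebius) (auto simp: shift_radii_def)

lemma measurable_circle_ident: "(\<lambda>z. z) \<in> borel_measurable circle_measure"
  by (intro borel_measurable_circle_continuous continuous_intros)

lemma measurable_torus_shift:
  assumes "shift_radii r"
  shows "torus_shift r \<in> measurable torus_pair torus"
proof (intro measurable_into_torus measurable_into_circle)
  fix j
  note [measurable] = measurable_torus_moebius_shift_radii[OF assms]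
  have c: "(\<lambda>\<omega>. \<omega> j) \<in> borel_measurable torus"
    by (rule measurable_compose[OF measurable_torus_coordinate measurable_circle_ident])
  have "(\<lambda>z. fst z j * torus_moebius r (snd z) j) \<in> borel_measurable torus_pair"
    by (intro borel_measurable_times measurable_compose[OF _ c]
      measurable_fst measurable_compose[OF measurable_snd measurable_torus_moebius_shift_radii[OF assms]])
  then show "(\<lambda>z. torus_shift r z j) \<in> borel_measurable torus_pair"
    by (simp add: torus_shift_def case_prod_beta)
  fix z assume "z \<in> space torus_pair"
  then have "fst z \<in> space torus" "torus_moebius r (snd z) \<in> space torus"
    using measurable_space[OF measurable_torus_moebius_shift_radii[OF assms]] by (auto simp: space_pair_measure)
  then show "norm (torus_shift r z j) = 1"
    by (simp add: torus_shift_def case_prod_beta norm_mult space_torus)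
qed

lemma measurable_torus_shift_section:
  assumes "shift_radii r" "\<omega> \<in> space torus"
  shows "(\<lambda>\<eta>. torus_shift r (\<omega>, \<eta>)) \<in> measurable torus torus"
  using measurable_compose[OF measurable_Pair1'[OF assms(2)] measurable_torus_shift[OF assms(1)]] .

lemma monomial_torus_shift:
  "monomial \<alpha> (torus_shift r (\<omega>, \<eta>)) = monomial \<alpha> \<omega> * monomial \<alpha> (torus_moebius r \<eta>)"
  by (simp add: torus_shift_def monomial_mult)

lemma integral_bounded_limit:
  fixes F :: "nat \<Rightarrow> 'a \<Rightarrow> complex"
  assumes "finite_measure M" "\<And>n. F n \<in> borel_measurable M" "\<And>n x. x \<in> space M \<Longrightarrow> norm (F n x) \<le> B"
    "\<And>x. x \<in> space M \<Longrightarrow> (\<lambda>n. F n x) \<longlonglongrightarrow> G x"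
  shows "(\<lambda>n. \<integral>x. F n x \<partial>M) \<longlonglongrightarrow> (\<integral>x. G x \<partial>M)"
proof -
  interpret finite_measure M by fact
  have [measurable]: "G \<in> borel_measurable M"
    by (rule borel_measurable_LIMSEQ_metric[where f=F]) (use assms in auto)
  show ?thesis
    by (rule integral_dominated_convergence[where w="\<lambda>_. B"]) (use assms in \<open>auto intro!: AE_I2\<close>)
qed

lemma torus_measure_eqI:
  assumes M: "prob_space M" "sets M = sets torus"
    and eq: "\<And>\<alpha>. \<alpha> \<in> fin_int_seqs \<Longrightarrow> (\<integral>\<omega>. monomial \<alpha> \<omega> \<partial>M) = (\<integral>\<omega>. monomial \<alpha> \<omega> \<partial>torus)"
  shows "M = torus"
proof -
  interpret M: prob_space M by fact
  have sp: "space M = space torus" using M(2) by (rule sets_eq_imp_space_eq)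
  have mM: "borel_measurable M = borel_measurable torus" by (rule measurable_cong_sets[OF M(2) refl])
  have eq_ind: "(\<integral>\<omega>. indicator A \<omega> \<partial>M) = (\<integral>\<omega>. indicator A \<omega> \<partial>torus :: complex)" if "A \<in> sets torus" for A
    using that
  proof (rule torus_bounded_functional_class[where Q="\<lambda>\<psi>. (\<integral>\<omega>. \<psi> \<omega> \<partial>M) = (\<integral>\<omega>. \<psi> \<omega> \<partial>torus)"])
    fix f g assume fg: "bounded_measurable torus f" "bounded_measurable torus g"
      and "(\<integral>\<omega>. f \<omega> \<partial>M) = (\<integral>\<omega>. f \<omega> \<partial>torus)" "(\<integral>\<omega>. g \<omega> \<partial>M) = (\<integral>\<omega>. g \<omega> \<partial>torus)"
    moreover have "bounded_measurable M f" "bounded_measurable M g"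
      using fg by (simp_all add: bounded_measurable_def mM sp)
    ultimately show "(\<integral>\<omega>. f \<omega> + g \<omega> \<partial>M) = (\<integral>\<omega>. f \<omega> + g \<omega> \<partial>torus)"
      by (simp add: bounded_measurable_integrable[OF M.finite_measure_axioms]
        bounded_measurable_integrable[OF torus.finite_measure_axioms])
  next
    fix f :: "nat \<Rightarrow> (nat \<Rightarrow> complex) \<Rightarrow> complex" and g B
    assume fm: "\<And>n. f n \<in> borel_measurable torus"
      and B: "\<And>n \<omega>. \<omega> \<in> space torus \<Longrightarrow> norm (f n \<omega>) \<le> B"
      and lim: "\<And>\<omega>. \<omega> \<in> space torus \<Longrightarrow> (\<lambda>n. f n \<omega>) \<longlonglongrightarrow> g \<omega>"
      and f: "\<And>n. (\<integral>\<omega>. f n \<omega> \<partial>M) = (\<integral>\<omega>. f n \<omega> \<partial>torus)"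
    have "(\<lambda>n. \<integral>\<omega>. f n \<omega> \<partial>M) \<longlonglongrightarrow> (\<integral>\<omega>. g \<omega> \<partial>M)"
      by (rule integral_bounded_limit[where B=B])
        (use fm B lim in \<open>auto simp: mM sp intro: M.finite_measure_axioms\<close>)
    moreover have "(\<lambda>n. \<integral>\<omega>. f n \<omega> \<partial>torus) \<longlonglongrightarrow> (\<integral>\<omega>. g \<omega> \<partial>torus)"
      by (rule integral_bounded_limit[where B=B])
        (use fm B lim in \<open>auto intro: torus.finite_measure_axioms\<close>)
    ultimately show "(\<integral>\<omega>. g \<omega> \<partial>M) = (\<integral>\<omega>. g \<omega> \<partial>torus)"
      using LIMSEQ_unique by (simp add: f)
  qed (auto simp: eq)
  show ?thesis
  proof (rule measure_eqI[OF M(2)])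
    fix A assume A: "A \<in> sets M"
    then have A': "A \<in> sets torus" by (simp add: M(2))
    have ind: "indicator A \<omega> = complex_of_real (indicator A \<omega>)" for \<omega> by (simp add: indicator_def)
    have "(\<integral>\<omega>. complex_of_real (indicator A \<omega>) \<partial>M) = (\<integral>\<omega>. complex_of_real (indicator A \<omega>) \<partial>torus)"
      using eq_ind[OF A'] by (simp add: ind)
    then have "measure M A = measure torus A"
      using sets.sets_into_space[OF A] sets.sets_into_space[OF A']
      by (simp add: integral_complex_of_real Int_absorb2)
    then show "emeasure M A = emeasure torus A"
      by (simp add: M.emeasure_eq_measure torus.emeasure_eq_measure)
  qed
qed

lemma torus2_integral_bounded:
  fixes F :: "_ \<Rightarrow> complex"
  assumes "F \<in> borel_measurable torus_pair" "\<And>z. z \<in> space torus_pair \<Longrightarrow> norm (F z) \<le> B"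
  shows "(\<integral>z. F z \<partial>torus_pair) = (\<integral>\<omega>. \<integral>\<eta>. F (\<omega>, \<eta>) \<partial>torus \<partial>torus)"
  using assms by (intro torus2.integral_fst'[symmetric] torus2.P.integrable_const_bound[where B=B]) auto

text \<open>
  Both measures have the same integrals of monomials: for the shifted one they factor, and the factor over \<open>\<omega>\<close>
  is 0 unless the monomial is constant.
\<close>

lemma distr_torus_shift:
  assumes r: "shift_radii r"
  shows "distr torus_pair torus (torus_shift r) = torus"
proof (rule torus_measure_eqI)
  note m[measurable] = measurable_torus_shift[OF r]
  show "prob_space (distr torus_pair torus (torus_shift r))"
    by (rule torus2.prob_space_distr[OF m])
  fix \<alpha> assume \<alpha>: "\<alpha> \<in> fin_int_seqs"
  have "(\<integral>\<omega>. monomial \<alpha> \<omega> \<partial>distr torus_pair torus (torus_shift r)) = (\<integral>z. monomial \<alpha> (torus_shift r z) \<partial>torus_pair)"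
    by (intro integral_distr m measurable_monomial)
  also have "\<dots> = (\<integral>\<omega>. \<integral>\<eta>. monomial \<alpha> (torus_shift r (\<omega>, \<eta>)) \<partial>torus \<partial>torus)"
    by (rule torus2_integral_bounded[where B=1])
      (auto intro: measurable_compose[OF m] eq_refl norm_monomial measurable_space[OF m])
  also have "\<dots> = (\<integral>\<eta>. monomial \<alpha> (torus_moebius r \<eta>) \<partial>torus) * (\<integral>\<omega>. monomial \<alpha> \<omega> \<partial>torus)"
    by (simp add: monomial_torus_shift mult.commute)
  also have "\<dots> = (\<integral>\<omega>. monomial \<alpha> \<omega> \<partial>torus)"
    by (simp add: torus_integral_monomial[OF \<alpha>] monomial_zero torus.prob_space)
  finally show "(\<integral>\<omega>. monomial \<alpha> \<omega> \<partial>distr torus_pair torus (torus_shift r)) = (\<integral>\<omega>. monomial \<alpha> \<omega> \<partial>torus)" .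
qed simp

lemma nn_integral_torus_shift:
  assumes r: "shift_radii r" and u: "u \<in> borel_measurable torus"
  shows "(\<integral>\<^sup>+z. u (torus_shift r z) \<partial>torus_pair) = (\<integral>\<^sup>+\<omega>. u \<omega> \<partial>torus)"
  using nn_integral_distr[OF measurable_torus_shift[OF r], of u] u by (simp add: distr_torus_shift[OF r])

lemma nn_integral_torus_shift_iterated:
  assumes r: "shift_radii r" and u: "u \<in> borel_measurable torus"
  shows "(\<integral>\<^sup>+\<omega>. \<integral>\<^sup>+\<eta>. u (torus_shift r (\<omega>, \<eta>)) \<partial>torus \<partial>torus) = (\<integral>\<^sup>+\<omega>. u \<omega> \<partial>torus)"
  using torus.nn_integral_fst[OF measurable_compose[OF measurable_torus_shift[OF r] u]]
  by (simp add: nn_integral_torus_shift[OF r u])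

lemma borel_measurable_nn_integral_torus_shift:
  assumes r: "shift_radii r" and u: "u \<in> borel_measurable torus"
  shows "(\<lambda>\<omega>. \<integral>\<^sup>+\<eta>. u (torus_shift r (\<omega>, \<eta>)) \<partial>torus) \<in> borel_measurable torus"
  using torus.borel_measurable_nn_integral_fst[OF measurable_compose[OF measurable_torus_shift[OF r] u]] by simp

section \<open>Averages over random shifts\<close>

text \<open>
  A relation rather than a function, since the inner integral exists only for almost every \<open>\<omega>\<close> and strong
  measurability of the result has to be arranged on a null set.
\<close>

definition torus_average :: "(nat \<Rightarrow> real) \<Rightarrow> ((nat \<Rightarrow> complex) \<Rightarrow> 'a::complex_banach) \<Rightarrow> ((nat \<Rightarrow> complex) \<Rightarrow> 'a) \<Rightarrow> bool" where
  "torus_average r f g \<longleftrightarrow> strongly_integrable torus g \<and>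
     (AE \<omega> in torus. has_strong_integral torus (\<lambda>\<eta>. f (torus_shift r (\<omega>, \<eta>))) (g \<omega>))"

lemma torus_average_norm_le:
  assumes "torus_average r f g"
  shows "AE \<omega> in torus. ennreal (norm (g \<omega>)) \<le> L1_norm torus (\<lambda>\<eta>. f (torus_shift r (\<omega>, \<eta>)))"
  using assms unfolding torus_average_def by (auto elim!: eventually_mono intro: has_strong_integral_norm_le)

lemma torus_average_add:
  assumes "torus_average r f g" "torus_average r f' g'"
  shows "torus_average r (\<lambda>\<omega>. f \<omega> + f' \<omega>) (\<lambda>\<omega>. g \<omega> + g' \<omega>)"
proof -
  have "AE \<omega> in torus. has_strong_integral torus (\<lambda>\<eta>. f (torus_shift r (\<omega>, \<eta>))) (g \<omega>)"
    "AE \<omega> in torus. has_strong_integral torus (\<lambda>\<eta>. f' (torus_shift r (\<omega>, \<eta>))) (g' \<omega>)"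
    using assms by (auto simp: torus_average_def)
  then have "AE \<omega> in torus. has_strong_integral torus (\<lambda>\<eta>. f (torus_shift r (\<omega>, \<eta>)) + f' (torus_shift r (\<omega>, \<eta>))) (g \<omega> + g' \<omega>)"
    by eventually_elim (rule has_strong_integral_add)
  then show ?thesis using assms by (auto simp: torus_average_def intro: strongly_integrable_add)
qed

lemma torus_average_dist_le:
  assumes r: "shift_radii r" and "torus_average r f g" "torus_average r f' g'"
    and f: "strongly_measurable torus f" "strongly_measurable torus f'"
  shows "L1_norm torus (\<lambda>\<omega>. g \<omega> - g' \<omega>) \<le> L1_norm torus (\<lambda>\<omega>. f \<omega> - f' \<omega>)"
proof -
  note [measurable] = strongly_measurable_diff[OF f]
  have "AE \<omega> in torus. has_strong_integral torus (\<lambda>\<eta>. f (torus_shift r (\<omega>, \<eta>))) (g \<omega>)"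
    "AE \<omega> in torus. has_strong_integral torus (\<lambda>\<eta>. f' (torus_shift r (\<omega>, \<eta>))) (g' \<omega>)"
    using assms by (auto simp: torus_average_def)
  then have "AE \<omega> in torus. ennreal (norm (g \<omega> - g' \<omega>)) \<le> L1_norm torus (\<lambda>\<eta>. f (torus_shift r (\<omega>, \<eta>)) - f' (torus_shift r (\<omega>, \<eta>)))"
    by eventually_elim (rule has_strong_integral_dist_le)
  then have "L1_norm torus (\<lambda>\<omega>. g \<omega> - g' \<omega>) \<le> (\<integral>\<^sup>+\<omega>. L1_norm torus (\<lambda>\<eta>. f (torus_shift r (\<omega>, \<eta>)) - f' (torus_shift r (\<omega>, \<eta>))) \<partial>torus)"
    by (rule nn_integral_mono_AE)
  also have "\<dots> = L1_norm torus (\<lambda>\<omega>. f \<omega> - f' \<omega>)"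
    by (rule nn_integral_torus_shift_iterated[OF r, of "\<lambda>\<omega>. ennreal (norm (f \<omega> - f' \<omega>))"]) measurable
  finally show ?thesis .
qed

text \<open>
  The average of the indicator of \<open>A\<close>, that is the probability that the shift of \<open>\<omega>\<close> falls into \<open>A\<close>.
\<close>

definition shift_probability :: "(nat \<Rightarrow> real) \<Rightarrow> (nat \<Rightarrow> complex) set \<Rightarrow> (nat \<Rightarrow> complex) \<Rightarrow> real" where
  "shift_probability r A \<omega> = (\<integral>\<eta>. indicator A (torus_shift r (\<omega>, \<eta>)) \<partial>torus)"

lemma borel_measurable_shift_probability:
  assumes r: "shift_radii r" and A: "A \<in> sets torus"
  shows "shift_probability r A \<in> borel_measurable torus"
proof -
  note [measurable] = measurable_torus_shift[OF r] A
  show ?thesis unfolding shift_probability_def[abs_def] by measurable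
qed

lemma shift_probability_bounds: "0 \<le> shift_probability r A \<omega>" "shift_probability r A \<omega> \<le> 1"
proof -
  show "0 \<le> shift_probability r A \<omega>" unfolding shift_probability_def by (rule Bochner_Integration.integral_nonneg) simp
  show "shift_probability r A \<omega> \<le> 1"
  proof (cases "integrable torus (\<lambda>\<eta>. indicat_real A (torus_shift r (\<omega>, \<eta>)))")
    case True
    then have "shift_probability r A \<omega> \<le> (\<integral>\<eta>. 1 \<partial>torus)" unfolding shift_probability_def
      by (intro integral_mono) (auto simp: indicator_def)
    then show ?thesis by (simp add: torus.prob_space)
  next
    case False
    then show ?thesis unfolding shift_probability_def by (simp add: not_integrable_integral_eq)
  qed
qed

lemma torus_average_indicator:
  fixes x :: "'a::complex_banach"
  assumes r: "shift_radii r" and A: "A \<in> sets torus"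
  shows "torus_average r (\<lambda>\<omega>. indicator A \<omega> *\<^sub>R x) (\<lambda>\<omega>. shift_probability r A \<omega> *\<^sub>R x)"
proof -
  have "strongly_measurable torus (\<lambda>\<omega>. shift_probability r A \<omega> *\<^sub>R x)"
    using borel_measurable_shift_probability[OF r A]
    by (intro strongly_measurable_compose2[where p="\<lambda>c _. c *\<^sub>R x" and g="\<lambda>_. 0::real"])
      (auto simp: strongly_measurable_iff_borel_measurable intro: tendsto_intros)
  moreover have "norm (shift_probability r A \<omega> *\<^sub>R x) \<le> norm x" for \<omega>
    using shift_probability_bounds[of r A \<omega>] by (simp add: mult_left_le_one_le)
  ultimately have "strongly_integrable torus (\<lambda>\<omega>. shift_probability r A \<omega> *\<^sub>R x)"
    by (rule torus.strongly_integrable_bounded)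
  moreover have "has_strong_integral torus (\<lambda>\<eta>. indicator A (torus_shift r (\<omega>, \<eta>)) *\<^sub>R x) (shift_probability r A \<omega> *\<^sub>R x)"
    if w: "\<omega> \<in> space torus" for \<omega>
  proof (rule has_strong_integral_bounded_linear[OF bounded_linear_scaleR_left])
    note [measurable] = measurable_torus_shift_section[OF r w] A
    have "integrable torus (\<lambda>\<eta>. indicat_real A (torus_shift r (\<omega>, \<eta>)))"
      by (rule torus.integrable_const_bound[where B=1]) auto
    then show "has_strong_integral torus (\<lambda>\<eta>. indicator A (torus_shift r (\<omega>, \<eta>))) (shift_probability r A \<omega>)"
      unfolding has_strong_integral_iff_has_bochner_integral shift_probability_def
      by (rule has_bochner_integral_integrable)
  qed
  ultimately show ?thesis by (auto simp: torus_average_def)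
qed

text \<open>
  For a fast limit, the shifted distances \<open>f - s n\<close> are small in \<open>L\<^sub>1\<close> of both variables, because the shift preserves the
  measure. Hence they tend to 0 in \<open>L\<^sub>1\<close> of \<open>\<eta>\<close> for almost every \<open>\<omega>\<close>, and so the averages of the \<open>s n\<close> converge
  at these \<open>\<omega>\<close> to the inner integral of \<open>f\<close>.
\<close>

lemma torus_average_exists:
  assumes r: "shift_radii r" and f: "strongly_integrable torus f"
  shows "\<exists>g. torus_average r f g"
  using f
proof (induction rule: torus.strongly_integrable_induct)
  case (indicator A x)
  show ?case by (rule exI, rule torus_average_indicator[OF r indicator])
next
  case (add f h)
  from add(3) obtain g where g: "torus_average r f g" ..
  from add(4) obtain k where k: "torus_average r h k" ..
  show ?case by (rule exI, rule torus_average_add[OF g k])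
next
  case (lim f s)
  from lim.IH have "\<forall>n. \<exists>g. torus_average r (s n) g" ..
  from choice[OF this] obtain g where "\<forall>n. torus_average r (s n) (g n)" ..
  then have g: "torus_average r (s n) (g n)" for n ..
  have gi: "strongly_integrable torus (g n)" for n using g by (simp add: torus_average_def)
  note fm = strongly_integrable_imp_measurable[OF lim.hyps(1)]
  note [measurable] = fm strongly_measurable_diff[OF fm strongly_integrable_imp_measurable[OF lim.hyps(2)]]
  let ?N = "\<lambda>h \<omega>. L1_norm torus (\<lambda>\<eta>. h (torus_shift r (\<omega>, \<eta>)))"
  let ?d = "\<lambda>n \<omega>. L1_norm torus (\<lambda>\<eta>. f (torus_shift r (\<omega>, \<eta>)) - s n (torus_shift r (\<omega>, \<eta>)))"
  let ?G = "\<lambda>\<omega>. strong_integral torus (\<lambda>\<eta>. f (torus_shift r (\<omega>, \<eta>)))"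
  have "(\<integral>\<^sup>+\<omega>. ?N f \<omega> \<partial>torus) = L1_norm torus f"
    by (rule nn_integral_torus_shift_iterated[OF r, of "\<lambda>\<omega>. ennreal (norm (f \<omega>))"]) measurable
  then have Nf: "(\<integral>\<^sup>+\<omega>. ?N f \<omega> \<partial>torus) < \<infinity>" using lim.hyps(1) by (simp add: strongly_integrable_def)
  have mN: "?N f \<in> borel_measurable torus"
    by (rule borel_measurable_nn_integral_torus_shift[OF r, of "\<lambda>\<omega>. ennreal (norm (f \<omega>))"]) measurable
  have "AE \<omega> in torus. ?N f \<omega> \<noteq> \<infinity>"
    by (rule nn_integral_PInf_AE[OF mN]) (use Nf in auto)
  moreover have "AE \<omega> in torus. (\<lambda>n. ?d n \<omega>) \<longlonglongrightarrow> 0"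
  proof (rule fast_L1_null_imp_AE_null)
    fix n
    show "(\<lambda>\<omega>. ?d n \<omega>) \<in> borel_measurable torus"
      by (rule borel_measurable_nn_integral_torus_shift[OF r, of "\<lambda>\<omega>. ennreal (norm (f \<omega> - s n \<omega>))"]) measurable
    have "(\<integral>\<^sup>+\<omega>. ?d n \<omega> \<partial>torus) = L1_norm torus (\<lambda>\<omega>. f \<omega> - s n \<omega>)"
      by (rule nn_integral_torus_shift_iterated[OF r, of "\<lambda>\<omega>. ennreal (norm (f \<omega> - s n \<omega>))"]) measurable
    then show "(\<integral>\<^sup>+\<omega>. ?d n \<omega> \<partial>torus) \<le> ennreal ((1/2)^n)"
      using lim.hyps(3) by simp
  qed
  moreover have "AE \<omega> in torus. \<forall>n. has_strong_integral torus (\<lambda>\<eta>. s n (torus_shift r (\<omega>, \<eta>))) (g n \<omega>)"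
    using g by (auto simp: AE_all_countable torus_average_def)
  ultimately have conv: "AE \<omega> in torus. has_strong_integral torus (\<lambda>\<eta>. f (torus_shift r (\<omega>, \<eta>))) (?G \<omega>)
     \<and> (\<lambda>n. g n \<omega>) \<longlonglongrightarrow> ?G \<omega>"
    using AE_space
  proof eventually_elim
    case (elim \<omega>)
    have "strongly_measurable torus (\<lambda>\<eta>. f (torus_shift r (\<omega>, \<eta>)))"
      by (rule strongly_measurable_comp[OF fm measurable_torus_shift_section[OF r elim(4)]])
    then have "strongly_integrable torus (\<lambda>\<eta>. f (torus_shift r (\<omega>, \<eta>)))"
      using elim(1) by (simp add: strongly_integrable_def less_top)
    then obtain I where I: "has_strong_integral torus (\<lambda>\<eta>. f (torus_shift r (\<omega>, \<eta>))) I"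
      using torus.has_strong_integral_exists by blast
    have "(\<lambda>n. ennreal (norm (I - g n \<omega>))) \<longlonglongrightarrow> 0"
    proof (rule tendsto_sandwich[OF _ _ tendsto_const elim(2)])
      show "\<forall>\<^sub>F n in sequentially. ennreal (norm (I - g n \<omega>)) \<le> ?d n \<omega>"
        using elim(3) by (intro always_eventually allI has_strong_integral_dist_le I) auto
    qed auto
    from tendsto_diff[OF tendsto_const[of I] tendsto_zero_of_ennreal_norm[OF this]] have "(\<lambda>n. g n \<omega>) \<longlonglongrightarrow> I" by simp
    with I strong_integral_eqI[OF I] show ?case by simp
  qed
  then have "AE \<omega> in torus. (\<lambda>n. g n \<omega>) \<longlonglongrightarrow> ?G \<omega>"
    by eventually_elim simp
  from strongly_measurable_AE_limit[OF gi this] obtain h where h: "strongly_measurable torus h"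
    "AE \<omega> in torus. h \<omega> = ?G \<omega>" by blast
  from h(2) conv have ae: "AE \<omega> in torus. has_strong_integral torus (\<lambda>\<eta>. f (torus_shift r (\<omega>, \<eta>))) (h \<omega>)"
    by eventually_elim simp
  then have "AE \<omega> in torus. ennreal (norm (h \<omega>)) \<le> ?N f \<omega>"
    by eventually_elim (rule has_strong_integral_norm_le)
  then have "L1_norm torus h \<le> (\<integral>\<^sup>+\<omega>. ?N f \<omega> \<partial>torus)"
    by (rule nn_integral_mono_AE)
  with Nf h(1) have "strongly_integrable torus h" by (auto simp: strongly_integrable_def)
  with ae show ?case by (auto simp: torus_average_def)
qed

section \<open>Fourier coefficients of averages\<close>

text \<open>
  The Fourier coefficient at \<open>-\<alpha>\<close> of the product of the Poisson measures. Its value is computed only for nonnegative \<open>\<alpha>\<close>, in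
  \<open>torus_integral_moebius_monomial\<close>.
\<close>

definition moebius_factor :: "(nat \<Rightarrow> real) \<Rightarrow> (nat \<Rightarrow> int) \<Rightarrow> complex" where
  "moebius_factor r \<alpha> = (\<integral>\<eta>. monomial \<alpha> (torus_moebius r \<eta>) \<partial>torus)"

lemma torus2_space: "z \<in> space torus_pair \<longleftrightarrow> fst z \<in> space torus \<and> snd z \<in> space torus"
  by (cases z) (simp add: space_pair_measure)

text \<open>
  The shift multiplies \<open>monomial \<beta>\<close> by a function of \<open>\<eta>\<close> alone, which produces the factor of \<open>\<beta>\<close>. By orthogonality it can be
  replaced by the factor of \<open>\<alpha>\<close>: the remaining integral vanishes for \<open>\<beta> \<noteq> \<alpha>\<close>. In this form both sides are
  linear in the monomial, and the identity extends to all bounded functions in its place.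
\<close>

lemma shift_monomial_integral:
  assumes r: "shift_radii r" and \<alpha>: "\<alpha> \<in> fin_int_seqs" and \<beta>: "\<beta> \<in> fin_int_seqs"
  shows "(\<integral>z. monomial (\<lambda>j. - \<alpha> j) (fst z) * monomial \<beta> (torus_shift r z) \<partial>torus_pair) =
    moebius_factor r \<alpha> * (\<integral>\<omega>. monomial (\<lambda>j. - \<alpha> j) \<omega> * monomial \<beta> \<omega> \<partial>torus)"
proof -
  note [measurable] = measurable_torus_shift[OF r]
  let ?\<gamma> = "\<lambda>j. - \<alpha> j + \<beta> j"
  have \<gamma>: "?\<gamma> \<in> fin_int_seqs" by (intro fin_int_seqs_add fin_int_seqs_uminus \<alpha> \<beta>)
  have eq: "(\<integral>\<omega>. monomial (\<lambda>j. - \<alpha> j) \<omega> * monomial \<beta> \<omega> \<partial>torus) = (if ?\<gamma> = (\<lambda>_. 0) then 1 else 0)"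
    by (subst torus_integral_monomial[OF \<gamma>, symmetric], rule Bochner_Integration.integral_cong[OF refl])
      (rule monomial_add[OF fin_int_seqs_uminus[OF \<alpha>] \<beta>, symmetric])
  have "(\<integral>z. monomial (\<lambda>j. - \<alpha> j) (fst z) * monomial \<beta> (torus_shift r z) \<partial>torus_pair) =
     (\<integral>\<omega>. \<integral>\<eta>. monomial (\<lambda>j. - \<alpha> j) (fst (\<omega>, \<eta>)) * monomial \<beta> (torus_shift r (\<omega>, \<eta>)) \<partial>torus \<partial>torus)"
    by (rule torus2_integral_bounded[where B=1])
      (auto simp: norm_mult torus2_space norm_monomial measurable_space[OF measurable_torus_shift[OF r]])
  also have "\<dots> = (\<integral>\<omega>. monomial (\<lambda>j. - \<alpha> j) \<omega> * monomial \<beta> \<omega> \<partial>torus) * moebius_factor r \<beta>"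
    by (simp add: monomial_torus_shift moebius_factor_def mult.assoc[symmetric])
  also have "\<dots> = moebius_factor r \<alpha> * (\<integral>\<omega>. monomial (\<lambda>j. - \<alpha> j) \<omega> * monomial \<beta> \<omega> \<partial>torus)"
  proof (cases "?\<gamma> = (\<lambda>_. 0)")
    case True
    then have "\<beta> = \<alpha>" by (auto simp: fun_eq_iff)
    then show ?thesis by simp
  qed (simp add: eq)
  finally show ?thesis .
qed

lemma shift_indicator_integral:
  assumes r: "shift_radii r" and \<alpha>: "\<alpha> \<in> fin_int_seqs" and A: "A \<in> sets torus"
  shows "(\<integral>\<omega>. monomial (\<lambda>j. - \<alpha> j) \<omega> * of_real (shift_probability r A \<omega>) \<partial>torus) =
    moebius_factor r \<alpha> * (\<integral>\<omega>. monomial (\<lambda>j. - \<alpha> j) \<omega> * of_real (indicator A \<omega>) \<partial>torus)"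
proof -
  note m[measurable] = measurable_torus_shift[OF r]
  note ms = measurable_space[OF m]
  let ?m = "monomial (\<lambda>j. - \<alpha> j)"
  have int: "integrable torus_pair (\<lambda>z. ?m (fst z) * \<psi> (torus_shift r z))" "integrable torus (\<lambda>\<omega>. ?m \<omega> * \<psi> \<omega>)"
    if \<psi>: "bounded_measurable torus \<psi>" for \<psi>
  proof -
    obtain B where B: "\<forall>\<omega>\<in>space torus. norm (\<psi> \<omega>) \<le> B" and [measurable]: "\<psi> \<in> borel_measurable torus"
      using \<psi> by (auto simp: bounded_measurable_def)
    show "integrable torus (\<lambda>\<omega>. ?m \<omega> * \<psi> \<omega>)"
      using B by (intro torus.integrable_const_bound[where B=B]) (auto simp: norm_mult norm_monomial)
    show "integrable torus_pair (\<lambda>z. ?m (fst z) * \<psi> (torus_shift r z))"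
      using B by (intro torus2.P.integrable_const_bound[where B=B] AE_I2) (auto simp: norm_mult norm_monomial torus2_space ms)
  qed
  let ?Q = "\<lambda>\<psi>. (\<integral>z. ?m (fst z) * \<psi> (torus_shift r z) \<partial>torus_pair) = moebius_factor r \<alpha> * (\<integral>\<omega>. ?m \<omega> * \<psi> \<omega> \<partial>torus)"
  have "?Q (indicator A)"
    using A
  proof (rule torus_bounded_functional_class[where Q="?Q"])
    show "?Q (monomial \<beta>)" if "\<beta> \<in> fin_int_seqs" for \<beta>
      by (rule shift_monomial_integral[OF r \<alpha> that])
  next
    fix f g assume fg: "bounded_measurable torus f" "bounded_measurable torus g" "?Q f" "?Q g"
    then show "?Q (\<lambda>\<omega>. f \<omega> + g \<omega>)"
      using int[OF fg(1)] int[OF fg(2)] by (simp add: distrib_left)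
  next
    fix f c assume "?Q f"
    then show "?Q (\<lambda>\<omega>. c * f \<omega>)" by (simp add: mult.left_commute[of _ c])
  next
    fix f g B
    assume fm[measurable]: "\<And>n::nat. f n \<in> borel_measurable torus" and g[measurable]: "g \<in> borel_measurable torus"
      and B: "\<And>n \<omega>. \<omega> \<in> space torus \<Longrightarrow> norm (f n \<omega>) \<le> B"
      and lim: "\<And>\<omega>. \<omega> \<in> space torus \<Longrightarrow> (\<lambda>n. f n \<omega>) \<longlonglongrightarrow> g \<omega>"
      and f: "\<And>n. ?Q (f n)"
    have 1: "(\<lambda>n. \<integral>z. ?m (fst z) * f n (torus_shift r z) \<partial>torus_pair) \<longlonglongrightarrow> (\<integral>z. ?m (fst z) * g (torus_shift r z) \<partial>torus_pair)"
      by (rule integral_bounded_limit[where B=B])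
        (auto simp: norm_mult norm_monomial torus2_space ms B lim intro!: tendsto_mult_left torus2.P.finite_measure_axioms)
    have "(\<lambda>n. \<integral>\<omega>. ?m \<omega> * f n \<omega> \<partial>torus) \<longlonglongrightarrow> (\<integral>\<omega>. ?m \<omega> * g \<omega> \<partial>torus)"
      by (rule integral_bounded_limit[where B=B])
        (auto simp: norm_mult norm_monomial B lim intro!: tendsto_mult_left torus.finite_measure_axioms)
    from tendsto_mult_left[OF this, of "moebius_factor r \<alpha>"]
    have "(\<lambda>n. \<integral>z. ?m (fst z) * f n (torus_shift r z) \<partial>torus_pair) \<longlonglongrightarrow> moebius_factor r \<alpha> * (\<integral>\<omega>. ?m \<omega> * g \<omega> \<partial>torus)"
      by (simp add: f)
    from LIMSEQ_unique[OF 1 this] show "?Q g" .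
  qed
  then have "moebius_factor r \<alpha> * (\<integral>\<omega>. ?m \<omega> * indicator A \<omega> \<partial>torus) = (\<integral>z. ?m (fst z) * indicator A (torus_shift r z) \<partial>torus_pair)"
    by (rule sym)
  also have "\<dots> = (\<integral>\<omega>. \<integral>\<eta>. ?m (fst (\<omega>, \<eta>)) * indicator A (torus_shift r (\<omega>, \<eta>)) \<partial>torus \<partial>torus)"
    using A by (intro torus2_integral_bounded[where B=1])
      (auto simp: norm_mult torus2_space norm_monomial indicator_def)
  also have "\<dots> = (\<integral>\<omega>. ?m \<omega> * of_real (shift_probability r A \<omega>) \<partial>torus)"
  proof -
    have "(\<integral>\<eta>. indicator A (torus_shift r (\<omega>, \<eta>)) \<partial>torus) = complex_of_real (shift_probability r A \<omega>)" for \<omega>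
      unfolding shift_probability_def integral_complex_of_real[symmetric]
      by (intro Bochner_Integration.integral_cong) (auto simp: indicator_def)
    then show ?thesis by simp
  qed
  finally have *: "moebius_factor r \<alpha> * (\<integral>\<omega>. ?m \<omega> * indicator A \<omega> \<partial>torus) =
    (\<integral>\<omega>. ?m \<omega> * of_real (shift_probability r A \<omega>) \<partial>torus)" .
  have "complex_of_real (indicator A \<omega>) = indicator A \<omega>" for \<omega> by (simp add: indicator_def)
  then show ?thesis using * by (simp only:)
qed

lemma fourier_coeff_scaleR:
  fixes x :: "'a::complex_banach"
  assumes [measurable]: "u \<in> borel_measurable torus" and u: "\<And>\<omega>. \<bar>u \<omega>\<bar> \<le> 1"
  shows "fourier_coeff (\<lambda>\<omega>. u \<omega> *\<^sub>R x) \<alpha> = scaleC (\<integral>\<omega>. monomial (\<lambda>j. - \<alpha> j) \<omega> * of_real (u \<omega>) \<partial>torus) x"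
proof (rule fourier_coeff_eqI)
  have "integrable torus (\<lambda>\<omega>. monomial (\<lambda>j. - \<alpha> j) \<omega> * of_real (u \<omega>))"
    using u by (intro torus.integrable_const_bound[where B=1] AE_I2) (auto simp: norm_mult norm_monomial)
  from has_strong_integral_scaleC_left[OF this, of x]
  show "has_strong_integral torus (\<lambda>\<omega>. scaleC (monomial (\<lambda>j. - \<alpha> j) \<omega>) (u \<omega> *\<^sub>R x))
     (scaleC (\<integral>\<omega>. monomial (\<lambda>j. - \<alpha> j) \<omega> * of_real (u \<omega>) \<partial>torus) x)"
    by (simp add: scaleC_scaleC[symmetric] scaleC_of_real)
qed

lemma torus_average_fourier_coeff_unique:
  assumes r: "shift_radii r" and f: "strongly_measurable torus f" and "torus_average r f g" "torus_average r f g'"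
  shows "fourier_coeff g \<alpha> = fourier_coeff g' \<alpha>"
proof -
  have "ennreal (norm (fourier_coeff g \<alpha> - fourier_coeff g' \<alpha>)) \<le> L1_norm torus (\<lambda>\<omega>. g \<omega> - g' \<omega>)"
    using assms by (intro fourier_coeff_dist_le) (auto simp: torus_average_def)
  also have "\<dots> \<le> L1_norm torus (\<lambda>\<omega>. f \<omega> - f \<omega>)"
    by (rule torus_average_dist_le[OF r assms(3,4) f f])
  finally show ?thesis by simp
qed

text \<open>
  Coefficients and averages both depend continuously on the function in \<open>L\<^sub>1\<close>, and an average has the same coefficients as
  every other average of the same function. So it suffices to consider indicators, where the claim is scalar.
\<close>

lemma torus_average_fourier_coeff:
  assumes r: "shift_radii r" and \<alpha>: "\<alpha> \<in> fin_int_seqs" and f: "strongly_integrable torus f" and g: "torus_average r f g"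
  shows "fourier_coeff g \<alpha> = scaleC (moebius_factor r \<alpha>) (fourier_coeff f \<alpha>)"
proof -
  have "\<forall>g. torus_average r f g \<longrightarrow> fourier_coeff g \<alpha> = scaleC (moebius_factor r \<alpha>) (fourier_coeff f \<alpha>)"
    using f
  proof (induction rule: torus.strongly_integrable_induct)
    case (indicator A x)
    show ?case
    proof (intro allI impI)
      fix g assume g: "torus_average r (\<lambda>\<omega>. indicator A \<omega> *\<^sub>R x) g"
      then have sm: "strongly_measurable torus (\<lambda>\<omega>. indicat_real A \<omega> *\<^sub>R x)"
        using indicator by (intro strongly_measurable_simple simple_function_compose1[where f="indicator A" and g="\<lambda>c. c *\<^sub>R x"] simple_function_indicator)
      have "fourier_coeff g \<alpha> = fourier_coeff (\<lambda>\<omega>. shift_probability r A \<omega> *\<^sub>R x) \<alpha>"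
        by (rule torus_average_fourier_coeff_unique[OF r sm g torus_average_indicator[OF r indicator]])
      also have "\<dots> = scaleC (moebius_factor r \<alpha>) (fourier_coeff (\<lambda>\<omega>. indicator A \<omega> *\<^sub>R x) \<alpha>)"
        using shift_probability_bounds[of r A] indicator
        by (subst (1 2) fourier_coeff_scaleR)
          (auto simp: borel_measurable_shift_probability[OF r indicator] shift_indicator_integral[OF r \<alpha> indicator] scaleC_scaleC indicator_def)
      finally show "fourier_coeff g \<alpha> = scaleC (moebius_factor r \<alpha>) (fourier_coeff (\<lambda>\<omega>. indicator A \<omega> *\<^sub>R x) \<alpha>)" .
    qed
  next
    case (add f h)
    show ?case
    proof (intro allI impI)
      fix k assume k: "torus_average r (\<lambda>\<omega>. f \<omega> + h \<omega>) k"
      obtain kf where kf: "torus_average r f kf" using torus_average_exists[OF r add.hyps(1)] ..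
      obtain kh where kh: "torus_average r h kh" using torus_average_exists[OF r add.hyps(2)] ..
      have "fourier_coeff k \<alpha> = fourier_coeff (\<lambda>\<omega>. kf \<omega> + kh \<omega>) \<alpha>"
        by (rule torus_average_fourier_coeff_unique[OF r _ k torus_average_add[OF kf kh]])
          (intro strongly_measurable_add strongly_integrable_imp_measurable add.hyps)
      also have "\<dots> = fourier_coeff kf \<alpha> + fourier_coeff kh \<alpha>"
        using kf kh by (intro fourier_coeff_add) (auto simp: torus_average_def)
      also have "\<dots> = scaleC (moebius_factor r \<alpha>) (fourier_coeff (\<lambda>\<omega>. f \<omega> + h \<omega>) \<alpha>)"
        using add.IH kf kh by (simp add: fourier_coeff_add[OF add.hyps] scaleC_add_right)
      finally show "fourier_coeff k \<alpha> = scaleC (moebius_factor r \<alpha>) (fourier_coeff (\<lambda>\<omega>. f \<omega> + h \<omega>) \<alpha>)" .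
    qed
  next
    case (lim f s)
    show ?case
    proof (intro allI impI)
      fix g assume g: "torus_average r f g"
      have "\<forall>n. \<exists>h. torus_average r (s n) h" using torus_average_exists[OF r lim.hyps(2)] ..
      from choice[OF this] obtain h where "\<forall>n. torus_average r (s n) (h n)" ..
      then have h: "torus_average r (s n) (h n)" for n ..
      have p0: "(\<lambda>n. (1/2::real)^n) \<longlonglongrightarrow> 0" by (rule LIMSEQ_realpow_zero) auto
      have conv: "(\<lambda>n. u n) \<longlonglongrightarrow> v" if "\<And>n. ennreal (norm (v - u n)) \<le> ennreal ((1/2)^n)" for u :: "nat \<Rightarrow> 'a" and v
      proof -
        have "norm (u n - v) \<le> (1/2)^n" for n using that[of n] by (simp add: norm_minus_commute)
        then have "(\<lambda>n. u n - v) \<longlonglongrightarrow> 0" using p0 by (intro Lim_null_comparison[OF _ p0]) auto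
        then show ?thesis by (simp add: LIM_zero_iff)
      qed
      have g_lim: "(\<lambda>n. fourier_coeff (h n) \<alpha>) \<longlonglongrightarrow> fourier_coeff g \<alpha>"
      proof (rule conv)
        fix n
        have "ennreal (norm (fourier_coeff g \<alpha> - fourier_coeff (h n) \<alpha>)) \<le> L1_norm torus (\<lambda>\<omega>. g \<omega> - h n \<omega>)"
          using g h[of n] by (intro fourier_coeff_dist_le) (auto simp: torus_average_def)
        also have "\<dots> \<le> L1_norm torus (\<lambda>\<omega>. f \<omega> - s n \<omega>)"
          by (intro torus_average_dist_le[OF r g h] strongly_integrable_imp_measurable lim.hyps)
        finally show "ennreal (norm (fourier_coeff g \<alpha> - fourier_coeff (h n) \<alpha>)) \<le> ennreal ((1/2)^n)"
          using lim.hyps(3)[of n] by (rule order_trans)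
      qed
      have "(\<lambda>n. fourier_coeff (s n) \<alpha>) \<longlonglongrightarrow> fourier_coeff f \<alpha>"
        by (rule conv, rule order_trans[OF fourier_coeff_dist_le[OF lim.hyps(1,2)] lim.hyps(3)])
      then have "(\<lambda>n. scaleC (moebius_factor r \<alpha>) (fourier_coeff (s n) \<alpha>)) \<longlonglongrightarrow> scaleC (moebius_factor r \<alpha>) (fourier_coeff f \<alpha>)"
        by (intro scaleC.tendsto tendsto_const)
      moreover have "fourier_coeff (h n) \<alpha> = scaleC (moebius_factor r \<alpha>) (fourier_coeff (s n) \<alpha>)" for n
        using lim.IH h by blast
      ultimately have "(\<lambda>n. fourier_coeff (h n) \<alpha>) \<longlonglongrightarrow> scaleC (moebius_factor r \<alpha>) (fourier_coeff f \<alpha>)"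
        by simp
      with g_lim show "fourier_coeff g \<alpha> = scaleC (moebius_factor r \<alpha>) (fourier_coeff f \<alpha>)" by (rule LIMSEQ_unique)
    qed
  qed
  with g show ?thesis by blast
qed

section \<open>Convergence as the radii tend to 1\<close>

lemma AE_torus_neq_minus_one: "AE \<eta> in torus. \<forall>j. \<eta> j \<noteq> -1"
  unfolding AE_all_countable torus_def
  by (intro allI AE_PiM_component[where P="\<lambda>z. z \<noteq> -1"] prob_space_circle AE_circle_neq_minus_one) auto

lemma tendsto_moebius:
  assumes "z \<noteq> -1" "r \<longlonglongrightarrow> 1"
  shows "(\<lambda>n. moebius (r n) z) \<longlonglongrightarrow> 1"
proof -
  have nz: "1 + z \<noteq> 0" using assms(1) by (metis add.inverse_unique)
  have "(\<lambda>n. (z + of_real (r n)) / (1 + of_real (r n) * z)) \<longlonglongrightarrow> (z + of_real 1) / (1 + of_real 1 * z)"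
    using nz by (intro tendsto_intros assms(2)) auto
  then show ?thesis using nz by (simp add: moebius_def add.commute)
qed

lemma monomial_moebius_L1_tendsto:
  assumes r: "\<And>n. shift_radii (r n)" "\<And>j. (\<lambda>n. r n j) \<longlonglongrightarrow> 1"
  shows "(\<lambda>n. \<integral>\<eta>. norm (monomial \<alpha> (torus_moebius (r n) \<eta>) - 1) \<partial>torus) \<longlonglongrightarrow> 0"
proof -
  note [measurable] = measurable_torus_moebius_shift_radii[OF r(1)]
  have "(\<lambda>n. \<integral>\<eta>. norm (monomial \<alpha> (torus_moebius (r n) \<eta>) - 1) \<partial>torus) \<longlonglongrightarrow> (\<integral>\<eta>. 0 \<partial>torus)"
  proof (rule integral_dominated_convergence[where w="\<lambda>_. 2"])
    show "AE \<eta> in torus. (\<lambda>n. norm (monomial \<alpha> (torus_moebius (r n) \<eta>) - 1)) \<longlonglongrightarrow> 0"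
      using AE_torus_neq_minus_one
    proof eventually_elim
      case (elim \<eta>)
      have "(\<lambda>n. \<Prod>j | \<alpha> j \<noteq> 0. moebius (r n j) (\<eta> j) powi \<alpha> j) \<longlonglongrightarrow> (\<Prod>j | \<alpha> j \<noteq> 0. 1 powi \<alpha> j)"
        using elim by (intro tendsto_prod tendsto_power_int tendsto_moebius r) auto
      then have "(\<lambda>n. norm (monomial \<alpha> (torus_moebius (r n) \<eta>) - 1)) \<longlonglongrightarrow> norm (1 - 1 :: complex)"
        by (intro tendsto_intros) (simp add: monomial_def torus_moebius_def)
      then show ?case by simp
    qed
    show "AE \<eta> in torus. norm (norm (monomial \<alpha> (torus_moebius (r n) \<eta>) - 1)) \<le> 2" for n
    proof (rule AE_I2)
      fix \<eta> assume "\<eta> \<in> space torus"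
      then have "norm (monomial \<alpha> (torus_moebius (r n) \<eta>)) = 1"
        by (intro norm_monomial measurable_space[OF measurable_torus_moebius_shift_radii[OF r(1)]])
      then show "norm (norm (monomial \<alpha> (torus_moebius (r n) \<eta>) - 1)) \<le> 2"
        using norm_triangle_ineq4[of "monomial \<alpha> (torus_moebius (r n) \<eta>)" 1] by simp
    qed
  qed auto
  then show ?thesis by simp
qed

text \<open>
  For a monomial, \<open>\<omega>\<close> enters the difference only through a factor of modulus 1, and the other factor tends to 0 for
  almost every \<open>\<eta>\<close>. In a bounded limit, replacing a function by an approximant costs twice its
  \<open>L\<^sub>1\<close> distance, uniformly in the radii, because both the shift and the first projection preserve the measure.
\<close>

lemma shift_indicator_L1_tendsto:
  assumes r: "\<And>n. shift_radii (r n)" "\<And>j. (\<lambda>n. r n j) \<longlonglongrightarrow> 1" and A: "A \<in> sets torus"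
  shows "(\<lambda>n. \<integral>z. norm (indicator A (torus_shift (r n) z) - indicator A (fst z) :: complex) \<partial>torus_pair) \<longlonglongrightarrow> 0"
proof -
  note m[measurable] = measurable_torus_shift[OF r(1)]
  note ms = measurable_space[OF m]
  let ?T = "torus_pair"
  define I where "I n \<psi> = (\<integral>z. norm (\<psi> (torus_shift (r n) z) - \<psi> (fst z)) \<partial>?T)" for n and \<psi> :: "_ \<Rightarrow> complex"
  have I_int: "integrable ?T (\<lambda>z. norm (\<psi> (torus_shift (r n) z) - \<psi> (fst z)))"
    "integrable ?T (\<lambda>z. norm (\<psi> (torus_shift (r n) z)))" "integrable ?T (\<lambda>z. norm (\<psi> (fst z)))"
    if "\<psi> \<in> borel_measurable torus" "\<forall>\<omega>\<in>space torus. norm (\<psi> \<omega>) \<le> B" for \<psi> :: "_ \<Rightarrow> complex" and n B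
  proof -
    note [measurable] = that(1)
    show 1: "integrable ?T (\<lambda>z. norm (\<psi> (torus_shift (r n) z)))" "integrable ?T (\<lambda>z. norm (\<psi> (fst z)))"
      using that(2) by (intro torus2.P.integrable_const_bound[where B=B] AE_I2; force simp: torus2_space ms)+
    show "integrable ?T (\<lambda>z. norm (\<psi> (torus_shift (r n) z) - \<psi> (fst z)))"
      by (rule Bochner_Integration.integrable_bound[OF Bochner_Integration.integrable_add[OF 1]]) (auto simp: norm_triangle_ineq4)
  qed
  have I_nonneg: "0 \<le> I n \<psi>" for n \<psi> unfolding I_def by (rule Bochner_Integration.integral_nonneg) simp
  have "(\<lambda>n. I n (indicator A)) \<longlonglongrightarrow> 0"
    using A
  proof (rule torus_bounded_functional_class[where Q="\<lambda>\<psi>. (\<lambda>n. I n \<psi>) \<longlonglongrightarrow> 0"])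
    fix \<alpha> assume "\<alpha> \<in> fin_int_seqs"
    have "I n (monomial \<alpha>) = (\<integral>\<eta>. norm (monomial \<alpha> (torus_moebius (r n) \<eta>) - 1) \<partial>torus)" for n
    proof -
      have "I n (monomial \<alpha>) = (\<integral>\<omega>. \<integral>\<eta>. norm (monomial \<alpha> (torus_shift (r n) (\<omega>, \<eta>)) - monomial \<alpha> \<omega>) \<partial>torus \<partial>torus)"
        unfolding I_def using I_int(1)[of "monomial \<alpha>" 1 n]
        by (subst torus2.integral_fst'[symmetric]) (auto simp: norm_monomial)
      also have "\<dots> = (\<integral>\<omega>. \<integral>\<eta>. norm (monomial \<alpha> (torus_moebius (r n) \<eta>) - 1) \<partial>torus \<partial>torus)"
      proof (intro Bochner_Integration.integral_cong refl)
        fix \<omega> \<eta> assume w: "\<omega> \<in> space torus"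
        have "norm (monomial \<alpha> (torus_shift (r n) (\<omega>, \<eta>)) - monomial \<alpha> \<omega>) = norm (monomial \<alpha> \<omega> * (monomial \<alpha> (torus_moebius (r n) \<eta>) - 1))"
          by (simp add: monomial_torus_shift algebra_simps)
        then show "norm (monomial \<alpha> (torus_shift (r n) (\<omega>, \<eta>)) - monomial \<alpha> \<omega>) = norm (monomial \<alpha> (torus_moebius (r n) \<eta>) - 1)"
          by (simp add: norm_mult norm_monomial[OF w])
      qed
      finally show ?thesis by (simp add: torus.prob_space)
    qed
    then show "(\<lambda>n. I n (monomial \<alpha>)) \<longlonglongrightarrow> 0"
      using monomial_moebius_L1_tendsto[OF r, of \<alpha>] by simp
  next
    fix f g assume fg: "bounded_measurable torus f" "bounded_measurable torus g"
      and conv: "(\<lambda>n. I n f) \<longlonglongrightarrow> 0" "(\<lambda>n. I n g) \<longlonglongrightarrow> 0"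
    obtain B B' B2 where B: "\<forall>\<omega>\<in>space torus. norm (f \<omega>) \<le> B" "\<forall>\<omega>\<in>space torus. norm (g \<omega>) \<le> B'"
      and B2: "\<forall>\<omega>\<in>space torus. norm (f \<omega> + g \<omega>) \<le> B2"
      using fg bounded_measurable_add[OF fg] unfolding bounded_measurable_def by blast
    have [measurable]: "f \<in> borel_measurable torus" "g \<in> borel_measurable torus"
      using fg by (auto simp: bounded_measurable_def)
    have "I n (\<lambda>\<omega>. f \<omega> + g \<omega>) \<le> I n f + I n g" for n
    proof -
      have "I n (\<lambda>\<omega>. f \<omega> + g \<omega>) \<le> (\<integral>z. norm (f (torus_shift (r n) z) - f (fst z)) + norm (g (torus_shift (r n) z) - g (fst z)) \<partial>?T)"
        unfolding I_def using I_int(1)[OF _ B2] I_int(1)[OF _ B(1)] I_int(1)[OF _ B(2)]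
        by (intro integral_mono Bochner_Integration.integrable_add) (auto simp: add_diff_add norm_triangle_ineq)
      then show ?thesis unfolding I_def
        using I_int(1)[OF _ B(1)] I_int(1)[OF _ B(2)] by (subst (asm) Bochner_Integration.integral_add) auto
    qed
    moreover have "(\<lambda>n. I n f + I n g) \<longlonglongrightarrow> 0" using tendsto_add[OF conv] by simp
    ultimately show "(\<lambda>n. I n (\<lambda>\<omega>. f \<omega> + g \<omega>)) \<longlonglongrightarrow> 0"
      by (intro tendsto_sandwich[OF _ _ tendsto_const, of _ "\<lambda>n. I n (\<lambda>\<omega>. f \<omega> + g \<omega>)" _ "\<lambda>n. I n f + I n g"]
        always_eventually allI I_nonneg)
  next
    fix f c assume conv: "(\<lambda>n. I n f) \<longlonglongrightarrow> 0"
    have "I n (\<lambda>\<omega>. c * f \<omega>) = norm c * I n f" for n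
      unfolding I_def right_diff_distrib[symmetric] norm_mult by simp
    then show "(\<lambda>n. I n (\<lambda>\<omega>. c * f \<omega>)) \<longlonglongrightarrow> 0"
      using tendsto_mult_right_zero[OF conv] by simp
  next
    fix f g B
    assume fm[measurable]: "\<And>n::nat. f n \<in> borel_measurable torus" and g[measurable]: "g \<in> borel_measurable torus"
      and B: "\<And>n \<omega>. \<omega> \<in> space torus \<Longrightarrow> norm (f n \<omega>) \<le> B"
      and Bg: "\<And>\<omega>. \<omega> \<in> space torus \<Longrightarrow> norm (g \<omega>) \<le> B"
      and lim: "\<And>\<omega>. \<omega> \<in> space torus \<Longrightarrow> (\<lambda>n. f n \<omega>) \<longlonglongrightarrow> g \<omega>"
      and f: "\<And>k. (\<lambda>n. I n (f k)) \<longlonglongrightarrow> 0"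
    define d where "d k = (\<integral>\<omega>. norm (g \<omega> - f k \<omega>) \<partial>torus)" for k
    have diff_bound: "\<forall>\<omega>\<in>space torus. norm (g \<omega> - f k \<omega>) \<le> 2 * B" for k
    proof
      fix \<omega> assume w: "\<omega> \<in> space torus"
      show "norm (g \<omega> - f k \<omega>) \<le> 2 * B"
        using norm_triangle_ineq4[of "g \<omega>" "f k \<omega>"] Bg[OF w] B[OF w, of k] by linarith
    qed
    have d0: "d \<longlonglongrightarrow> 0"
    proof -
      have "(\<lambda>k. \<integral>\<omega>. norm (g \<omega> - f k \<omega>) \<partial>torus) \<longlonglongrightarrow> (\<integral>\<omega>. 0 \<partial>torus)"
      proof (rule integral_dominated_convergence[where w="\<lambda>_. 2 * B"])
        show "AE \<omega> in torus. (\<lambda>k. norm (g \<omega> - f k \<omega>)) \<longlonglongrightarrow> 0"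
          by (intro AE_I2 tendsto_norm_zero) (auto intro!: tendsto_eq_intros lim)
        show "AE \<omega> in torus. norm (norm (g \<omega> - f k \<omega>)) \<le> 2 * B" for k
          using diff_bound by (intro AE_I2) auto
      qed auto
      then show ?thesis by (simp add: d_def[abs_def])
    qed
    have d_shift: "(\<integral>z. norm (g (torus_shift (r n) z) - f k (torus_shift (r n) z)) \<partial>?T) = d k" for n k
      using integral_distr[OF m[of n], of "\<lambda>\<omega>. norm (g \<omega> - f k \<omega>)"] by (simp add: distr_torus_shift[OF r(1)] d_def)
    have d_fst: "(\<integral>z. norm (g (fst z) - f k (fst z)) \<partial>?T) = d k" for k
      using I_int(3)[of "\<lambda>\<omega>. g \<omega> - f k \<omega>", OF _ diff_bound]
      by (subst torus2.integral_fst'[symmetric]) (auto simp: d_def torus.prob_space)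
    have le: "I n g \<le> 2 * d k + I n (f k)" for n k
    proof -
      let ?a = "\<lambda>z. norm (g (torus_shift (r n) z) - f k (torus_shift (r n) z))" and ?b = "\<lambda>z. norm (g (fst z) - f k (fst z))"
        and ?c = "\<lambda>z. norm (f k (torus_shift (r n) z) - f k (fst z))"
      have i1: "integrable ?T (\<lambda>z. ?a z)"
        "integrable ?T (\<lambda>z. ?b z)"
        using I_int(2,3)[of "\<lambda>\<omega>. g \<omega> - f k \<omega>", OF _ diff_bound] by auto
      have i2: "integrable ?T (\<lambda>z. ?c z)"
        using B by (intro I_int(1)[where B=B]) auto
      have i3: "integrable ?T (\<lambda>z. norm (g (torus_shift (r n) z) - g (fst z)))"
        using Bg by (intro I_int(1)[where B=B]) auto
      have "I n g \<le> (\<integral>z. ?a z + ?b z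
          + ?c z \<partial>?T)"
        unfolding I_def
      proof (intro integral_mono Bochner_Integration.integrable_add i1 i2 i3)
        fix z
        have "g (torus_shift (r n) z) - g (fst z) = (g (torus_shift (r n) z) - f k (torus_shift (r n) z)) - (g (fst z) - f k (fst z))
          + (f k (torus_shift (r n) z) - f k (fst z))" by simp
        also have "norm \<dots> \<le> ?a z + ?b z
          + ?c z"
          by (rule order_trans[OF norm_triangle_ineq add_right_mono[OF norm_triangle_ineq4]])
        finally show "norm (g (torus_shift (r n) z) - g (fst z)) \<le> ?a z + ?b z
          + ?c z" .
      qed
      also have "\<dots> = 2 * d k + I n (f k)"
        unfolding Bochner_Integration.integral_add[OF Bochner_Integration.integrable_add[OF i1] i2] Bochner_Integration.integral_add[OF i1]
        by (simp add: d_shift d_fst I_def)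
      finally show ?thesis .
    qed
    show "(\<lambda>n. I n g) \<longlonglongrightarrow> 0"
    proof (rule LIMSEQ_I)
      fix e :: real assume e: "0 < e"
      obtain k where k: "d k < e / 4"
        using order_tendstoD(2)[OF d0, of "e/4"] e by (auto simp: eventually_sequentially)
      obtain N where N: "\<And>n. n \<ge> N \<Longrightarrow> I n (f k) < e / 2"
        using order_tendstoD(2)[OF f, of "e/2" k] e by (auto simp: eventually_sequentially)
      show "\<exists>N. \<forall>n\<ge>N. norm (I n g - 0) < e"
      proof (intro exI[of _ N] allI impI)
        fix n assume "n \<ge> N"
        with N[of n] k le[of n k] I_nonneg[of n g] show "norm (I n g - 0) < e" by simp
      qed
    qed
  qed
  then show ?thesis by (simp add: I_def)
qed

text \<open>
  The extension from indicators to vector-valued functions costs twice an \<open>L\<^sub>1\<close> distance for the same reason as before.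
\<close>

lemma shift_L1_tendsto:
  fixes f :: "(nat \<Rightarrow> complex) \<Rightarrow> 'a::complex_banach"
  assumes r: "\<And>n. shift_radii (r n)" "\<And>j. (\<lambda>n. r n j) \<longlonglongrightarrow> 1" and f: "strongly_integrable torus f"
  shows "(\<lambda>n. L1_norm torus_pair (\<lambda>z. f (torus_shift (r n) z) - f (fst z))) \<longlonglongrightarrow> 0"
  using f
proof (induction rule: torus.strongly_integrable_induct)
  case (indicator A x)
  note [measurable] = measurable_torus_shift[OF r(1)] indicator
  let ?d = "\<lambda>n z. norm (indicator A (torus_shift (r n) z) - indicator A (fst z) :: complex)"
  have "L1_norm torus_pair (\<lambda>z. indicat_real A (torus_shift (r n) z) *\<^sub>R x - indicat_real A (fst z) *\<^sub>R x)
    = ennreal ((\<integral>z. ?d n z \<partial>torus_pair) * norm x)" for n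
  proof -
    have i: "integrable torus_pair (\<lambda>z. ?d n z * norm x)"
      by (intro integrable_mult_left torus2.P.integrable_const_bound[where B=1]) (auto simp: indicator_def)
    have "L1_norm torus_pair (\<lambda>z. indicat_real A (torus_shift (r n) z) *\<^sub>R x - indicat_real A (fst z) *\<^sub>R x)
      = (\<integral>\<^sup>+z. ennreal (?d n z * norm x) \<partial>torus_pair)"
      by (intro nn_integral_cong) (auto simp: indicator_def)
    also have "\<dots> = ennreal (\<integral>z. ?d n z * norm x \<partial>torus_pair)"
      by (rule nn_integral_eq_integral[OF i]) auto
    finally show ?thesis by simp
  qed
  moreover have "(\<lambda>n. ennreal ((\<integral>z. ?d n z \<partial>torus_pair) * norm x)) \<longlonglongrightarrow> ennreal (0 * norm x)"
    by (intro tendsto_ennrealI tendsto_mult shift_indicator_L1_tendsto r indicator tendsto_const)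
  ultimately show ?case by simp
next
  case (add f h)
  note fm = add.hyps[THEN strongly_integrable_imp_measurable]
  let ?D = "\<lambda>f n. L1_norm torus_pair (\<lambda>z. f (torus_shift (r n) z) - f (fst z))"
  have le: "?D (\<lambda>\<omega>. f \<omega> + h \<omega>) n \<le> ?D f n + ?D h n" for n
  proof -
    have sm: "strongly_measurable torus_pair (\<lambda>z. k (torus_shift (r n) z) - k (fst z))"
      if "strongly_measurable torus k" for k :: "_ \<Rightarrow> 'a"
      by (intro strongly_measurable_diff strongly_measurable_comp[OF that] measurable_torus_shift r measurable_fst)
    show ?thesis
      using nn_integral_norm_add_le[OF sm[OF fm(1)] sm[OF fm(2)]] by (simp add: add_diff_add)
  qed
  have conv: "(\<lambda>n. ?D f n + ?D h n) \<longlonglongrightarrow> 0" using tendsto_add[OF add.IH] by simp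
  show ?case
    by (rule tendsto_sandwich[OF _ _ tendsto_const conv])
      (rule always_eventually, rule allI, rule zero_le, rule always_eventually, rule allI, rule le)
next
  case (lim f s)
  note fm = strongly_integrable_imp_measurable[OF lim.hyps(1)]
  note sm = strongly_integrable_imp_measurable[OF lim.hyps(2)]
  let ?D = "\<lambda>f n. L1_norm torus_pair (\<lambda>z. f (torus_shift (r n) z) - f (fst z))"
  have le: "?D f n \<le> ennreal (2 * (1/2)^k) + ?D (s k) n" for n k
  proof -
    let ?a = "\<lambda>z. f (torus_shift (r n) z) - s k (torus_shift (r n) z)" and ?b = "\<lambda>z. f (fst z) - s k (fst z)" and ?c = "\<lambda>z. s k (torus_shift (r n) z) - s k (fst z)"
    note [measurable] = strongly_measurable_diff[OF fm sm[of k]]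
    have 1: "strongly_measurable torus_pair (\<lambda>z. ?a z)"
      "strongly_measurable torus_pair (\<lambda>z. ?b z)"
      "strongly_measurable torus_pair (\<lambda>z. ?c z)"
      by (intro strongly_measurable_diff strongly_measurable_comp[OF fm] strongly_measurable_comp[OF sm] measurable_torus_shift r measurable_fst)+
    have "?D f n = L1_norm torus_pair (\<lambda>z. (?a z - ?b z)
      + ?c z)" by simp
    also have "\<dots> \<le> L1_norm torus_pair (\<lambda>z. ?a z - ?b z) + ?D (s k) n"
      by (rule nn_integral_norm_add_le[OF strongly_measurable_diff[OF 1(1,2)] 1(3)])
    also have "\<dots> \<le> (L1_norm torus_pair (\<lambda>z. ?a z)
      + L1_norm torus_pair (\<lambda>z. ?b z)) + ?D (s k) n"
      by (rule add_right_mono[OF nn_integral_norm_diff_le[OF 1(1,2)]])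
    also have "L1_norm torus_pair (\<lambda>z. ?a z) = L1_norm torus (\<lambda>\<omega>. f \<omega> - s k \<omega>)"
      by (rule nn_integral_torus_shift[OF r(1), of "\<lambda>\<omega>. ennreal (norm (f \<omega> - s k \<omega>))"]) measurable
    also have "L1_norm torus_pair (\<lambda>z. ?b z) = L1_norm torus (\<lambda>\<omega>. f \<omega> - s k \<omega>)"
    proof -
      note [measurable] = 1(2)
      show ?thesis by (subst torus.nn_integral_fst[symmetric]) (auto simp: torus.emeasure_space_1)
    qed
    also have "L1_norm torus (\<lambda>\<omega>. f \<omega> - s k \<omega>) + L1_norm torus (\<lambda>\<omega>. f \<omega> - s k \<omega>) \<le> ennreal ((1/2)^k) + ennreal ((1/2)^k)"
      by (intro add_mono lim.hyps)
    also have "\<dots> = ennreal (2 * (1/2)^k)" by (simp flip: ennreal_plus)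
    finally show ?thesis by (simp add: add_right_mono)
  qed
  show ?case
  proof (rule order_tendstoI)
    fix e :: ennreal assume "0 < e"
    then obtain z where z: "0 < z" "z < e" using dense by blast
    then have "z \<noteq> \<infinity>" by (auto simp: top_unique)
    with z obtain e' :: real where e': "0 < e'" "ennreal e' < e"
      by (cases z) auto
    have p0: "(\<lambda>k. 2 * (1/2::real)^k) \<longlonglongrightarrow> 2 * 0" by (intro tendsto_mult tendsto_const LIMSEQ_realpow_zero) auto
    obtain k where k: "2 * (1/2::real)^k < e' / 2"
      using order_tendstoD(2)[OF p0, of "e'/2"] e' by (auto simp: eventually_sequentially)
    have "\<forall>\<^sub>F n in sequentially. ?D (s k) n < ennreal (e' / 2)"
      using lim.IH[of k] e' by (intro order_tendstoD(2)[of _ 0]) auto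
    then show "\<forall>\<^sub>F n in sequentially. ?D f n < e"
    proof eventually_elim
      case (elim n)
      have "?D f n \<le> ennreal (2 * (1/2)^k) + ?D (s k) n" by (rule le)
      also have "\<dots> \<le> ennreal (e' / 2) + ennreal (e' / 2)"
        using k elim by (intro add_mono ennreal_leI) auto
      also have "\<dots> = ennreal e'" using e' by (simp flip: ennreal_plus)
      finally show ?case using e'(2) by (rule order.strict_trans1)
    qed
  qed auto
qed

lemma has_strong_integral_const:
  "has_strong_integral torus (\<lambda>_. x) x"
proof -
  have "has_strong_integral torus (\<lambda>_. 1::real) 1"
    unfolding has_strong_integral_iff_has_bochner_integral
    using has_bochner_integral_integrable[of torus "\<lambda>_. 1::real"] by (simp add: torus.prob_space)
  from has_strong_integral_bounded_linear[OF bounded_linear_scaleR_left this, of x]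
  show ?thesis by simp
qed

lemma torus_average_L1_tendsto:
  fixes f :: "(nat \<Rightarrow> complex) \<Rightarrow> 'a::complex_banach"
  assumes r: "\<And>n. shift_radii (r n)" "\<And>j. (\<lambda>n. r n j) \<longlonglongrightarrow> 1" and f: "strongly_integrable torus f"
    and g: "\<And>n. torus_average (r n) f (g n)"
  shows "(\<lambda>n. L1_norm torus (\<lambda>\<omega>. g n \<omega> - f \<omega>)) \<longlonglongrightarrow> 0"
proof (rule tendsto_sandwich[OF _ _ tendsto_const shift_L1_tendsto[OF r f]])
  note fm = strongly_integrable_imp_measurable[OF f]
  have "L1_norm torus (\<lambda>\<omega>. g n \<omega> - f \<omega>) \<le> L1_norm torus_pair (\<lambda>z. f (torus_shift (r n) z) - f (fst z))" for n
  proof -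
    have "strongly_measurable torus_pair (\<lambda>z. f (torus_shift (r n) z) - f (fst z))"
      by (intro strongly_measurable_diff strongly_measurable_comp[OF fm] measurable_torus_shift r measurable_fst)
    note [measurable] = this
    have "AE \<omega> in torus. has_strong_integral torus (\<lambda>\<eta>. f (torus_shift (r n) (\<omega>, \<eta>))) (g n \<omega>)"
      using g by (simp add: torus_average_def)
    then have "AE \<omega> in torus. ennreal (norm (g n \<omega> - f \<omega>)) \<le> L1_norm torus (\<lambda>\<eta>. f (torus_shift (r n) (\<omega>, \<eta>)) - f \<omega>)"
      by eventually_elim (rule has_strong_integral_dist_le[OF _ has_strong_integral_const])
    then have "L1_norm torus (\<lambda>\<omega>. g n \<omega> - f \<omega>) \<le> (\<integral>\<^sup>+\<omega>. L1_norm torus (\<lambda>\<eta>. f (torus_shift (r n) (\<omega>, \<eta>)) - f \<omega>) \<partial>torus)"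
      by (rule nn_integral_mono_AE)
    also have "\<dots> = L1_norm torus_pair (\<lambda>z. f (torus_shift (r n) z) - f (fst z))"
      by (subst torus.nn_integral_fst[symmetric]) auto
    finally show ?thesis .
  qed
  then show "\<forall>\<^sub>F n in sequentially. L1_norm torus (\<lambda>\<omega>. g n \<omega> - f \<omega>) \<le> L1_norm torus_pair (\<lambda>z. f (torus_shift (r n) z) - f (fst z))"
    by (intro always_eventually allI)
qed auto

section \<open>Norms of averages and of limits\<close>

lemma Lp_norm_le_iff_infinity:
  assumes "strongly_measurable M f"
  shows "Lp_norm \<infinity> M f \<le> c \<longleftrightarrow> (AE x in M. ennreal (norm (f x)) \<le> c)"
proof -
  have [measurable]: "(\<lambda>x. ennreal (norm (f x))) \<in> borel_measurable M"
    using strongly_measurable_imp_borel[OF assms] by measurable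
  show ?thesis
  proof
    assume "Lp_norm \<infinity> M f \<le> c"
    with esssup_AE[of "\<lambda>x. ennreal (norm (f x))" M] show "AE x in M. ennreal (norm (f x)) \<le> c"
      by (auto simp: Lp_norm_def elim!: eventually_mono)
  next
    assume "AE x in M. ennreal (norm (f x)) \<le> c"
    then have "esssup M (\<lambda>x. ennreal (norm (f x))) \<le> c" by (intro esssup_I) measurable
    then show "Lp_norm \<infinity> M f \<le> c" by (simp add: Lp_norm_def)
  qed
qed

lemma Lp_norm_le_iff_finite:
  assumes p: "1 \<le> p" "p \<noteq> \<infinity>" and c: "0 \<le> c"
  shows "Lp_norm p M f \<le> ennreal c \<longleftrightarrow> (\<integral>\<^sup>+x. ennreal (norm (f x) powr enn2real p) \<partial>M) \<le> ennreal (c powr enn2real p)"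
proof -
  define q where "q = enn2real p"
  have q: "1 \<le> q" using p by (cases p) (auto simp: q_def)
  define I where "I = (\<integral>\<^sup>+x. ennreal (norm (f x) powr q) \<partial>M)"
  have L: "Lp_norm p M f = (if I = \<infinity> then \<infinity> else ennreal (enn2real I powr (1 / q)))"
    using p by (simp add: Lp_norm_def I_def q_def Let_def)
  show ?thesis
  proof (cases "I = \<infinity>")
    case True
    then show ?thesis using L by (simp add: I_def q_def top_unique)
  next
    case False
    then obtain i where i: "I = ennreal i" "0 \<le> i" by (cases I) auto
    have "i powr (1 / q) \<le> c \<longleftrightarrow> i \<le> c powr q"
    proof
      assume "i powr (1 / q) \<le> c"
      then have "(i powr (1 / q)) powr q \<le> c powr q" using q by (intro powr_mono2) auto
      then show "i \<le> c powr q" using q i by (simp add: powr_powr)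
    next
      assume "i \<le> c powr q"
      then have "i powr (1 / q) \<le> (c powr q) powr (1 / q)" using q i by (intro powr_mono2) auto
      then show "i powr (1 / q) \<le> c" using q c by (simp add: powr_powr)
    qed
    then show ?thesis using L i c by (simp add: I_def[symmetric] q_def[symmetric])
  qed
qed

lemma Lp_norm_AE_cong:
  assumes "strongly_measurable M f" "strongly_measurable M g" and ae: "AE x in M. f x = g x"
  shows "Lp_norm p M f = Lp_norm p M g"
proof -
  note [measurable] = assms(1,2)
  have "(\<integral>\<^sup>+x. ennreal (norm (f x) powr enn2real p) \<partial>M) = (\<integral>\<^sup>+x. ennreal (norm (g x) powr enn2real p) \<partial>M)"
    by (rule nn_integral_cong_AE) (use ae in eventually_elim, simp)
  moreover have "esssup M (\<lambda>x. ennreal (norm (f x))) = esssup M (\<lambda>x. ennreal (norm (g x)))"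
    by (rule esssup_AE_cong) (auto intro: eventually_mono[OF ae])
  ultimately show ?thesis by (simp add: Lp_norm_def)
qed

lemma Lp_space_imp_strongly_integrable:
  assumes p: "1 \<le> p" and M: "finite_measure M" and f: "f \<in> Lp_space p M"
  shows "strongly_integrable M f"
proof -
  interpret finite_measure M by fact
  from f have fm[measurable]: "strongly_measurable M f" and fin: "Lp_norm p M f < \<infinity>" by (auto simp: Lp_space_def)
  then obtain c where c: "Lp_norm p M f = ennreal c" "0 \<le> c" by (cases "Lp_norm p M f") auto
  have "L1_norm M f < \<infinity>"
  proof (cases "p = \<infinity>")
    case True
    with c Lp_norm_le_iff_infinity[OF fm, of "ennreal c"] have "AE x in M. ennreal (norm (f x)) \<le> ennreal c" by simp
    then have "L1_norm M f \<le> (\<integral>\<^sup>+x. ennreal c \<partial>M)" by (rule nn_integral_mono_AE)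
    also have "\<dots> < \<infinity>" by (simp add: emeasure_eq_measure ennreal_mult_less_top)
    finally show ?thesis .
  next
    case False
    define q where "q = enn2real p"
    have q: "1 \<le> q" using p False by (cases p) (auto simp: q_def)
    have le: "(\<integral>\<^sup>+x. ennreal (norm (f x) powr q) \<partial>M) \<le> ennreal (c powr q)"
      using Lp_norm_le_iff_finite[OF p False c(2), of M f] c by (simp add: q_def)
    have "L1_norm M f \<le> (\<integral>\<^sup>+x. 1 + ennreal (norm (f x) powr q) \<partial>M)"
    proof (intro nn_integral_mono)
      fix x
      have "norm (f x) \<le> 1 + norm (f x) powr q"
      proof (cases "norm (f x) \<le> 1")
        case False
        then have "norm (f x) powr 1 \<le> norm (f x) powr q" using q by (intro powr_mono) auto
        then show ?thesis using False by simp
      qed (simp add: add_increasing2)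
      then show "ennreal (norm (f x)) \<le> 1 + ennreal (norm (f x) powr q)"
        by (simp flip: ennreal_plus ennreal_1)
    qed
    also have "\<dots> = emeasure M (space M) + (\<integral>\<^sup>+x. ennreal (norm (f x) powr q) \<partial>M)"
      by (subst nn_integral_add) auto
    also have "\<dots> < \<infinity>" using le by (auto simp: emeasure_eq_measure intro: le_less_trans)
    finally show ?thesis .
  qed
  with fm show ?thesis by (simp add: strongly_integrable_def)
qed

text \<open>
  The tangent of \<open>t powr q\<close> at \<open>a\<close>, with the negative term moved to the other side, so that it can be integrated among
  extended nonnegative reals. The point \<open>t = 0\<close>, outside the open half-line of the convexity argument, is treated apart.
\<close>

lemma powr_above_tangent:
  fixes a t q :: real
  assumes "1 \<le> q" "0 < a" "0 \<le> t"
  shows "q * a powr (q - 1) * t \<le> t powr q + (q - 1) * a powr q"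
proof -
  have aq: "a powr q = a powr (q - 1) * a" using assms by (simp add: powr_diff)
  show ?thesis
  proof (cases "t = 0")
    case True
    then show ?thesis using assms by simp
  next
    case False
    have "q * a powr (q - 1) * (t - a) \<le> t powr q - a powr q"
    proof (rule convex_on_imp_above_tangent[OF powr_convex[OF assms(1)]])
      show "((\<lambda>x. x powr q) has_real_derivative q * a powr (q - 1)) (at a within {0<..})"
        using assms by (auto intro!: derivative_eq_intros)
    qed (use assms False in \<open>auto simp: interior_open\<close>)
    then show ?thesis by (simp add: algebra_simps aq)
  qed
qed

text \<open>
  Jensen's inequality in the extended nonnegative reals, obtained by integrating the tangent inequality at \<open>a\<close>. The lower
  bound \<open>a\<close> stands in for the mean of \<open>v\<close>, which may be infinite.
\<close>

lemma (in prob_space) powr_le_nn_integral_powr: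
  fixes v :: "'a \<Rightarrow> real"
  assumes [measurable]: "v \<in> borel_measurable M" and v: "\<And>x. 0 \<le> v x" and q: "1 \<le> q" and a: "0 \<le> a"
    and le: "ennreal a \<le> (\<integral>\<^sup>+x. ennreal (v x) \<partial>M)"
  shows "ennreal (a powr q) \<le> (\<integral>\<^sup>+x. ennreal (v x powr q) \<partial>M)"
proof (cases "a = 0")
  case True
  then show ?thesis by simp
next
  case False
  with a have a0: "0 < a" by simp
  let ?J = "\<integral>\<^sup>+x. ennreal (v x powr q) \<partial>M"
  have "a powr q + (q - 1) * a powr q = (q * a powr (q - 1)) * a"
    using a0 by (simp add: powr_diff algebra_simps)
  then have "ennreal (a powr q) + ennreal ((q - 1) * a powr q) = ennreal (q * a powr (q - 1)) * ennreal a"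
    using q a0 by (subst ennreal_mult[symmetric]) (auto simp flip: ennreal_plus)
  also have "\<dots> \<le> ennreal (q * a powr (q - 1)) * (\<integral>\<^sup>+x. ennreal (v x) \<partial>M)"
    by (intro mult_left_mono le) auto
  also have "\<dots> = (\<integral>\<^sup>+x. ennreal (q * a powr (q - 1)) * ennreal (v x) \<partial>M)"
    by (rule nn_integral_cmult[symmetric]) auto
  also have "\<dots> \<le> (\<integral>\<^sup>+x. ennreal (v x powr q) + ennreal ((q - 1) * a powr q) \<partial>M)"
    using q a0 v powr_above_tangent[OF q a0]
    by (intro nn_integral_mono) (auto simp: ennreal_mult[symmetric] simp flip: ennreal_plus)
  also have "\<dots> = ?J + ennreal ((q - 1) * a powr q)"
    by (subst nn_integral_add) (auto simp: emeasure_space_1)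
  finally show ?thesis by (simp add: ennreal_add_left_cancel_le add.commute)
qed

text \<open>
  At almost every point the norm of the average is at most the average of the norm. For finite \<open>p\<close>, Jensen's inequality
  and invariance of the measure finish the proof. For \<open>p = \<infinity>\<close>, invariance shows that the excess of the norm over
  its essential bound \<open>c\<close> still vanishes almost everywhere after the shift.
\<close>

lemma Lp_norm_torus_average_le:
  assumes r: "shift_radii r" and p: "1 \<le> p" and f: "strongly_measurable torus f" and g: "torus_average r f g"
  shows "Lp_norm p torus g \<le> Lp_norm p torus f"
proof (cases "Lp_norm p torus f = \<infinity>")
  case True
  then show ?thesis by simp
next
  case False
  then obtain c where c: "Lp_norm p torus f = ennreal c" "0 \<le> c" by (cases "Lp_norm p torus f") auto
  note [measurable] = f
  have gm: "strongly_measurable torus g" using g by (simp add: torus_average_def strongly_integrable_def)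
  note ae = torus_average_norm_le[OF g]
  show ?thesis
  proof (cases "p = \<infinity>")
    case True
    define u where "u \<omega> = ennreal (norm (f \<omega>) - c)" for \<omega>
    have um[measurable]: "u \<in> borel_measurable torus" unfolding u_def by measurable
    have "AE \<omega> in torus. ennreal (norm (f \<omega>)) \<le> ennreal c"
      using Lp_norm_le_iff_infinity[OF f, of "ennreal c"] c True by simp
    then have "AE \<omega> in torus. u \<omega> = 0" by eventually_elim (use c in \<open>simp add: u_def ennreal_eq_0_iff\<close>)
    then have "(\<integral>\<^sup>+\<omega>. u \<omega> \<partial>torus) = 0" by (subst nn_integral_0_iff_AE) auto
    then have "(\<integral>\<^sup>+\<omega>. \<integral>\<^sup>+\<eta>. u (torus_shift r (\<omega>, \<eta>)) \<partial>torus \<partial>torus) = 0"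
      by (simp add: nn_integral_torus_shift_iterated[OF r um])
    then have "AE \<omega> in torus. (\<integral>\<^sup>+\<eta>. u (torus_shift r (\<omega>, \<eta>)) \<partial>torus) = 0"
      using borel_measurable_nn_integral_torus_shift[OF r um] by (subst (asm) nn_integral_0_iff_AE) auto
    with ae have "AE \<omega> in torus. ennreal (norm (g \<omega>)) \<le> ennreal c"
      using AE_space
    proof eventually_elim
      case (elim \<omega>)
      note [measurable] = measurable_torus_shift_section[OF r elim(3)]
      have "ennreal (norm (g \<omega>)) \<le> (\<integral>\<^sup>+\<eta>. ennreal c + u (torus_shift r (\<omega>, \<eta>)) \<partial>torus)"
      proof (rule order_trans[OF elim(1)], rule nn_integral_mono)
        fix \<eta>
        show "ennreal (norm (f (torus_shift r (\<omega>, \<eta>)))) \<le> ennreal c + u (torus_shift r (\<omega>, \<eta>))"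
        proof (cases "norm (f (torus_shift r (\<omega>, \<eta>))) \<le> c")
          case True
          then show ?thesis by (intro add_increasing2 ennreal_leI) auto
        next
          case False
          then show ?thesis unfolding u_def using c by (subst ennreal_plus[symmetric]) auto
        qed
      qed
      also have "\<dots> = ennreal c + (\<integral>\<^sup>+\<eta>. u (torus_shift r (\<omega>, \<eta>)) \<partial>torus)"
        by (subst nn_integral_add) (auto simp: torus.emeasure_space_1)
      finally show ?case using elim(2) by simp
    qed
    then show ?thesis using Lp_norm_le_iff_infinity[OF gm, of "ennreal c"] True c by simp
  next
    case False
    define q where "q = enn2real p"
    have q: "1 \<le> q" using p False by (cases p) (auto simp: q_def)
    have "AE \<omega> in torus. ennreal (norm (g \<omega>) powr q) \<le> (\<integral>\<^sup>+\<eta>. ennreal (norm (f (torus_shift r (\<omega>, \<eta>))) powr q) \<partial>torus)"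
      using ae AE_space
    proof eventually_elim
      case (elim \<omega>)
      have "(\<lambda>\<eta>. norm (f (torus_shift r (\<omega>, \<eta>)))) \<in> borel_measurable torus"
        by (rule measurable_compose[OF measurable_compose[OF measurable_torus_shift_section[OF r elim(2)] strongly_measurable_imp_borel[OF f]] borel_measurable_norm])
      from torus.powr_le_nn_integral_powr[OF this _ q _ elim(1)] show ?case by simp
    qed
    then have "(\<integral>\<^sup>+\<omega>. ennreal (norm (g \<omega>) powr q) \<partial>torus) \<le> (\<integral>\<^sup>+\<omega>. \<integral>\<^sup>+\<eta>. ennreal (norm (f (torus_shift r (\<omega>, \<eta>))) powr q) \<partial>torus \<partial>torus)"
      by (rule nn_integral_mono_AE)
    also have "\<dots> = (\<integral>\<^sup>+\<omega>. ennreal (norm (f \<omega>) powr q) \<partial>torus)"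
      by (rule nn_integral_torus_shift_iterated[OF r, of "\<lambda>\<omega>. ennreal (norm (f \<omega>) powr q)"]) measurable
    also have "\<dots> \<le> ennreal (c powr q)"
      using Lp_norm_le_iff_finite[OF p False c(2), of torus f] c by (simp add: q_def)
    finally show ?thesis
      using Lp_norm_le_iff_finite[OF p False c(2), of torus g] c by (simp add: q_def)
  qed
qed

text \<open>
  A fast subsequence converges almost everywhere, and then Fatou's lemma applies, or for \<open>p = \<infinity>\<close> the pointwise bound passes to
  the limit.
\<close>

lemma Lp_norm_le_of_L1_limit:
  fixes f :: "'b \<Rightarrow> 'a::real_normed_vector"
  assumes p: "1 \<le> p" and f: "strongly_measurable M f" and g: "\<And>n::nat. strongly_measurable M (g n)"
    and lim: "(\<lambda>n. L1_norm M (\<lambda>x. g n x - f x)) \<longlonglongrightarrow> 0"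
    and le: "\<And>n. Lp_norm p M (g n) \<le> C"
  shows "Lp_norm p M f \<le> C"
proof (cases "C = \<infinity>")
  case True
  then show ?thesis by simp
next
  case False
  then obtain c where c: "C = ennreal c" "0 \<le> c" by (cases C) auto
  note dm = strongly_measurable_diff[OF g f]
  note [measurable] = f g dm
  have "\<exists>m. L1_norm M (\<lambda>x. g m x - f x) \<le> ennreal ((1/2)^n)" for n
  proof -
    have "\<forall>\<^sub>F m in sequentially. L1_norm M (\<lambda>x. g m x - f x) < ennreal ((1/2)^n)"
      by (rule order_tendstoD(2)[OF lim]) simp
    then show ?thesis using eventually_happens'[OF sequentially_bot] less_imp_le by blast
  qed
  then obtain m where m: "\<And>n. L1_norm M (\<lambda>x. g (m n) x - f x) \<le> ennreal ((1/2)^n)"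
    by metis
  have "AE x in M. (\<lambda>n. ennreal (norm (g (m n) x - f x))) \<longlonglongrightarrow> 0"
    by (rule fast_L1_null_imp_AE_null[OF _ m]) measurable
  then have conv: "AE x in M. (\<lambda>n. norm (g (m n) x)) \<longlonglongrightarrow> norm (f x)"
  proof eventually_elim
    case (elim x)
    from tendsto_zero_of_ennreal_norm[OF this] have "(\<lambda>n. g (m n) x) \<longlonglongrightarrow> f x" by (simp add: LIM_zero_iff)
    then show ?case by (rule tendsto_norm)
  qed
  show ?thesis
  proof (cases "p = \<infinity>")
    case True
    have "AE x in M. \<forall>n. ennreal (norm (g (m n) x)) \<le> ennreal c"
      using le c Lp_norm_le_iff_infinity[OF g] True by (auto simp: AE_all_countable)
    with conv have "AE x in M. ennreal (norm (f x)) \<le> ennreal c"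
    proof eventually_elim
      case (elim x)
      then show ?case using c by (intro ennreal_leI LIMSEQ_le_const2[OF elim(1)]) auto
    qed
    then show ?thesis using Lp_norm_le_iff_infinity[OF f] True c by simp
  next
    case False
    define q where "q = enn2real p"
    have q: "1 \<le> q" using p False by (cases p) (auto simp: q_def)
    have "(\<integral>\<^sup>+x. ennreal (norm (f x) powr q) \<partial>M) \<le> (\<integral>\<^sup>+x. liminf (\<lambda>n. ennreal (norm (g (m n) x) powr q)) \<partial>M)"
    proof (rule nn_integral_mono_AE, use conv in eventually_elim)
      case (elim x)
      have "(\<lambda>n. ennreal (norm (g (m n) x) powr q)) \<longlonglongrightarrow> ennreal (norm (f x) powr q)"
        using elim q by (intro tendsto_ennrealI tendsto_powr') auto
      from lim_imp_Liminf[OF trivial_limit_sequentially this] show ?case by simp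
    qed
    also have "\<dots> \<le> liminf (\<lambda>n. \<integral>\<^sup>+x. ennreal (norm (g (m n) x) powr q) \<partial>M)"
      by (rule nn_integral_liminf) auto
    also have "\<dots> \<le> liminf (\<lambda>n. ennreal (c powr q))"
      using le c Lp_norm_le_iff_finite[OF p False c(2), of M "g _"] by (intro Liminf_mono) (auto simp: q_def)
    also have "\<dots> = ennreal (c powr q)" by (rule Liminf_const) simp
    finally show ?thesis
      using Lp_norm_le_iff_finite[OF p False c(2), of M f] c by (simp add: q_def)
  qed
qed

section \<open>Dirichlet series\<close>

lemma bohr_lift_norm_unique:
  fixes a :: "nat \<Rightarrow> 'a::complex_banach"
  assumes p: "1 \<le> p" and "bohr_lift p a f" "bohr_lift p a g"
  shows "Lp_norm p torus f = Lp_norm p torus g"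
proof -
  have L: "f \<in> Lp_space p torus" "g \<in> Lp_space p torus" using assms by (auto simp: bohr_lift_def hardy_torus_def)
  note SI = L[THEN Lp_space_imp_strongly_integrable[OF p torus.finite_measure_axioms]]
  have "AE \<omega> in torus. f \<omega> - g \<omega> = 0"
  proof (rule fourier_coeff_zero_imp_AE_zero[OF strongly_integrable_diff[OF SI]])
    fix \<alpha> assume "\<alpha> \<in> fin_int_seqs"
    then have "fourier_coeff f \<alpha> = fourier_coeff g \<alpha>"
      using assms(2,3) by (cases "\<alpha> \<in> fin_nat_seqs") (auto simp: bohr_lift_def hardy_torus_def)
    then show "fourier_coeff (\<lambda>\<omega>. f \<omega> - g \<omega>) \<alpha> = 0" by (simp add: fourier_coeff_diff[OF SI])
  qed
  then have "AE \<omega> in torus. f \<omega> = g \<omega>" by eventually_elim simp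
  then show ?thesis using L by (intro Lp_norm_AE_cong) (auto simp: Lp_space_def)
qed

lemma hardy_dirichlet_norm_eq:
  fixes a :: "nat \<Rightarrow> 'a::complex_banach"
  assumes p: "1 \<le> p" and f: "bohr_lift p a f"
  shows "hardy_dirichlet_norm p a = Lp_norm p torus f"
  unfolding hardy_dirichlet_norm_def
proof (rule the_equality)
  show "\<exists>g. bohr_lift p a g \<and> Lp_norm p torus f = Lp_norm p torus g" using f by blast
  show "r = Lp_norm p torus f" if "\<exists>g. bohr_lift p a g \<and> r = Lp_norm p torus g" for r
    using that bohr_lift_norm_unique[OF p _ f] by blast
qed

definition prime_radii :: "real \<Rightarrow> nat \<Rightarrow> real" where
  "prime_radii \<epsilon> j = real (enumerate {q::nat. prime q} j) powr (- \<epsilon>)"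

lemma enumerate_prime_gt_1: "1 < enumerate {q::nat. prime q} j"
  using enumerate_in_set[OF primes_infinite, of j] prime_gt_1_nat by simp

lemma shift_radii_prime_radii: "0 < \<epsilon> \<Longrightarrow> shift_radii (prime_radii \<epsilon>)"
  unfolding shift_radii_def
proof (intro allI conjI)
  fix j assume "0 < \<epsilon>"
  have x: "1 < real (enumerate {q::nat. prime q} j)" using enumerate_prime_gt_1[of j] by simp
  show "0 \<le> prime_radii \<epsilon> j" by (simp add: prime_radii_def)
  show "prime_radii \<epsilon> j < 1"
    using powr_less_mono[of "-\<epsilon>" 0, OF _ x] \<open>0 < \<epsilon>\<close> x by (simp add: prime_radii_def)
qed

lemma moebius_factor_prime_radii:
  assumes "0 < \<epsilon>" "\<alpha> \<in> fin_nat_seqs"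
  shows "moebius_factor (prime_radii \<epsilon>) \<alpha> = 1 / of_nat (prime_power \<alpha>) powr of_real \<epsilon>"
proof -
  let ?p = "\<lambda>j. enumerate {q::nat. prime q} j"
  have r: "0 \<le> prime_radii \<epsilon> j" "prime_radii \<epsilon> j < 1" for j
    using shift_radii_prime_radii[OF assms(1)] by (auto simp: shift_radii_def)
  have "real (prime_power \<alpha>) powr \<epsilon> = (\<Prod>j | \<alpha> j \<noteq> 0. (real (?p j) ^ nat (\<alpha> j)) powr \<epsilon>)"
    by (simp add: prime_power_def prod_powr_distrib)
  also have "\<dots> = (\<Prod>j | \<alpha> j \<noteq> 0. inverse (prime_radii \<epsilon> j ^ nat (\<alpha> j)))"
  proof (rule prod.cong[OF refl])
    fix j
    have "0 < real (?p j)" using enumerate_prime_gt_1[of j] by simp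
    then show "(real (?p j) ^ nat (\<alpha> j)) powr \<epsilon> = inverse (prime_radii \<epsilon> j ^ nat (\<alpha> j))"
      by (simp add: prime_radii_def powr_minus power_inverse powr_powr powr_realpow[symmetric] mult.commute)
  qed
  finally have "real (prime_power \<alpha>) powr \<epsilon> = inverse (\<Prod>j | \<alpha> j \<noteq> 0. prime_radii \<epsilon> j ^ nat (\<alpha> j))"
    using prod_inversef[of "\<lambda>j. prime_radii \<epsilon> j ^ nat (\<alpha> j)" "{j. \<alpha> j \<noteq> 0}"] by (simp add: o_def)
  then have "(\<Prod>j | \<alpha> j \<noteq> 0. prime_radii \<epsilon> j ^ nat (\<alpha> j)) = 1 / real (prime_power \<alpha>) powr \<epsilon>"
    by (simp add: field_simps)
  then have "complex_of_real (\<Prod>j | \<alpha> j \<noteq> 0. prime_radii \<epsilon> j ^ nat (\<alpha> j)) = 1 / of_nat (prime_power \<alpha>) powr of_real \<epsilon>"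
    using powr_of_real[of "real (prime_power \<alpha>)" \<epsilon>] by simp
  then show ?thesis
    unfolding moebius_factor_def by (simp add: torus_integral_moebius_monomial[OF r assms(2)])
qed

lemma bohr_lift_translate:
  fixes a :: "nat \<Rightarrow> 'a::complex_banach"
  assumes p: "1 \<le> p" and \<epsilon>: "0 < \<epsilon>" and f: "bohr_lift p a f" and g: "torus_average (prime_radii \<epsilon>) f g"
  shows "bohr_lift p (translate (complex_of_real \<epsilon>) a) g"
proof -
  note r = shift_radii_prime_radii[OF \<epsilon>]
  have fL: "f \<in> Lp_space p torus" using f by (auto simp: bohr_lift_def hardy_torus_def)
  then have fI: "strongly_integrable torus f" by (rule Lp_space_imp_strongly_integrable[OF p torus.finite_measure_axioms])
  have "Lp_norm p torus g \<le> Lp_norm p torus f"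
    by (rule Lp_norm_torus_average_le[OF r p strongly_integrable_imp_measurable[OF fI] g])
  also have "\<dots> < \<infinity>" using fL by (simp add: Lp_space_def)
  finally have "g \<in> Lp_space p torus"
    using g by (simp add: Lp_space_def torus_average_def strongly_integrable_def)
  moreover have coeff: "fourier_coeff g \<alpha> = scaleC (moebius_factor (prime_radii \<epsilon>) \<alpha>) (fourier_coeff f \<alpha>)"
    if "\<alpha> \<in> fin_int_seqs" for \<alpha>
    by (rule torus_average_fourier_coeff[OF r that fI g])
  moreover have "fin_nat_seqs \<subseteq> fin_int_seqs" by (auto simp: fin_nat_seqs_def)
  ultimately show ?thesis
    using f by (auto simp: bohr_lift_def hardy_torus_def translate_def moebius_factor_prime_radii[OF \<epsilon>] scaleC.zero_right)
qed

lemma prime_radii_tendsto_1: "(\<lambda>n. prime_radii (1 / real (Suc n)) j) \<longlonglongrightarrow> 1"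
proof -
  have "0 < real (enumerate {q::nat. prime q} j)" using enumerate_prime_gt_1[of j] by simp
  moreover have "(\<lambda>n. - (1 / real (Suc n))) \<longlonglongrightarrow> - 0"
    by (intro tendsto_minus LIMSEQ_Suc[OF lim_1_over_n])
  ultimately have "(\<lambda>n. prime_radii (1 / real (Suc n)) j) \<longlonglongrightarrow> real (enumerate {q::nat. prime q} j) powr (- 0)"
    unfolding prime_radii_def by (intro tendsto_powr tendsto_const) auto
  then show ?thesis using \<open>0 < real _\<close> by simp
qed

theorem theorem2p1:
  fixes p :: ennreal
  assumes "1 \<le> p"
  shows "(hardy_dirichlet p :: (nat \<Rightarrow> 'a::complex_banach) set) \<subseteq> hardy_dirichlet_plus p \<and>
    (\<forall>D \<in> (hardy_dirichlet p :: (nat \<Rightarrow> 'a) set).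
       hardy_dirichlet_plus_norm p D = hardy_dirichlet_norm p D)"
proof -
  have "D \<in> hardy_dirichlet_plus p \<and> hardy_dirichlet_plus_norm p D = hardy_dirichlet_norm p D"
    if D: "D \<in> hardy_dirichlet p" for D :: "nat \<Rightarrow> 'a"
  proof -
    from D obtain f where f: "bohr_lift p D f" and D0: "D \<in> dirichlet_series"
      by (auto simp: hardy_dirichlet_def)
    have fL: "f \<in> Lp_space p torus" using f by (auto simp: bohr_lift_def hardy_torus_def)
    then have fI: "strongly_integrable torus f" by (rule Lp_space_imp_strongly_integrable[OF assms torus.finite_measure_axioms])
    note fm = strongly_integrable_imp_measurable[OF fI]
    have "\<exists>g. torus_average (prime_radii \<epsilon>) f g" if "0 < \<epsilon>" for \<epsilon>
      by (rule torus_average_exists[OF shift_radii_prime_radii[OF that] fI])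
    then have "\<forall>\<epsilon>. \<exists>g. 0 < \<epsilon> \<longrightarrow> torus_average (prime_radii \<epsilon>) f g" by blast
    from choice[OF this] obtain g where "\<forall>\<epsilon>. 0 < \<epsilon> \<longrightarrow> torus_average (prime_radii \<epsilon>) f (g \<epsilon>)" ..
    then have g: "torus_average (prime_radii \<epsilon>) f (g \<epsilon>)" if "0 < \<epsilon>" for \<epsilon> using that by simp
    have lift: "bohr_lift p (translate (complex_of_real \<epsilon>) D) (g \<epsilon>)" if "0 < \<epsilon>" for \<epsilon>
      by (rule bohr_lift_translate[OF assms that f g[OF that]])
    have norm_g: "hardy_dirichlet_norm p (translate (complex_of_real \<epsilon>) D) = Lp_norm p torus (g \<epsilon>)" if "0 < \<epsilon>" for \<epsilon>
      by (rule hardy_dirichlet_norm_eq[OF assms lift[OF that]])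
    have "translate z D \<in> dirichlet_series" for z
      using D0 by (simp add: dirichlet_series_def translate_def scaleC.zero_right)
    then have mem: "translate (complex_of_real \<epsilon>) D \<in> hardy_dirichlet p" if "0 < \<epsilon>" for \<epsilon>
      using lift[OF that] by (auto simp: hardy_dirichlet_def)
    have norm_f: "hardy_dirichlet_norm p D = Lp_norm p torus f"
      by (rule hardy_dirichlet_norm_eq[OF assms f])
    have plus: "hardy_dirichlet_plus_norm p D = (SUP \<epsilon>\<in>{0<..}. Lp_norm p torus (g \<epsilon>))"
      unfolding hardy_dirichlet_plus_norm_def by (intro SUP_cong) (auto simp: norm_g)
    have le: "(SUP \<epsilon>\<in>{0<..}. Lp_norm p torus (g \<epsilon>)) \<le> Lp_norm p torus f"
      by (rule SUP_least) (auto intro!: Lp_norm_torus_average_le[OF shift_radii_prime_radii assms fm g])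
    have "Lp_norm p torus f \<le> (SUP \<epsilon>\<in>{0<..}. Lp_norm p torus (g \<epsilon>))"
    proof (rule Lp_norm_le_of_L1_limit[OF assms fm, where g="\<lambda>n. g (1 / real (Suc n))"])
      show "strongly_measurable torus (g (1 / real (Suc n)))" for n
        using g[of "1 / real (Suc n)"] by (simp add: torus_average_def strongly_integrable_def)
      show "(\<lambda>n. L1_norm torus (\<lambda>\<omega>. g (1 / real (Suc n)) \<omega> - f \<omega>)) \<longlonglongrightarrow> 0"
        by (rule torus_average_L1_tendsto[OF shift_radii_prime_radii prime_radii_tendsto_1 fI g]) auto
      show "Lp_norm p torus (g (1 / real (Suc n))) \<le> (SUP \<epsilon>\<in>{0<..}. Lp_norm p torus (g \<epsilon>))" for n
        by (rule SUP_upper) simp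
    qed
    with le plus norm_f have eq: "hardy_dirichlet_plus_norm p D = hardy_dirichlet_norm p D" by simp
    moreover have "hardy_dirichlet_norm p D < \<infinity>" using fL norm_f by (simp add: Lp_space_def)
    ultimately show ?thesis using D0 mem by (simp add: hardy_dirichlet_plus_def)
  qed
  then show ?thesis by blast
qed

end
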